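(* Let $(\mathcal{M},g,K)$ be an optical geometry of dimension $2m+2$ with congruence of null curves $\mathcal{K}$. Let $\kappa_a$ be an optical $1$-form and set $\tau_{abc}:=3\,\kappa_{[a}\nabla_b\kappa_{c]}$. The following two conditions are equivalent: (1) the $3$-form $\tau_{abc}$ satisfies $$\tau_{ab}{}^{e}\tau_{ecd}=-\frac{2}{m}\,\tau_{[a}{}^{ef}g_{b][c}\tau_{d]ef}\neq0;$$ (2) $\mathcal{K}$ is geodesic and twisting, and there exists a unique optical vector field $k$ whose twist endomorphism $h^{-1}\circ\tau$ is a bundle complex structure $J$ compatible with $h$ on the screen bundle $(H_K,h)$, i.e. $J=h^{-1}\circ\tau$. In particular, the twist of $\mathcal{K}$ induces an almost Robinson structure $(N,K)$ on $(\mathcal{M},g,K)$, and $\kappa=g(k,\cdot)$ determines a unique Robinson $3$-form given by $\rho_{abc}=3\,\kappa_{[a}\nabla_b\kappa_{c]}$.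
   Context: An optical geometry $(\mathcal{M},g,K)$ is an oriented, time-oriented Lorentzian manifold with a null line distribution $K\subset T\mathcal{M}$, oriented by the orientation and time-orientation of $\mathcal{M}$; $\nabla$ is the Levi-Civita connection and indices are raised and lowered with $g$. An optical vector field is a nonvanishing (positively oriented) section $k$ of $K$; an optical $1$-form is $\kappa=g(k,\cdot)$. $\mathcal{K}$ is the congruence of integral curves of $K$. The screen bundle $H_K=K^\perp/K$ carries the induced positive-definite bundle metric $h$. If $\mathcal{K}$ is geodesic, the twist of $k$ is the $2$-form $\tau_{ij}$ on $H_K$ obtained by restricting $\nabla_{[a}\kappa_{b]}$ to $K^\perp$ (which descends to $K^\perp/K$); $\mathcal{K}$ is twisting if it does not vanish. The endomorphism $h^{-1}\circ\tau$ is $\tau_i{}^j=\tau_{ik}h^{kj}$. The symbol $\neq0$ in (1) means nowhere vanishing. Given a bundle complex structure $J$ on $H_K$ compatible with $h$, the associated almost Robinson structure is $(N,K)$ with $N=\{v\in{}^{\mathbb{C}}K^\perp: J(v+{}^{\mathbb{C}}K)=-iv+{}^{\mathbb{C}}K\}$, a totally null complex rank-$(m+1)$ distribution with $N\cap\overline N={}^{\mathbb{C}}K$. The Robinson $3$-form associated to an optical $1$-form $\kappa$ is $\rho_{abc}=3\kappa_{[a}\omega_{bc]}$, where $\omega_{ij}=J_i{}^kh_{kj}$ is extended to $T\mathcal{M}$ (the result does not depend on the extension). Brackets $[\ ]$ denote skew-symmetrisation with factor $1/p!$. *)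

theory Defs
  imports "HOL-Analysis.Analysis"
begin

section \<open>Smooth functions and oriented smooth manifolds\<close>

text \<open>Continuous differentiability up to order \<open>n\<close>; only used for open \<open>S\<close>.\<close>

fun Ck_on :: "nat \<Rightarrow> 'v::real_normed_vector set \<Rightarrow> ('v \<Rightarrow> 'w::real_normed_vector) \<Rightarrow> bool" where
  "Ck_on 0 S f \<longleftrightarrow> continuous_on S f"
| "Ck_on (Suc n) S f \<longleftrightarrow> (\<forall>x\<in>S. f differentiable (at x)) \<and>
     (\<forall>v. Ck_on n S (\<lambda>x. frechet_derivative f (at x) v))"

definition smooth_on :: "'v::real_normed_vector set \<Rightarrow> ('v \<Rightarrow> 'w::real_normed_vector) \<Rightarrow> bool" where
  "smooth_on S f \<longleftrightarrow> (\<forall>n. Ck_on n S f)"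

definition partial :: "'n::finite \<Rightarrow> (real^'n \<Rightarrow> real) \<Rightarrow> real^'n \<Rightarrow> real" where
  "partial i f x = frechet_derivative f (at x) (axis i 1)"

text \<open>A chart is a pair of its domain and its coordinate map (meaningful on the domain only).\<close>

type_synonym ('a, 'n) chart = "'a set \<times> ('a \<Rightarrow> real^'n)"

abbreviation chart_inv :: "('a, 'n) chart \<Rightarrow> real^'n \<Rightarrow> 'a" where
  "chart_inv c \<equiv> inv_into (fst c) (snd c)"

definition jacobian :: "('a, 'n::finite) chart \<Rightarrow> ('a, 'n) chart \<Rightarrow> 'a \<Rightarrow> real^'n^'n" where
  "jacobian c d p = matrix (frechet_derivative (snd d \<circ> chart_inv c) (at (snd c p)))"

definition oriented_atlas :: "('a::topological_space, 'n::finite) chart set \<Rightarrow> bool" where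
  "oriented_atlas A \<longleftrightarrow>
     (\<Union>c\<in>A. fst c) = UNIV \<and>
     (\<forall>c\<in>A. open (fst c) \<and> open (snd c ` fst c) \<and>
        homeomorphism (fst c) (snd c ` fst c) (snd c) (chart_inv c)) \<and>
     (\<forall>c\<in>A. \<forall>d\<in>A. smooth_on (snd c ` (fst c \<inter> fst d)) (snd d \<circ> chart_inv c) \<and>
        (\<forall>p \<in> fst c \<inter> fst d. det (jacobian c d p) > 0))"

text \<open>
  The manifold is the whole type, carrying the topology of its type class. The fields
  are: an oriented atlas, the Lorentzian metric, the future timecone at each point (the
  time-orientation), and the null line distribution $K$.

  The tangent space at a point \<open>p\<close> is \<open>real^'n\<close>, identified by means of the coordinate basis
  of a fixed preferred chart around \<open>p\<close> (see \<open>chart_at\<close> below). Vectors, covectors and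
  covariant tensors at \<open>p\<close> are given by their components in that basis; their components in
  any other chart are obtained by the usual transformation laws.
\<close>

record ('a, 'n) optical_data =
  atlas :: "('a, 'n) chart set"
  metric :: "'a \<Rightarrow> real^'n^'n"
  future :: "'a \<Rightarrow> (real^'n) set"
  line :: "'a \<Rightarrow> (real^'n) set"

definition chart_at :: "('a, 'n::finite) optical_data \<Rightarrow> 'a \<Rightarrow> ('a, 'n) chart" where
  "chart_at M p = (SOME c. c \<in> atlas M \<and> p \<in> fst c)"

definition vec_in :: "('a, 'n::finite) optical_data \<Rightarrow> ('a, 'n) chart \<Rightarrow> ('a \<Rightarrow> real^'n) \<Rightarrow> 'a \<Rightarrow> real^'n" where
  "vec_in M c X p = jacobian (chart_at M p) c p *v X p"

definition form_in :: "('a, 'n::finite) optical_data \<Rightarrow> ('a, 'n) chart \<Rightarrow> ('a \<Rightarrow> real^'n) \<Rightarrow> 'a \<Rightarrow> real^'n" where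
  "form_in M c \<alpha> p = transpose (jacobian c (chart_at M p) p) *v \<alpha> p"

definition tensor2_in :: "('a, 'n::finite) optical_data \<Rightarrow> ('a, 'n) chart \<Rightarrow> ('a \<Rightarrow> real^'n^'n) \<Rightarrow> 'a \<Rightarrow> real^'n^'n" where
  "tensor2_in M c T p =
     transpose (jacobian c (chart_at M p) p) ** T p ** jacobian c (chart_at M p) p"

definition smooth_vec_on :: "('a, 'n::finite) optical_data \<Rightarrow> 'a set \<Rightarrow> ('a \<Rightarrow> real^'n) \<Rightarrow> bool" where
  "smooth_vec_on M U X \<longleftrightarrow>
     (\<forall>c\<in>atlas M. smooth_on (snd c ` (fst c \<inter> U)) (\<lambda>x. vec_in M c X (chart_inv c x)))"

definition smooth_tensor2 :: "('a, 'n::finite) optical_data \<Rightarrow> ('a \<Rightarrow> real^'n^'n) \<Rightarrow> bool" where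
  "smooth_tensor2 M T \<longleftrightarrow>
     (\<forall>c\<in>atlas M. smooth_on (snd c ` fst c) (\<lambda>x. tensor2_in M c T (chart_inv c x)))"


section \<open>Optical geometries\<close>

definition eval2 :: "real^'n^'n \<Rightarrow> real^'n \<Rightarrow> real^'n \<Rightarrow> real" where
  "eval2 T v w = (\<Sum>a\<in>UNIV. \<Sum>b\<in>UNIV. T $ a $ b * v $ a * w $ b)"

abbreviation gform :: "('a, 'n::finite) optical_data \<Rightarrow> 'a \<Rightarrow> real^'n \<Rightarrow> real^'n \<Rightarrow> real" where
  "gform M p \<equiv> eval2 (metric M p)"

text \<open>Signature $(+,\dots,+,-)$: there is an orthonormal frame with exactly one timelike vector.\<close>

definition lorentzian :: "real^'n^'n::finite \<Rightarrow> bool" where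
  "lorentzian G \<longleftrightarrow> transpose G = G \<and>
     (\<exists>(e :: 'n \<Rightarrow> real^'n) i0. \<forall>i j.
        eval2 G (e i) (e j) = (if i \<noteq> j then 0 else if i = i0 then -1 else 1))"

definition time_orientation :: "('a::topological_space, 'n::finite) optical_data \<Rightarrow> bool" where
  "time_orientation M \<longleftrightarrow>
     (\<forall>p. \<exists>t. gform M p t t < 0 \<and>
        future M p = {u. gform M p u u < 0 \<and> gform M p t u < 0}) \<and>
     (\<forall>p. \<exists>U X. open U \<and> p \<in> U \<and> smooth_vec_on M U X \<and> (\<forall>q\<in>U. X q \<in> future M q))"

definition null_line_distribution :: "('a::topological_space, 'n::finite) optical_data \<Rightarrow> bool" where
  "null_line_distribution M \<longleftrightarrow>
     (\<forall>p. subspace (line M p) \<and> dim (line M p) = 1 \<and> (\<forall>v\<in>line M p. gform M p v v = 0)) \<and>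
     (\<forall>p. \<exists>U F. open U \<and> p \<in> U \<and> finite F \<and> (\<forall>X\<in>F. smooth_vec_on M U X) \<and>
        (\<forall>q\<in>U. line M q = span ((\<lambda>X. X q) ` F)))"

definition optical_geometry ::
  "('a::{t2_space,second_countable_topology}, 'n::finite) optical_data \<Rightarrow> bool" where
  "optical_geometry M \<longleftrightarrow>
     oriented_atlas (atlas M) \<and>
     smooth_tensor2 M (metric M) \<and> (\<forall>p. lorentzian (metric M p)) \<and>
     time_orientation M \<and> null_line_distribution M"

text \<open>$K$ is oriented such that its positive nonzero vectors are the future-directed ones.\<close>

definition optical_vector_field :: "('a, 'n::finite) optical_data \<Rightarrow> ('a \<Rightarrow> real^'n) \<Rightarrow> bool" where
  "optical_vector_field M k \<longleftrightarrow> smooth_vec_on M UNIV k \<and>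
     (\<forall>p. k p \<in> line M p \<and> k p \<noteq> 0 \<and> (\<forall>t\<in>future M p. gform M p (k p) t < 0))"

definition flat :: "('a, 'n::finite) optical_data \<Rightarrow> ('a \<Rightarrow> real^'n) \<Rightarrow> 'a \<Rightarrow> real^'n" where
  "flat M X p = (\<chi> b. \<Sum>a\<in>UNIV. metric M p $ a $ b * X p $ a)"

definition optical_form :: "('a, 'n::finite) optical_data \<Rightarrow> ('a \<Rightarrow> real^'n) \<Rightarrow> bool" where
  "optical_form M \<kappa> \<longleftrightarrow> (\<exists>k. optical_vector_field M k \<and> \<kappa> = flat M k)"


section \<open>The Levi-Civita connection\<close>

text \<open>
  \<open>christoffel M p e a b\<close> is $\Gamma^e_{ab}$ at \<open>p\<close> in the preferred chart around \<open>p\<close>. The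
  covariant derivatives at \<open>p\<close> are also computed in that chart; as they are tensorial, this
  choice does not matter. The first index of \<open>nabla_vec\<close> and \<open>nabla_form\<close> is that of the
  derivative: they are $\nabla_a X^b$ and $\nabla_a \alpha_b$.
\<close>

definition christoffel :: "('a, 'n::finite) optical_data \<Rightarrow> 'a \<Rightarrow> 'n \<Rightarrow> 'n \<Rightarrow> 'n \<Rightarrow> real" where
  "christoffel M p e a b =
     (let c = chart_at M p; x = snd c p;
          g = (\<lambda>i j y. tensor2_in M c (metric M) (chart_inv c y) $ i $ j)
      in 1/2 * (\<Sum>d\<in>UNIV. matrix_inv (metric M p) $ e $ d *
           (partial a (g b d) x + partial b (g a d) x - partial d (g a b) x)))"

definition nabla_vec :: "('a, 'n::finite) optical_data \<Rightarrow> ('a \<Rightarrow> real^'n) \<Rightarrow> 'a \<Rightarrow> 'n \<Rightarrow> 'n \<Rightarrow> real" where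
  "nabla_vec M X p a b =
     (let c = chart_at M p
      in partial a (\<lambda>y. vec_in M c X (chart_inv c y) $ b) (snd c p)
         + (\<Sum>e\<in>UNIV. christoffel M p b a e * X p $ e))"

definition nabla_form :: "('a, 'n::finite) optical_data \<Rightarrow> ('a \<Rightarrow> real^'n) \<Rightarrow> 'a \<Rightarrow> 'n \<Rightarrow> 'n \<Rightarrow> real" where
  "nabla_form M \<alpha> p a b =
     (let c = chart_at M p
      in partial a (\<lambda>y. form_in M c \<alpha> (chart_inv c y) $ b) (snd c p)
         - (\<Sum>e\<in>UNIV. christoffel M p e a b * \<alpha> p $ e))"

definition skew2 :: "('n \<Rightarrow> 'n \<Rightarrow> real) \<Rightarrow> 'n \<Rightarrow> 'n \<Rightarrow> real" where
  "skew2 T a b = (T a b - T b a) / 2"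

definition skew3 :: "('n \<Rightarrow> 'n \<Rightarrow> 'n \<Rightarrow> real) \<Rightarrow> 'n \<Rightarrow> 'n \<Rightarrow> 'n \<Rightarrow> real" where
  "skew3 T a b c = (T a b c + T b c a + T c a b - T b a c - T a c b - T c b a) / 6"

text \<open>$\tau_{abc} = 3 \kappa_{[a} \nabla_b \kappa_{c]}$\<close>

definition tau3 :: "('a, 'n::finite) optical_data \<Rightarrow> ('a \<Rightarrow> real^'n) \<Rightarrow> 'a \<Rightarrow> 'n \<Rightarrow> 'n \<Rightarrow> 'n \<Rightarrow> real" where
  "tau3 M \<kappa> p a b c = 3 * skew3 (\<lambda>a b c. \<kappa> p $ a * nabla_form M \<kappa> p b c) a b c"

text \<open>\<open>raise3 G T a b e\<close> is $T_{ab}{}^e$ and \<open>raise23 G T a e f\<close> is $T_a{}^{ef}$.\<close>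

definition raise3 :: "real^'n^'n::finite \<Rightarrow> ('n \<Rightarrow> 'n \<Rightarrow> 'n \<Rightarrow> real) \<Rightarrow> 'n \<Rightarrow> 'n \<Rightarrow> 'n \<Rightarrow> real" where
  "raise3 G T a b e = (\<Sum>f\<in>UNIV. T a b f * matrix_inv G $ f $ e)"

definition raise23 :: "real^'n^'n::finite \<Rightarrow> ('n \<Rightarrow> 'n \<Rightarrow> 'n \<Rightarrow> real) \<Rightarrow> 'n \<Rightarrow> 'n \<Rightarrow> 'n \<Rightarrow> real" where
  "raise23 G T a e f =
     (\<Sum>i\<in>UNIV. \<Sum>j\<in>UNIV. T a i j * matrix_inv G $ i $ e * matrix_inv G $ j $ f)"

text \<open>$T_{[a}{}^{ef} g_{b][c} T_{d]ef}$, skew in $ab$ and in $cd$\<close>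

definition skew_square :: "real^'n^'n::finite \<Rightarrow> ('n \<Rightarrow> 'n \<Rightarrow> 'n \<Rightarrow> real) \<Rightarrow> 'n \<Rightarrow> 'n \<Rightarrow> 'n \<Rightarrow> 'n \<Rightarrow> real" where
  "skew_square G T a b c d =
     skew2 (\<lambda>a b. skew2 (\<lambda>c d.
        \<Sum>e\<in>UNIV. \<Sum>f\<in>UNIV. raise23 G T a e f * G $ b $ c * T d e f) c d) a b"


section \<open>The screen bundle and the twist\<close>

definition perp :: "('a, 'n::finite) optical_data \<Rightarrow> 'a \<Rightarrow> (real^'n) set" where
  "perp M p = {v. \<forall>u\<in>line M p. gform M p u v = 0}"

definition screen_rel :: "('a, 'n::finite) optical_data \<Rightarrow> 'a \<Rightarrow> ((real^'n) \<times> (real^'n)) set" where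
  "screen_rel M p = {(v, w). v \<in> perp M p \<and> w \<in> perp M p \<and> v - w \<in> line M p}"

definition screen :: "('a, 'n::finite) optical_data \<Rightarrow> 'a \<Rightarrow> (real^'n) set set" where
  "screen M p = perp M p // screen_rel M p"

abbreviation screen_class :: "('a, 'n::finite) optical_data \<Rightarrow> 'a \<Rightarrow> real^'n \<Rightarrow> (real^'n) set" where
  "screen_class M p v \<equiv> screen_rel M p `` {v}"

definition screen_add :: "('a, 'n::finite) optical_data \<Rightarrow> 'a \<Rightarrow> (real^'n) set \<Rightarrow> (real^'n) set \<Rightarrow> (real^'n) set" where
  "screen_add M p V W = (\<Union>v\<in>V. \<Union>w\<in>W. screen_class M p (v + w))"

definition screen_scale :: "('a, 'n::finite) optical_data \<Rightarrow> 'a \<Rightarrow> real \<Rightarrow> (real^'n) set \<Rightarrow> (real^'n) set" where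
  "screen_scale M p r V = (\<Union>v\<in>V. screen_class M p (r *\<^sub>R v))"

definition screen_metric :: "('a, 'n::finite) optical_data \<Rightarrow> 'a \<Rightarrow> (real^'n) set \<Rightarrow> (real^'n) set \<Rightarrow> real" where
  "screen_metric M p V W = the_elem (\<Union>v\<in>V. \<Union>w\<in>W. {gform M p v w})"

definition geodesic :: "('a::topological_space, 'n::finite) optical_data \<Rightarrow> bool" where
  "geodesic M \<longleftrightarrow>
     (\<forall>U X. open U \<and> smooth_vec_on M U X \<and> (\<forall>q\<in>U. X q \<in> line M q) \<longrightarrow>
        (\<forall>p\<in>U. (\<chi> b. \<Sum>a\<in>UNIV. X p $ a * nabla_vec M X p a b) \<in> line M p))"

text \<open>The value of the twist on two classes is well defined only for a geodesic congruence.\<close>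

definition twist :: "('a, 'n::finite) optical_data \<Rightarrow> ('a \<Rightarrow> real^'n) \<Rightarrow> 'a \<Rightarrow> (real^'n) set \<Rightarrow> (real^'n) set \<Rightarrow> real" where
  "twist M k p V W =
     the_elem (\<Union>v\<in>V. \<Union>w\<in>W. {eval2 (\<chi> a b. skew2 (nabla_form M (flat M k) p) a b) v w})"

definition twisting :: "('a, 'n::finite) optical_data \<Rightarrow> bool" where
  "twisting M \<longleftrightarrow>
     (\<forall>k. optical_vector_field M k \<longrightarrow>
        (\<forall>p. \<exists>V\<in>screen M p. \<exists>W\<in>screen M p. twist M k p V W \<noteq> 0))"

text \<open>$\tau_i{}^j = \tau_{ik} h^{kj}$ is the endomorphism with $h(\tau(V), W) = \tau(V, W)$.\<close>

definition twist_endo :: "('a, 'n::finite) optical_data \<Rightarrow> ('a \<Rightarrow> real^'n) \<Rightarrow> 'a \<Rightarrow> (real^'n) set \<Rightarrow> (real^'n) set" where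
  "twist_endo M k p V =
     (THE Z. Z \<in> screen M p \<and> (\<forall>W\<in>screen M p. screen_metric M p Z W = twist M k p V W))"

definition screen_linear :: "('a, 'n::finite) optical_data \<Rightarrow> 'a \<Rightarrow> ((real^'n) set \<Rightarrow> (real^'n) set) \<Rightarrow> bool" where
  "screen_linear M p L \<longleftrightarrow>
     (\<forall>V\<in>screen M p. L V \<in> screen M p) \<and>
     (\<forall>V\<in>screen M p. \<forall>W\<in>screen M p.
        L (screen_add M p V W) = screen_add M p (L V) (L W)) \<and>
     (\<forall>r. \<forall>V\<in>screen M p. L (screen_scale M p r V) = screen_scale M p r (L V))"

text \<open>The last conjunct is the smoothness of $J$: it maps smooth sections to smooth sections,
  where a smooth section of the screen bundle is locally the class of a smooth section of
  $K^\perp$.\<close>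

definition bundle_complex_structure ::
  "('a::topological_space, 'n::finite) optical_data \<Rightarrow> ('a \<Rightarrow> (real^'n) set \<Rightarrow> (real^'n) set) \<Rightarrow> bool" where
  "bundle_complex_structure M J \<longleftrightarrow>
     (\<forall>p. screen_linear M p (J p) \<and> (\<forall>V\<in>screen M p. J p (J p V) = screen_scale M p (-1) V)) \<and>
     (\<forall>U X. open U \<and> smooth_vec_on M U X \<and> (\<forall>q\<in>U. X q \<in> perp M q) \<longrightarrow>
        (\<forall>p\<in>U. \<exists>U' Y. open U' \<and> p \<in> U' \<and> U' \<subseteq> U \<and> smooth_vec_on M U' Y \<and>
           (\<forall>q\<in>U'. Y q \<in> perp M q \<and>
              J q (screen_class M q (X q)) = screen_class M q (Y q))))"

definition screen_compatible ::
  "('a, 'n::finite) optical_data \<Rightarrow> ('a \<Rightarrow> (real^'n) set \<Rightarrow> (real^'n) set) \<Rightarrow> bool" where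
  "screen_compatible M J \<longleftrightarrow>
     (\<forall>p. \<forall>V\<in>screen M p. \<forall>W\<in>screen M p.
        screen_metric M p (J p V) (J p W) = screen_metric M p V W)"


section \<open>Almost Robinson structures\<close>

definition re_vec :: "complex^'n \<Rightarrow> real^'n" where
  "re_vec v = (\<chi> a. Re (v $ a))"

definition im_vec :: "complex^'n \<Rightarrow> real^'n" where
  "im_vec v = (\<chi> a. Im (v $ a))"

definition cnj_vec :: "complex^'n \<Rightarrow> complex^'n" where
  "cnj_vec v = (\<chi> a. cnj (v $ a))"

definition complexification :: "(real^'n) set \<Rightarrow> (complex^'n) set" where
  "complexification S = {v. re_vec v \<in> S \<and> im_vec v \<in> S}"

definition cgform :: "('a, 'n::finite) optical_data \<Rightarrow> 'a \<Rightarrow> complex^'n \<Rightarrow> complex^'n \<Rightarrow> complex" where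
  "cgform M p v w = (\<Sum>a\<in>UNIV. \<Sum>b\<in>UNIV. of_real (metric M p $ a $ b) * v $ a * w $ b)"

definition smooth_cvec_on :: "('a, 'n::finite) optical_data \<Rightarrow> 'a set \<Rightarrow> ('a \<Rightarrow> complex^'n) \<Rightarrow> bool" where
  "smooth_cvec_on M U Z \<longleftrightarrow>
     smooth_vec_on M U (\<lambda>p. re_vec (Z p)) \<and> smooth_vec_on M U (\<lambda>p. im_vec (Z p))"

text \<open>With $\dim \mathcal{M} = 2m+2$, the rank of $N$ is $m+1$.\<close>

definition almost_robinson_structure ::
  "('a::topological_space, 'n::finite) optical_data \<Rightarrow> ('a \<Rightarrow> (complex^'n) set) \<Rightarrow> bool" where
  "almost_robinson_structure M N \<longleftrightarrow>
     (\<forall>p. vec.subspace (N p) \<and> 2 * vec.dim (N p) = CARD('n) \<and>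
        (\<forall>v\<in>N p. \<forall>w\<in>N p. cgform M p v w = 0) \<and>
        N p \<inter> cnj_vec ` N p = complexification (line M p)) \<and>
     (\<forall>p. \<exists>U F. open U \<and> p \<in> U \<and> finite F \<and> (\<forall>Z\<in>F. smooth_cvec_on M U Z) \<and>
        (\<forall>q\<in>U. N q = vec.span ((\<lambda>Z. Z q) ` F)))"

definition cscreen_class :: "('a, 'n::finite) optical_data \<Rightarrow> 'a \<Rightarrow> complex^'n \<Rightarrow> (complex^'n) set" where
  "cscreen_class M p v =
     {w \<in> complexification (perp M p). w - v \<in> complexification (line M p)}"

text \<open>The complex-linear extension of a screen endomorphism to ${}^{\mathbb{C}}K^\perp/{}^{\mathbb{C}}K$,
  acting on real and imaginary parts\<close>

definition complexify_endo ::
  "('a, 'n::finite) optical_data \<Rightarrow> 'a \<Rightarrow> ((real^'n) set \<Rightarrow> (real^'n) set) \<Rightarrow> (complex^'n) set \<Rightarrow> (complex^'n) set" where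
  "complexify_endo M p L V =
     (\<Union>v\<in>V. {w. re_vec w \<in> L (screen_class M p (re_vec v)) \<and>
                im_vec w \<in> L (screen_class M p (im_vec v))})"

definition robinson_distribution ::
  "('a, 'n::finite) optical_data \<Rightarrow> ('a \<Rightarrow> (real^'n) set \<Rightarrow> (real^'n) set) \<Rightarrow> 'a \<Rightarrow> (complex^'n) set" where
  "robinson_distribution M J p =
     {v \<in> complexification (perp M p).
        complexify_endo M p (J p) (cscreen_class M p v) = cscreen_class M p ((-\<i>) *s v)}"

text \<open>$\omega_{ij} = J_i{}^k h_{kj}$, that is $\omega(V, W) = h(J V, W)$\<close>

definition extends_hermitian_form ::
  "('a, 'n::finite) optical_data \<Rightarrow> ('a \<Rightarrow> (real^'n) set \<Rightarrow> (real^'n) set) \<Rightarrow> ('a \<Rightarrow> real^'n^'n) \<Rightarrow> bool" where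
  "extends_hermitian_form M J \<Omega> \<longleftrightarrow>
     smooth_tensor2 M \<Omega> \<and> (\<forall>p. transpose (\<Omega> p) = - \<Omega> p) \<and>
     (\<forall>p. \<forall>v\<in>perp M p. \<forall>w\<in>perp M p.
        eval2 (\<Omega> p) v w =
          screen_metric M p (J p (screen_class M p v)) (screen_class M p w))"

definition robinson_3_form ::
  "('a, 'n::finite) optical_data \<Rightarrow> ('a \<Rightarrow> (real^'n) set \<Rightarrow> (real^'n) set) \<Rightarrow> ('a \<Rightarrow> real^'n) \<Rightarrow>
    ('a \<Rightarrow> 'n \<Rightarrow> 'n \<Rightarrow> 'n \<Rightarrow> real) \<Rightarrow> bool" where
  "robinson_3_form M J \<kappa> \<rho> \<longleftrightarrow>
     (\<exists>\<Omega>. extends_hermitian_form M J \<Omega> \<and>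
        (\<forall>p a b c. \<rho> p a b c = 3 * skew3 (\<lambda>a b c. \<kappa> p $ a * \<Omega> p $ b $ c) a b c))"

text \<open>The twist of \<open>k\<close> is a bundle complex structure compatible with the screen bundle metric.\<close>

definition twist_is_complex_structure ::
  "('a::topological_space, 'n::finite) optical_data \<Rightarrow> ('a \<Rightarrow> real^'n) \<Rightarrow> bool" where
  "twist_is_complex_structure M k \<longleftrightarrow>
     bundle_complex_structure M (twist_endo M k) \<and> screen_compatible M (twist_endo M k)"

end

theory Submission
  imports Defs
begin

text \<open>
  Let \<open>\<kappa> = g(k,\<cdot>)\<close> be an optical 1-form and \<open>F\<close> its skew derivative, \<open>F\<^sub>a\<^sub>b = \<nabla>\<^sub>[\<^sub>a\<kappa>\<^sub>b\<^sub>]\<close>. The Christoffel symbols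
  cancel in \<open>F\<close>, and \<open>\<tau>\<^sub>a\<^sub>b\<^sub>c\<close> is \<open>3 \<kappa>\<^sub>[\<^sub>a F\<^sub>b\<^sub>c\<^sub>]\<close>. Let \<open>A\<close> be the endomorphism of the tangent bundle with
  \<open>g(Av,w) = F(v,w)\<close>. Two observations translate the geometry into linear algebra at a point. First, for a
  field \<open>X\<close> of null vectors, \<open>g(\<nabla>\<^sub>X X, \<cdot>)\<close> is the contraction of \<open>X\<close> with the exterior derivative of \<open>g(X,\<cdot>)\<close>
  (\<open>acceleration_eq\<close>), so the congruence is geodesic iff \<open>k \<lrcorner> F\<close> is everywhere a multiple of \<open>\<kappa>\<close>
  (\<open>geodesic_iff\<close>). Second, in that case \<open>A\<close> preserves \<open>K\<^sup>\<bottom>\<close> and \<open>K\<close> and induces the twist endomorphism on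
  the screen space; being skew, it is a complex structure compatible with \<open>h\<close> iff it is an isometry
  (\<open>twist_is_complex_structure_iff\<close>).

  The core is the pointwise statement \<open>equation_iff\<close>: the quadratic equation for \<open>\<tau>\<close>, with nonzero
  right-hand side, holds iff \<open>k \<lrcorner> F\<close> is a multiple of \<open>\<kappa>\<close> and \<open>A\<close> is conformal on the screen space, that is
  \<open>g(Av,Aw) = \<mu> g(v,w)\<close> on \<open>K\<^sup>\<bottom>\<close> with \<open>\<mu> > 0\<close>. Contracting the equation with \<open>k, x, x, l\<close> for suitable vectors \<open>x\<close>
  and \<open>l\<close> gives the multiple of \<open>\<kappa>\<close> (\<open>equation_imp_geodesic\<close>). Then \<open>F\<close> may be replaced by a form annihilated
  by \<open>k\<close>, each side of the equation becomes the skew-symmetrised product of \<open>\<kappa>\<^sub>a \<kappa>\<^sub>c\<close> with a symmetric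
  tensor, and comparing the two tensors on \<open>K\<^sup>\<bottom>\<close> is the conformality (\<open>equation_imp_conformal\<close>,
  \<open>conformal_imp_equation\<close>).

  If \<open>k' = fk\<close>, the factor \<open>\<mu>\<close> is multiplied by \<open>f\<^sup>2\<close> (\<open>conformal_rescale\<close>). As \<open>\<mu>\<close> is smooth, being locally
  \<open>g(AX,AX)/g(X,X)\<close> for a section \<open>X\<close> of \<open>K\<^sup>\<bottom>\<close>, there is exactly one positive rescaling with \<open>\<mu> = 1\<close>. This is
  the equivalence. For that \<open>k\<close>, the almost Robinson structure is the set of the \<open>x + \<i>(Ax + K)\<close>, \<open>x \<in> K\<^sup>\<bottom>\<close>,
  and \<open>F\<close> itself extends the Hermitian form, so that the Robinson 3-form is \<open>\<tau>\<close>.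

  Smoothness of the new fields requires some calculus: closure of smooth functions under algebraic
  operations, square roots and matrix inversion, and the symmetry of second derivatives, from which
  \<open>F\<close> is tensorial (\<open>skew_deriv_in_change\<close>).
\<close>

section \<open>Calculus of smooth functions\<close>

text \<open>Closure properties of \<open>smooth_on\<close>. The derivatives in \<open>Ck_on\<close> are taken at points of an open set,
  so they only depend on the function there.\<close>

lemma frechet_derivative_cong_open:
  assumes "open S" "x \<in> S" "\<And>y. y \<in> S \<Longrightarrow> f y = g y"
  shows "frechet_derivative f (at x) = frechet_derivative g (at x)"
proof -
  have "(f has_derivative D) (at x) = (g has_derivative D) (at x)" for D
    using has_derivative_transform_within_open[OF _ assms(1,2)] assms(3) by metis
  then show ?thesis unfolding frechet_derivative_def by simp
qed

lemma differentiable_cong_open: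
  assumes "open S" "x \<in> S" "\<And>y. y \<in> S \<Longrightarrow> f y = g y" "f differentiable (at x)"
  shows "g differentiable (at x)"
proof -
  obtain D where "(f has_derivative D) (at x)" using assms(4) by (auto simp: differentiable_def)
  then have "(g has_derivative D) (at x)"
    by (rule has_derivative_transform_within_open[OF _ assms(1,2)]) (rule assms(3))
  then show ?thesis by (auto simp: differentiable_def)
qed

lemma Ck_on_cong:
  assumes "open S" "\<And>x. x \<in> S \<Longrightarrow> f x = g x" "Ck_on n S f"
  shows "Ck_on n S g"
  using assms(2,3)
proof (induction n arbitrary: f g)
  case 0
  then show ?case by (simp cong: continuous_on_cong)
next
  case (Suc n)
  have "g differentiable (at x)" if "x \<in> S" for x
    using differentiable_cong_open[OF assms(1) that] Suc.prems that by auto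
  moreover have "Ck_on n S (\<lambda>x. frechet_derivative g (at x) v)" for v
  proof (rule Suc.IH[of "\<lambda>x. frechet_derivative f (at x) v"])
    show "frechet_derivative f (at x) v = frechet_derivative g (at x) v" if "x \<in> S" for x
      using frechet_derivative_cong_open[OF assms(1) that] Suc.prems(1) by metis
    show "Ck_on n S (\<lambda>x. frechet_derivative f (at x) v)" using Suc.prems(2) by simp
  qed
  ultimately show ?case by simp
qed

lemma Ck_on_SucI:
  assumes "open S" "\<And>x. x \<in> S \<Longrightarrow> (f has_derivative f' x) (at x)"
    and "\<And>v. Ck_on n S (\<lambda>x. f' x v)"
  shows "Ck_on (Suc n) S f"
proof -
  have "Ck_on n S (\<lambda>x. frechet_derivative f (at x) v)" for v
    by (rule Ck_on_cong[OF assms(1) _ assms(3)[of v]])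
      (rule fun_cong[OF frechet_derivative_at[OF assms(2)]])
  then show ?thesis using assms(2) by (auto simp: differentiable_def)
qed

lemma Ck_on_subset: "Ck_on n S f \<Longrightarrow> T \<subseteq> S \<Longrightarrow> Ck_on n T f"
  by (induction n arbitrary: f) (auto intro: continuous_on_subset)

lemma Ck_on_local:
  assumes "\<And>x. x \<in> S \<Longrightarrow> \<exists>T. open T \<and> x \<in> T \<and> Ck_on n T f"
  shows "Ck_on n S f"
  using assms
proof (induction n arbitrary: f)
  case 0
  then have "isCont f x" if "x \<in> S" for x
    using that continuous_on_eq_continuous_at by (metis Ck_on.simps(1))
  then show ?case by (simp add: continuous_at_imp_continuous_on)
next
  case (Suc n)
  have "f differentiable (at x)" if "x \<in> S" for x
    using Suc.prems[OF that] by auto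
  moreover have "Ck_on n S (\<lambda>x. frechet_derivative f (at x) v)" for v
    using Suc.prems by (intro Suc.IH) fastforce
  ultimately show ?case by simp
qed

lemma Ck_on_Suc_imp: "Ck_on (Suc n) S f \<Longrightarrow> Ck_on n S f"
proof (induction n arbitrary: f)
  case 0
  then show ?case
    by (auto intro!: continuous_at_imp_continuous_on differentiable_imp_continuous_within)
next
  case (Suc n)
  then show ?case by auto
qed

lemma Ck_on_const: "Ck_on n S (\<lambda>x. c)"
  by (induction n arbitrary: c) auto

lemma Ck_on_bounded_linear:
  assumes "open S" "bounded_linear L" "Ck_on n S f"
  shows "Ck_on n S (\<lambda>x. L (f x))"
  using assms(3)
proof (induction n arbitrary: f)
  case 0
  then show ?case
    using assms(2) by (auto intro: bounded_linear.continuous_on)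
next
  case (Suc n)
  have D: "((\<lambda>x. L (f x)) has_derivative (\<lambda>v. L (frechet_derivative f (at x) v))) (at x)"
    if "x \<in> S" for x
    using Suc.prems that frechet_derivative_works
    by (auto intro!: bounded_linear.has_derivative[OF assms(2)])
  show ?case
    by (rule Ck_on_SucI[OF assms(1) D]) (use Suc in auto)
qed

lemma Ck_on_add:
  assumes "open S" "Ck_on n S f" "Ck_on n S g"
  shows "Ck_on n S (\<lambda>x. f x + g x)"
  using assms(2,3)
proof (induction n arbitrary: f g)
  case 0
  then show ?case by (auto intro: continuous_on_add)
next
  case (Suc n)
  have D: "((\<lambda>x. f x + g x) has_derivative
      (\<lambda>v. frechet_derivative f (at x) v + frechet_derivative g (at x) v)) (at x)"
    if "x \<in> S" for x
    using Suc.prems that frechet_derivative_works by (auto intro!: has_derivative_add)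
  show ?case
    by (rule Ck_on_SucI[OF assms(1) D]) (use Suc in auto)
qed

lemma Ck_on_bilinear:
  assumes "open S" "bounded_bilinear B" "Ck_on n S f" "Ck_on n S g"
  shows "Ck_on n S (\<lambda>x. B (f x) (g x))"
  using assms(3,4)
proof (induction n arbitrary: f g)
  case 0
  then show ?case using assms(2) by (auto intro: bounded_bilinear.continuous_on)
next
  case (Suc n)
  have D: "((\<lambda>x. B (f x) (g x)) has_derivative
      (\<lambda>v. B (f x) (frechet_derivative g (at x) v) + B (frechet_derivative f (at x) v) (g x))) (at x)"
    if "x \<in> S" for x
    using Suc.prems that
    by (intro bounded_bilinear.FDERIV[OF assms(2)]) (auto simp flip: frechet_derivative_works)
  have "Ck_on n S f" "Ck_on n S g" using Suc.prems Ck_on_Suc_imp by blast+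
  then show ?case
    by (intro Ck_on_SucI[OF assms(1) D] Ck_on_add[OF assms(1)] Suc.IH) (use Suc.prems in auto)
qed

lemma Ck_on_sum:
  assumes "open S" "finite I" "\<And>i. i \<in> I \<Longrightarrow> Ck_on n S (f i)"
  shows "Ck_on n S (\<lambda>x. \<Sum>i\<in>I. f i x)"
  using assms(2,3)
  by (induction I rule: finite_induct) (auto intro: Ck_on_const Ck_on_add[OF assms(1)])

lemma Ck_on_inverse:
  fixes f :: "'v::real_normed_vector \<Rightarrow> real"
  assumes "open S" "\<And>x. x \<in> S \<Longrightarrow> f x \<noteq> 0" "Ck_on n S f"
  shows "Ck_on n S (\<lambda>x. inverse (f x))"
  using assms(3)
proof (induction n)
  case 0
  then show ?case using assms(2) by (auto intro: continuous_on_inverse)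
next
  case (Suc n)
  have D: "((\<lambda>x. inverse (f x)) has_derivative
      (\<lambda>v. - (inverse (f x) * frechet_derivative f (at x) v * inverse (f x)))) (at x)"
    if "x \<in> S" for x
  proof -
    have "(f has_derivative frechet_derivative f (at x)) (at x)"
      using Suc.prems that frechet_derivative_works by auto
    then show ?thesis using assms(2)[OF that] by (intro Deriv.has_derivative_inverse)
  qed
  have m: "Ck_on n S (\<lambda>x. g x * h x)" if "Ck_on n S g" "Ck_on n S h" for g h :: "'v \<Rightarrow> real"
    using Ck_on_bilinear[OF assms(1) bounded_bilinear_mult that] .
  have I: "Ck_on n S (\<lambda>x. inverse (f x))"
    using Suc Ck_on_Suc_imp by blast
  have "Ck_on n S (\<lambda>x. (-1) * (inverse (f x) * frechet_derivative f (at x) v * inverse (f x)))" for v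
    using Suc.prems by (intro m I Ck_on_const) auto
  then show ?case
    by (intro Ck_on_SucI[OF assms(1) D]) simp_all
qed

lemma Ck_on_sqrt:
  fixes f :: "'v::real_normed_vector \<Rightarrow> real"
  assumes "open S" "\<And>x. x \<in> S \<Longrightarrow> f x > 0" "Ck_on n S f"
  shows "Ck_on n S (\<lambda>x. sqrt (f x))"
  using assms(3)
proof (induction n)
  case 0
  then show ?case by (auto intro: continuous_on_real_sqrt)
next
  case (Suc n)
  have D: "((\<lambda>x. sqrt (f x)) has_derivative
      (\<lambda>v. frechet_derivative f (at x) v * (inverse (sqrt (f x)) / 2))) (at x)"
    if "x \<in> S" for x
  proof -
    have "(f has_derivative frechet_derivative f (at x)) (at x)"
      using Suc.prems that frechet_derivative_works by auto
    with DERIV_real_sqrt[OF assms(2)[OF that]] show ?thesis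
      by (rule DERIV_compose_FDERIV)
  qed
  have m: "Ck_on n S (\<lambda>x. g x * h x)" if "Ck_on n S g" "Ck_on n S h" for g h :: "'v \<Rightarrow> real"
    using Ck_on_bilinear[OF assms(1) bounded_bilinear_mult that] .
  have I: "Ck_on n S (\<lambda>x. sqrt (f x))"
    using Suc Ck_on_Suc_imp by blast
  have "Ck_on n S (\<lambda>x. frechet_derivative f (at x) v * (inverse (sqrt (f x)) * (1/2)))" for v
    using Suc.prems assms(2)
    by (intro m Ck_on_inverse I Ck_on_const assms(1)) (auto simp: less_imp_neq[symmetric])
  then show ?case
    by (intro Ck_on_SucI[OF assms(1) D]) simp_all
qed

lemma smooth_on_cong:
  "open S \<Longrightarrow> smooth_on S f \<Longrightarrow> (\<And>x. x \<in> S \<Longrightarrow> f x = g x) \<Longrightarrow> smooth_on S g"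
  unfolding smooth_on_def using Ck_on_cong by blast

lemma smooth_on_subset: "smooth_on S f \<Longrightarrow> T \<subseteq> S \<Longrightarrow> smooth_on T f"
  unfolding smooth_on_def using Ck_on_subset by blast

lemma smooth_on_local:
  "(\<And>x. x \<in> S \<Longrightarrow> \<exists>T. open T \<and> x \<in> T \<and> smooth_on T f) \<Longrightarrow> smooth_on S f"
  unfolding smooth_on_def using Ck_on_local by metis

lemma smooth_on_const: "smooth_on S (\<lambda>x. c)"
  unfolding smooth_on_def using Ck_on_const by blast

lemma smooth_on_bounded_linear:
  "open S \<Longrightarrow> bounded_linear L \<Longrightarrow> smooth_on S f \<Longrightarrow> smooth_on S (\<lambda>x. L (f x))"
  unfolding smooth_on_def using Ck_on_bounded_linear by blast

lemma smooth_on_add: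
  "open S \<Longrightarrow> smooth_on S f \<Longrightarrow> smooth_on S g \<Longrightarrow> smooth_on S (\<lambda>x. f x + g x)"
  unfolding smooth_on_def using Ck_on_add by blast

lemma smooth_on_bilinear:
  "open S \<Longrightarrow> bounded_bilinear B \<Longrightarrow> smooth_on S f \<Longrightarrow> smooth_on S g
    \<Longrightarrow> smooth_on S (\<lambda>x. B (f x) (g x))"
  unfolding smooth_on_def using Ck_on_bilinear by blast

lemma smooth_on_scaleR:
  "open S \<Longrightarrow> smooth_on S f \<Longrightarrow> smooth_on S g \<Longrightarrow> smooth_on S (\<lambda>x. f x *\<^sub>R g x)"
  using smooth_on_bilinear[OF _ bounded_bilinear_scaleR] .

lemma smooth_on_mult:
  fixes f g :: "_ \<Rightarrow> real"
  shows "open S \<Longrightarrow> smooth_on S f \<Longrightarrow> smooth_on S g \<Longrightarrow> smooth_on S (\<lambda>x. f x * g x)"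
  using smooth_on_bilinear[OF _ bounded_bilinear_mult] .

lemma smooth_on_minus:
  "open S \<Longrightarrow> smooth_on S f \<Longrightarrow> smooth_on S (\<lambda>x. - f x)"
  using smooth_on_bounded_linear[OF _ bounded_linear_minus[OF bounded_linear_ident]] .

lemma smooth_on_diff:
  "open S \<Longrightarrow> smooth_on S f \<Longrightarrow> smooth_on S g \<Longrightarrow> smooth_on S (\<lambda>x. f x - g x)"
  using smooth_on_add[OF _ _ smooth_on_minus] by auto

lemma smooth_on_sum:
  "open S \<Longrightarrow> finite I \<Longrightarrow> (\<And>i. i \<in> I \<Longrightarrow> smooth_on S (f i)) \<Longrightarrow> smooth_on S (\<lambda>x. \<Sum>i\<in>I. f i x)"
  unfolding smooth_on_def using Ck_on_sum by blast

lemma smooth_on_prod: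
  fixes f :: "_ \<Rightarrow> _ \<Rightarrow> real"
  assumes "open S" "finite I" "\<And>i. i \<in> I \<Longrightarrow> smooth_on S (f i)"
  shows "smooth_on S (\<lambda>x. \<Prod>i\<in>I. f i x)"
  using assms(2,3)
  by (induction I rule: finite_induct) (auto intro: smooth_on_const smooth_on_mult[OF assms(1)])

lemma smooth_on_inverse:
  fixes f :: "_ \<Rightarrow> real"
  shows "open S \<Longrightarrow> (\<And>x. x \<in> S \<Longrightarrow> f x \<noteq> 0) \<Longrightarrow> smooth_on S f \<Longrightarrow> smooth_on S (\<lambda>x. inverse (f x))"
  unfolding smooth_on_def using Ck_on_inverse by blast

lemma smooth_on_divide:
  fixes f g :: "_ \<Rightarrow> real"
  shows "open S \<Longrightarrow> (\<And>x. x \<in> S \<Longrightarrow> g x \<noteq> 0) \<Longrightarrow> smooth_on S f \<Longrightarrow> smooth_on S g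
    \<Longrightarrow> smooth_on S (\<lambda>x. f x / g x)"
  unfolding divide_inverse by (intro smooth_on_mult smooth_on_inverse)

lemma smooth_on_sqrt:
  fixes f :: "_ \<Rightarrow> real"
  shows "open S \<Longrightarrow> (\<And>x. x \<in> S \<Longrightarrow> f x > 0) \<Longrightarrow> smooth_on S f \<Longrightarrow> smooth_on S (\<lambda>x. sqrt (f x))"
  unfolding smooth_on_def using Ck_on_sqrt by blast

lemma smooth_on_differentiable: "smooth_on S f \<Longrightarrow> x \<in> S \<Longrightarrow> f differentiable (at x)"
  unfolding smooth_on_def by (metis Ck_on.simps(2))

lemma smooth_on_frechet_derivative:
  "smooth_on S f \<Longrightarrow> smooth_on S (\<lambda>x. frechet_derivative f (at x) v)"
  unfolding smooth_on_def by (metis Ck_on.simps(2))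

lemma smooth_on_continuous: "smooth_on S f \<Longrightarrow> continuous_on S f"
  unfolding smooth_on_def by (metis Ck_on.simps(1))

lemma smooth_on_vec_nth: "open S \<Longrightarrow> smooth_on S f \<Longrightarrow> smooth_on S (\<lambda>x. f x $ i)"
  using smooth_on_bounded_linear[OF _ bounded_linear_vec_nth] .

lemma bounded_linear_axis: "bounded_linear (axis i :: 'w::euclidean_space \<Rightarrow> 'w^'n::finite)"
  by (rule linear_conv_bounded_linear[THEN iffD1]) (auto simp: linear_iff axis_def vec_eq_iff)

lemma smooth_on_vec_lambda:
  fixes f :: "'n::finite \<Rightarrow> 'v::real_normed_vector \<Rightarrow> 'w::euclidean_space"
  assumes "open S" "\<And>i. smooth_on S (f i)"
  shows "smooth_on S (\<lambda>x. \<chi> i. f i x)"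
proof -
  have "(\<chi> i. f i x) = (\<Sum>i\<in>UNIV. axis i (f i x))" for x
    by (simp add: vec_eq_iff axis_def if_distrib sum.If_cases cong: if_cong)
  then show ?thesis
    using assms by (simp add: smooth_on_sum smooth_on_bounded_linear[OF _ bounded_linear_axis])
qed

lemma smooth_on_matrix_vector_mult:
  fixes A :: "'v::real_normed_vector \<Rightarrow> real^'n::finite^'m::finite"
  assumes "open S" "smooth_on S A" "smooth_on S X"
  shows "smooth_on S (\<lambda>x. A x *v X x)"
  unfolding matrix_vector_mult_def
  by (intro smooth_on_vec_lambda smooth_on_sum smooth_on_mult smooth_on_vec_nth assms) simp

lemma smooth_on_transpose:
  fixes A :: "'v::real_normed_vector \<Rightarrow> real^'n::finite^'m::finite"
  assumes "open S" "smooth_on S A"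
  shows "smooth_on S (\<lambda>x. transpose (A x))"
  unfolding transpose_def by (intro smooth_on_vec_lambda smooth_on_vec_nth assms)

lemma smooth_on_det:
  fixes A :: "'v::real_normed_vector \<Rightarrow> real^'n::finite^'n"
  assumes "open S" "smooth_on S A"
  shows "smooth_on S (\<lambda>x. det (A x))"
  unfolding det_def
  by (intro smooth_on_sum smooth_on_mult smooth_on_prod smooth_on_const smooth_on_vec_nth assms) auto

lemma matrix_inv_mult:
  fixes A :: "'a::semiring_1^'n^'m"
  assumes "invertible A"
  shows "A ** matrix_inv A = mat 1" "matrix_inv A ** A = mat 1"
  using someI_ex[OF assms[unfolded invertible_def]] by (auto simp: matrix_inv_def)

lemma matrix_inv_unique:
  fixes A :: "'a::semiring_1^'n^'n"
  assumes "A ** B = mat 1" "B ** A = mat 1"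
  shows "matrix_inv A = B"
  by (metis assms invertible_def matrix_inv_mult(1) matrix_mul_assoc matrix_mul_lid matrix_mul_rid)

lemma smooth_on_matrix_inv:
  fixes A :: "'v::real_normed_vector \<Rightarrow> real^'n::finite^'n"
  assumes S: "open S" "smooth_on S A" and inv: "\<And>x. x \<in> S \<Longrightarrow> invertible (A x)"
  shows "smooth_on S (\<lambda>x. matrix_inv (A x))"
proof -
  \<comment> \<open>Cramer's rule: the columns of the inverse are quotients of determinants.\<close>
  let ?C = "\<lambda>x j. (\<chi> k. det (\<chi> i l. if l = k then axis j 1 $ i else A x $ i $ l) / det (A x)) :: real^'n"
  have det: "det (A x) \<noteq> 0" if "x \<in> S" for x
    using inv[OF that] by (simp add: invertible_det_nz)
  have eq: "matrix_inv (A x) = (\<chi> k j. ?C x j $ k)" if "x \<in> S" for x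
  proof -
    have "A x *v (matrix_inv (A x) *v axis j 1) = axis j 1" for j
      by (simp only: matrix_vector_mul_assoc matrix_inv_mult(1)[OF inv[OF that]] matrix_vector_mul_lid)
    then have "matrix_inv (A x) *v axis j 1 = ?C x j" for j
      unfolding cramer[OF det[OF that]] .
    then have "(matrix_inv (A x) *v axis j 1) $ k = ?C x j $ k" for k j
      by (simp only:)
    then show ?thesis
      by (simp only: vec_eq_iff vec_lambda_beta matrix_vector_mult_basis column_def) simp
  qed
  have e: "smooth_on S (\<lambda>x. if l = k then axis j 1 $ i else A x $ i $ l)" for i j k l
    by (cases "l = k") (auto intro!: smooth_on_const smooth_on_vec_nth S)
  have "smooth_on S (\<lambda>x. (\<chi> k j. ?C x j $ k))"
    by (simp, intro smooth_on_vec_lambda smooth_on_divide smooth_on_det e S det) auto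
  then show ?thesis
    by (rule smooth_on_cong[OF S(1)]) (use eq in auto)
qed

text \<open>Symmetry of second derivatives: the second difference of \<open>f\<close> over a small parallelogram
  spanned by \<open>tv\<close> and \<open>tw\<close> is, by the mean value theorem applied twice, \<open>t\<^sup>2\<close> times a value of the iterated
  derivative close to \<open>x\<close>, in either order of the two directions.\<close>

lemma second_difference_mvt:
  fixes f :: "'v::real_normed_vector \<Rightarrow> real"
  assumes C: "smooth_on S f" and t: "t > 0"
    and sub: "\<And>a b. 0 \<le> a \<Longrightarrow> a \<le> t \<Longrightarrow> 0 \<le> b \<Longrightarrow> b \<le> t \<Longrightarrow> x + a *\<^sub>R v + b *\<^sub>R w \<in> S"
  obtains a b where "0 \<le> a" "a \<le> t" "0 \<le> b" "b \<le> t"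
    "f (x + t *\<^sub>R v + t *\<^sub>R w) - f (x + t *\<^sub>R v) - f (x + t *\<^sub>R w) + f x =
    t * t * frechet_derivative (\<lambda>y. frechet_derivative f (at y) v) (at (x + a *\<^sub>R v + b *\<^sub>R w)) w"
proof -
  have der: "((\<lambda>s. g (y + s *\<^sub>R u)) has_real_derivative frechet_derivative g (at (y + s *\<^sub>R u)) u) (at s)"
    if "smooth_on S g" "y + s *\<^sub>R u \<in> S" for g :: "'v \<Rightarrow> real" and y u s
  proof -
    have d: "(g has_derivative frechet_derivative g (at (y + s *\<^sub>R u))) (at (y + s *\<^sub>R u))"
      using smooth_on_differentiable[OF that] frechet_derivative_works by blast
    have i: "((\<lambda>s. y + s *\<^sub>R u) has_derivative (\<lambda>h. h *\<^sub>R u)) (at s)"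
      by (auto intro!: derivative_eq_intros)
    have "((\<lambda>s. g (y + s *\<^sub>R u)) has_derivative
        (\<lambda>h. frechet_derivative g (at (y + s *\<^sub>R u)) (h *\<^sub>R u))) (at s)"
      using diff_chain_at[OF i d] by (simp add: o_def)
    moreover have "frechet_derivative g (at (y + s *\<^sub>R u)) (h *\<^sub>R u) =
        frechet_derivative g (at (y + s *\<^sub>R u)) u * h" for h
      using linear_scale[OF has_derivative_linear[OF d]] by simp
    ultimately show ?thesis by (simp add: has_field_derivative_def fun_eq_iff)
  qed
  let ?D = "\<lambda>y. frechet_derivative f (at y) v"
  have 1: "((\<lambda>s. f (x + t *\<^sub>R w + s *\<^sub>R v) - f (x + s *\<^sub>R v)) has_real_derivative
      ?D (x + t *\<^sub>R w + s *\<^sub>R v) - ?D (x + s *\<^sub>R v)) (at s)" if "0 \<le> s" "s \<le> t" for s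
    using sub[of s t] sub[of s 0] that t
    by (intro DERIV_diff der C) (auto simp: algebra_simps)
  obtain a where a: "0 < a" "a < t" "(f (x + t *\<^sub>R w + t *\<^sub>R v) - f (x + t *\<^sub>R v)) -
      (f (x + t *\<^sub>R w + 0 *\<^sub>R v) - f (x + 0 *\<^sub>R v)) =
      (t - 0) * (?D (x + t *\<^sub>R w + a *\<^sub>R v) - ?D (x + a *\<^sub>R v))"
    using MVT2[OF t 1] by blast
  have 2: "((\<lambda>s. ?D (x + a *\<^sub>R v + s *\<^sub>R w)) has_real_derivative
      frechet_derivative ?D (at (x + a *\<^sub>R v + s *\<^sub>R w)) w) (at s)" if "0 \<le> s" "s \<le> t" for s
    using sub[of a s] that a by (intro der smooth_on_frechet_derivative C) auto
  obtain b where b: "0 < b" "b < t" "?D (x + a *\<^sub>R v + t *\<^sub>R w) - ?D (x + a *\<^sub>R v + 0 *\<^sub>R w) =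
      (t - 0) * frechet_derivative ?D (at (x + a *\<^sub>R v + b *\<^sub>R w)) w"
    using MVT2[OF t 2] by blast
  have "f (x + t *\<^sub>R v + t *\<^sub>R w) - f (x + t *\<^sub>R v) - f (x + t *\<^sub>R w) + f x =
      t * (t * frechet_derivative ?D (at (x + a *\<^sub>R v + b *\<^sub>R w)) w)"
    using a(3) b(3) by (simp add: add_ac)
  then show ?thesis using a b by (intro that[of a b]) simp_all
qed

lemma frechet_derivative_commute:
  fixes f :: "'v::real_normed_vector \<Rightarrow> real"
  assumes S: "open S" "x \<in> S" and C: "smooth_on S f"
  shows "frechet_derivative (\<lambda>y. frechet_derivative f (at y) v) (at x) w =
         frechet_derivative (\<lambda>y. frechet_derivative f (at y) w) (at x) v"
proof -
  let ?P = "\<lambda>y. frechet_derivative (\<lambda>y. frechet_derivative f (at y) v) (at y) w"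
  let ?Q = "\<lambda>y. frechet_derivative (\<lambda>y. frechet_derivative f (at y) w) (at y) v"
  have com: "x + a + b = x + b + a" for a b :: 'v
    by (simp only: add.assoc add.commute[of a b])
  have "continuous_on S (\<lambda>y. ?P y)" "continuous_on S (\<lambda>y. ?Q y)"
    by (intro smooth_on_continuous smooth_on_frechet_derivative C)+
  then have cont: "continuous (at x) ?P" "continuous (at x) ?Q"
    using S continuous_on_eq_continuous_at by blast+
  have "\<bar>?P x - ?Q x\<bar> < e" if e: "e > 0" for e
  proof -
    obtain d1 where d1: "d1 > 0" "\<And>y. dist y x < d1 \<Longrightarrow> dist (?P y) (?P x) < e / 2"
      using cont(1)[unfolded continuous_at_eps_delta, rule_format, OF half_gt_zero[OF e]] by blast
    obtain d2 where d2: "d2 > 0" "\<And>y. dist y x < d2 \<Longrightarrow> dist (?Q y) (?Q x) < e / 2"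
      using cont(2)[unfolded continuous_at_eps_delta, rule_format, OF half_gt_zero[OF e]] by blast
    obtain d3 where d3: "d3 > 0" "ball x d3 \<subseteq> S"
      using S open_contains_ball by blast
    define d where "d = min d1 (min d2 d3)"
    define t where "t = d / (2 * (norm v + norm w + 1))"
    have d: "d > 0" using d1 d2 d3 by (simp add: d_def)
    have N: "norm v + norm w + 1 > 0" using norm_ge_zero[of v] norm_ge_zero[of w] by linarith
    have t: "t > 0" using d N by (simp add: t_def)
    have tN: "t * (norm v + norm w + 1) = d / 2"
      using N by (simp add: t_def field_simps)
    have near: "dist (x + a *\<^sub>R v + b *\<^sub>R w) x < d"
      if "0 \<le> a" "a \<le> t" "0 \<le> b" "b \<le> t" for a b
    proof -
      have "norm (a *\<^sub>R v + b *\<^sub>R w) \<le> a * norm v + b * norm w"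
        using that norm_triangle_ineq[of "a *\<^sub>R v" "b *\<^sub>R w"] by simp
      also have "\<dots> \<le> t * norm v + t * norm w"
        using that by (intro add_mono mult_right_mono) auto
      also have "\<dots> \<le> t * (norm v + norm w + 1)" using t by (simp add: algebra_simps)
      also have "\<dots> < d" using tN d by simp
      finally show ?thesis by (simp add: dist_norm add.assoc)
    qed
    have sub: "x + a *\<^sub>R v + b *\<^sub>R w \<in> S"
      if "0 \<le> a" "a \<le> t" "0 \<le> b" "b \<le> t" for a b
    proof -
      have "x + a *\<^sub>R v + b *\<^sub>R w \<in> ball x d3"
        using near[OF that] by (simp add: d_def dist_commute)
      with d3(2) show ?thesis by (rule subsetD)
    qed
    obtain a b where 1: "0 \<le> a" "a \<le> t" "0 \<le> b" "b \<le> t"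
      "f (x + t *\<^sub>R v + t *\<^sub>R w) - f (x + t *\<^sub>R v) - f (x + t *\<^sub>R w) + f x =
        t * t * ?P (x + a *\<^sub>R v + b *\<^sub>R w)"
      by (rule second_difference_mvt[OF C t sub])
    have sub': "x + a *\<^sub>R w + b *\<^sub>R v \<in> S"
      if "0 \<le> a" "a \<le> t" "0 \<le> b" "b \<le> t" for a b
      using sub[of b a] that by (simp add: algebra_simps)
    obtain a' b' where 2: "0 \<le> a'" "a' \<le> t" "0 \<le> b'" "b' \<le> t"
      "f (x + t *\<^sub>R w + t *\<^sub>R v) - f (x + t *\<^sub>R w) - f (x + t *\<^sub>R v) + f x =
        t * t * ?Q (x + a' *\<^sub>R w + b' *\<^sub>R v)"
      by (rule second_difference_mvt[OF C t sub'])
    have "t * t * ?P (x + a *\<^sub>R v + b *\<^sub>R w) = t * t * ?Q (x + a' *\<^sub>R w + b' *\<^sub>R v)"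
      using 1(5) 2(5) unfolding com[of "t *\<^sub>R w" "t *\<^sub>R v"] by linarith
    then have eq: "?P (x + a *\<^sub>R v + b *\<^sub>R w) = ?Q (x + b' *\<^sub>R v + a' *\<^sub>R w)"
      using t unfolding com[of "a' *\<^sub>R w" "b' *\<^sub>R v"] by simp
    have "dist (?P (x + a *\<^sub>R v + b *\<^sub>R w)) (?P x) < e / 2"
      using near[OF 1(1-4)] by (intro d1) (simp add: d_def)
    moreover have "dist (?Q (x + b' *\<^sub>R v + a' *\<^sub>R w)) (?Q x) < e / 2"
      using near[OF 2(3,4,1,2)] by (intro d2) (simp add: d_def)
    ultimately show ?thesis using eq unfolding dist_real_def by linarith
  qed
  then have "\<not> \<bar>?P x - ?Q x\<bar> > 0" using less_irrefl by blast
  then show ?thesis by simp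
qed

section \<open>Charts and changes of coordinates\<close>

lemma eval2_inner: "eval2 T v w = v \<bullet> (T *v w)"
  by (simp add: eval2_def inner_vec_def matrix_vector_mult_def sum_distrib_left mult_ac)

text \<open>A manifold given by its oriented atlas; the other fields of \<open>M\<close> are unconstrained.\<close>

locale smooth_atlas =
  fixes M :: "('a::topological_space, 'n::finite) optical_data"
  assumes atlas: "oriented_atlas (atlas M)"
begin

lemma chart_open: "c \<in> atlas M \<Longrightarrow> open (fst c)"
  using atlas by (auto simp: oriented_atlas_def)

lemma chart_homeomorphism:
  "c \<in> atlas M \<Longrightarrow> homeomorphism (fst c) (snd c ` fst c) (snd c) (chart_inv c)"
  using atlas by (auto simp: oriented_atlas_def)

lemma chart_inv_chart: "c \<in> atlas M \<Longrightarrow> p \<in> fst c \<Longrightarrow> chart_inv c (snd c p) = p"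
  using chart_homeomorphism by (rule homeomorphism_apply1)

lemma chart_inv_in: "c \<in> atlas M \<Longrightarrow> x \<in> snd c ` (fst c \<inter> U) \<Longrightarrow> chart_inv c x \<in> fst c \<inter> U"
  using chart_inv_chart by fastforce

lemma chart_image_open:
  assumes "c \<in> atlas M" "open U"
  shows "open (snd c ` (fst c \<inter> U))"
proof -
  have o: "open (snd c ` fst c)" using assms(1) atlas by (auto simp: oriented_atlas_def)
  have "continuous_on (snd c ` fst c) (chart_inv c)"
    using chart_homeomorphism[OF assms(1)] by (simp add: homeomorphism_def)
  then have "open (snd c ` fst c \<inter> chart_inv c -` U)"
    using o assms(2) by (rule continuous_open_preimage)
  moreover have "snd c ` fst c \<inter> chart_inv c -` U = snd c ` (fst c \<inter> U)"
    using chart_inv_chart[OF assms(1)] by auto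
  ultimately show ?thesis by simp
qed

lemma chart_at: "chart_at M p \<in> atlas M" "p \<in> fst (chart_at M p)"
proof -
  have "p \<in> (\<Union>c\<in>atlas M. fst c)" using atlas by (simp add: oriented_atlas_def)
  then have "\<exists>c. c \<in> atlas M \<and> p \<in> fst c" by blast
  from someI_ex[OF this] show "chart_at M p \<in> atlas M" "p \<in> fst (chart_at M p)"
    by (auto simp: chart_at_def)
qed

lemma transition_smooth:
  "c \<in> atlas M \<Longrightarrow> d \<in> atlas M \<Longrightarrow> smooth_on (snd c ` (fst c \<inter> fst d)) (snd d \<circ> chart_inv c)"
  using atlas by (auto simp: oriented_atlas_def)

lemma transition_derivative:
  assumes "c \<in> atlas M" "d \<in> atlas M" "p \<in> fst c" "p \<in> fst d"
  shows "((snd d \<circ> chart_inv c) has_derivative (*v) (jacobian c d p)) (at (snd c p))"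
proof -
  have "(snd d \<circ> chart_inv c) differentiable (at (snd c p))"
    using transition_smooth[OF assms(1,2)] by (rule smooth_on_differentiable) (use assms in auto)
  then have D: "((snd d \<circ> chart_inv c) has_derivative
      frechet_derivative (snd d \<circ> chart_inv c) (at (snd c p))) (at (snd c p))"
    by (simp add: frechet_derivative_works)
  have "frechet_derivative (snd d \<circ> chart_inv c) (at (snd c p)) = (*v) (jacobian c d p)"
    unfolding jacobian_def
    by (rule ext) (simp only: matrix_works[OF iffD2[OF linear_matrix_vector_mul_eq has_derivative_linear[OF D]]])
  with D show ?thesis by simp
qed

lemma jacobian_chain:
  assumes "c \<in> atlas M" "d \<in> atlas M" "e \<in> atlas M" "p \<in> fst c" "p \<in> fst d" "p \<in> fst e"
  shows "jacobian d e p ** jacobian c d p = jacobian c e p"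
proof -
  let ?S = "snd c ` (fst c \<inter> fst d)"
  have "((snd d \<circ> chart_inv c) has_derivative (*v) (jacobian c d p)) (at (snd c p))"
    by (intro transition_derivative assms)
  moreover have "((snd e \<circ> chart_inv d) has_derivative (*v) (jacobian d e p))
      (at ((snd d \<circ> chart_inv c) (snd c p)))"
    using transition_derivative[of d e p] assms by (simp add: chart_inv_chart)
  ultimately have "((snd e \<circ> chart_inv d) \<circ> (snd d \<circ> chart_inv c) has_derivative
      (*v) (jacobian d e p) \<circ> (*v) (jacobian c d p)) (at (snd c p))"
    by (rule diff_chain_at)
  then have "(snd e \<circ> chart_inv c has_derivative
      (*v) (jacobian d e p) \<circ> (*v) (jacobian c d p)) (at (snd c p))"
    by (rule has_derivative_transform_within_open[where s = ?S])
      (use assms chart_inv_chart chart_image_open[OF assms(1) chart_open[OF assms(2)]] in auto)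
  moreover have "(snd e \<circ> chart_inv c has_derivative (*v) (jacobian c e p)) (at (snd c p))"
    by (intro transition_derivative assms)
  ultimately have "(*v) (jacobian d e p) \<circ> (*v) (jacobian c d p) = (*v) (jacobian c e p)"
    by (rule has_derivative_unique)
  then have "(jacobian d e p ** jacobian c d p) *v x = jacobian c e p *v x" for x
    by (metis comp_apply matrix_vector_mul_assoc)
  then show ?thesis by (simp add: matrix_eq)
qed

lemma jacobian_self:
  assumes "c \<in> atlas M" "p \<in> fst c"
  shows "jacobian c c p = mat 1"
proof -
  have "((\<lambda>x. x) has_derivative (\<lambda>x. x)) (at (snd c p))" by (rule has_derivative_ident)
  then have "(snd c \<circ> chart_inv c has_derivative (\<lambda>x. x)) (at (snd c p))"
    by (rule has_derivative_transform_within_open[where s = "snd c ` (fst c \<inter> UNIV)"])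
      (use assms chart_inv_chart chart_image_open[OF assms(1) open_UNIV] in auto)
  from has_derivative_unique[OF this transition_derivative[OF assms(1,1,2,2)]]
  have "jacobian c c p *v x = mat 1 *v x" for x
    by (metis matrix_vector_mul_lid)
  then show ?thesis by (simp add: matrix_eq)
qed

lemma jacobian_inverse:
  assumes "c \<in> atlas M" "d \<in> atlas M" "p \<in> fst c" "p \<in> fst d"
  shows "jacobian c d p ** jacobian d c p = mat 1"
  using jacobian_chain[of d c d p] jacobian_self[of d p] assms by simp

lemma jacobian_smooth:
  assumes "c \<in> atlas M" "d \<in> atlas M"
  shows "smooth_on (snd c ` (fst c \<inter> fst d)) (\<lambda>x. jacobian c d (chart_inv c x))"
proof -
  let ?S = "snd c ` (fst c \<inter> fst d)" and ?\<phi> = "snd d \<circ> chart_inv c"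
  have o: "open ?S" by (intro chart_image_open chart_open assms)
  have "smooth_on ?S (\<lambda>x. \<chi> i j. frechet_derivative ?\<phi> (at x) (axis j 1) $ i)"
    by (intro smooth_on_vec_lambda smooth_on_vec_nth o smooth_on_frechet_derivative transition_smooth assms)
  then show ?thesis
    by (rule smooth_on_cong[OF o])
      (auto simp: jacobian_def matrix_def chart_inv_chart assms)
qed

lemma form_in_change:
  assumes "c \<in> atlas M" "d \<in> atlas M" "p \<in> fst c" "p \<in> fst d"
  shows "form_in M c \<alpha> p = transpose (jacobian c d p) *v form_in M d \<alpha> p"
  unfolding form_in_def matrix_vector_mul_assoc matrix_transpose_mul[symmetric]
  by (subst jacobian_chain) (use assms chart_at in auto)

lemma vec_in_chart_at: "vec_in M (chart_at M p) X p = X p"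
  using jacobian_self[OF chart_at] by (simp add: vec_in_def)

lemma form_in_chart_at: "form_in M (chart_at M p) \<alpha> p = \<alpha> p"
  using jacobian_self[OF chart_at] by (simp add: form_in_def transpose_mat)

lemma tensor2_in_chart_at: "tensor2_in M (chart_at M p) T p = T p"
  using jacobian_self[OF chart_at] by (simp add: tensor2_in_def transpose_mat)

lemma pairing_in:
  assumes "c \<in> atlas M" "p \<in> fst c"
  shows "form_in M c \<alpha> p \<bullet> vec_in M c X p = \<alpha> p \<bullet> X p"
proof -
  have "form_in M c \<alpha> p \<bullet> vec_in M c X p =
      \<alpha> p \<bullet> ((jacobian c (chart_at M p) p ** jacobian (chart_at M p) c p) *v X p)"
    by (simp add: form_in_def vec_in_def dot_lmul_matrix matrix_vector_mul_assoc[symmetric])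
  then show ?thesis using jacobian_inverse[OF assms(1) chart_at(1) assms(2) chart_at(2)] by simp
qed

lemma tensor2_in_vec_in:
  assumes "c \<in> atlas M" "p \<in> fst c"
  shows "tensor2_in M c T p *v vec_in M c X p = form_in M c (\<lambda>p. T p *v X p) p"
proof -
  let ?P = "jacobian c (chart_at M p) p" and ?J = "jacobian (chart_at M p) c p"
  have "tensor2_in M c T p *v vec_in M c X p = transpose ?P *v (T p *v ((?P ** ?J) *v X p))"
    by (simp add: tensor2_in_def vec_in_def matrix_vector_mul_assoc matrix_mul_assoc)
  then show ?thesis
    using jacobian_inverse[OF assms(1) chart_at(1) assms(2) chart_at(2)] by (simp add: form_in_def)
qed

lemma tensor2_in_transpose:
  "tensor2_in M c (\<lambda>p. transpose (T p)) p = transpose (tensor2_in M c T p)"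
  by (simp add: tensor2_in_def matrix_transpose_mul matrix_mul_assoc)

lemma eval2_in:
  assumes "c \<in> atlas M" "p \<in> fst c"
  shows "eval2 (tensor2_in M c T p) (vec_in M c X p) (vec_in M c Y p) = eval2 (T p) (X p) (Y p)"
  using pairing_in[OF assms, of "\<lambda>p. T p *v Y p" X] tensor2_in_vec_in[OF assms, of T Y]
  by (simp add: eval2_inner inner_commute)

lemma tensor2_in_invertible:
  assumes "c \<in> atlas M" "p \<in> fst c" "invertible (T p)"
  shows "invertible (tensor2_in M c T p)"
    and "matrix_inv (tensor2_in M c T p) *v form_in M c \<alpha> p = vec_in M c (\<lambda>p. matrix_inv (T p) *v \<alpha> p) p"
proof -
  let ?P = "jacobian c (chart_at M p) p" and ?J = "jacobian (chart_at M p) c p"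
  have PJ: "?P ** ?J = mat 1" "?J ** ?P = mat 1"
    using jacobian_inverse assms(1,2) chart_at by auto
  have I: "invertible ?P" unfolding invertible_def using PJ by blast
  have I': "invertible (transpose ?P)" using I by (rule transpose_invertible)
  show inv: "invertible (tensor2_in M c T p)"
    unfolding tensor2_in_def by (intro invertible_mult I I' assms(3))
  have "tensor2_in M c T p *v vec_in M c (\<lambda>p. matrix_inv (T p) *v \<alpha> p) p = form_in M c \<alpha> p"
    unfolding tensor2_in_vec_in[OF assms(1,2)]
    by (simp only: form_in_def matrix_vector_mul_assoc matrix_inv_mult(1)[OF assms(3)] matrix_vector_mul_lid matrix_mul_assoc[symmetric])
  then have "matrix_inv (tensor2_in M c T p) *v form_in M c \<alpha> p =
      (matrix_inv (tensor2_in M c T p) ** tensor2_in M c T p) *v vec_in M c (\<lambda>p. matrix_inv (T p) *v \<alpha> p) p"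
    by (simp only: matrix_vector_mul_assoc[symmetric])
  then show "matrix_inv (tensor2_in M c T p) *v form_in M c \<alpha> p = vec_in M c (\<lambda>p. matrix_inv (T p) *v \<alpha> p) p"
    by (simp only: matrix_inv_mult(2)[OF inv] matrix_vector_mul_lid)
qed

end

section \<open>Smooth functions, vector fields and forms on a manifold\<close>

text \<open>As for vector fields, smoothness means smoothness of the components in every chart.\<close>

definition smooth_fun_on :: "('a, 'n::finite) optical_data \<Rightarrow> 'a set \<Rightarrow> ('a \<Rightarrow> real) \<Rightarrow> bool" where
  "smooth_fun_on M U f \<longleftrightarrow>
     (\<forall>c\<in>atlas M. smooth_on (snd c ` (fst c \<inter> U)) (\<lambda>x. f (chart_inv c x)))"

definition smooth_form_on :: "('a, 'n::finite) optical_data \<Rightarrow> 'a set \<Rightarrow> ('a \<Rightarrow> real^'n) \<Rightarrow> bool" where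
  "smooth_form_on M U \<alpha> \<longleftrightarrow>
     (\<forall>c\<in>atlas M. smooth_on (snd c ` (fst c \<inter> U)) (\<lambda>x. form_in M c \<alpha> (chart_inv c x)))"

context smooth_atlas
begin

lemma smooth_vec_on_subset: "smooth_vec_on M U X \<Longrightarrow> W \<subseteq> U \<Longrightarrow> smooth_vec_on M W X"
  unfolding smooth_vec_on_def by (meson Int_mono image_mono order_refl smooth_on_subset)

lemma smooth_fun_on_local:
  assumes "\<And>p. p \<in> U \<Longrightarrow> \<exists>W. open W \<and> p \<in> W \<and> smooth_fun_on M W f"
  shows "smooth_fun_on M U f"
  unfolding smooth_fun_on_def
proof (intro ballI smooth_on_local)
  fix c x assume c: "c \<in> atlas M" and x: "x \<in> snd c ` (fst c \<inter> U)"
  then obtain p where p: "p \<in> fst c" "p \<in> U" "x = snd c p" by auto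
  obtain W where W: "open W" "p \<in> W" "smooth_fun_on M W f" using assms[OF p(2)] by auto
  show "\<exists>T. open T \<and> x \<in> T \<and> smooth_on T (\<lambda>x. f (chart_inv c x))"
    using W p c chart_image_open[OF c W(1)]
    by (intro exI[of _ "snd c ` (fst c \<inter> W)"]) (auto simp: smooth_fun_on_def)
qed

lemma smooth_fun_on_cong:
  assumes "open U" "smooth_fun_on M U f" "\<And>p. p \<in> U \<Longrightarrow> f p = g p"
  shows "smooth_fun_on M U g"
  unfolding smooth_fun_on_def
proof
  fix c assume c: "c \<in> atlas M"
  have "smooth_on (snd c ` (fst c \<inter> U)) (\<lambda>x. f (chart_inv c x))"
    using assms(2) c by (simp add: smooth_fun_on_def)
  then show "smooth_on (snd c ` (fst c \<inter> U)) (\<lambda>x. g (chart_inv c x))"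
    by (rule smooth_on_cong[OF chart_image_open[OF c assms(1)]])
      (use assms(3) chart_inv_in[OF c] in blast)
qed

lemma smooth_fun_on_const: "smooth_fun_on M U (\<lambda>p. r)"
  by (simp add: smooth_fun_on_def smooth_on_const)

lemma smooth_fun_on_divide:
  assumes "open U" "smooth_fun_on M U f" "smooth_fun_on M U g" "\<And>p. p \<in> U \<Longrightarrow> g p \<noteq> 0"
  shows "smooth_fun_on M U (\<lambda>p. f p / g p)"
  unfolding smooth_fun_on_def
  by (intro ballI smooth_on_divide chart_image_open)
    (use assms chart_inv_chart in \<open>auto simp: smooth_fun_on_def\<close>)

lemma smooth_fun_on_sqrt:
  assumes "open U" "smooth_fun_on M U f" "\<And>p. p \<in> U \<Longrightarrow> f p > 0"
  shows "smooth_fun_on M U (\<lambda>p. sqrt (f p))"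
  unfolding smooth_fun_on_def
  by (intro ballI smooth_on_sqrt chart_image_open)
    (use assms chart_inv_chart in \<open>auto simp: smooth_fun_on_def\<close>)

lemma smooth_fun_on_pairing:
  assumes "open U" "smooth_form_on M U \<alpha>" "smooth_vec_on M U X"
  shows "smooth_fun_on M U (\<lambda>p. \<alpha> p \<bullet> X p)"
  unfolding smooth_fun_on_def
proof
  fix c assume c: "c \<in> atlas M"
  note o = chart_image_open[OF c assms(1)]
  have "smooth_on (snd c ` (fst c \<inter> U)) (\<lambda>x. form_in M c \<alpha> (chart_inv c x) \<bullet> vec_in M c X (chart_inv c x))"
    using assms c by (intro smooth_on_bilinear[OF _ bounded_bilinear_inner] o) (auto simp: smooth_form_on_def smooth_vec_on_def)
  then show "smooth_on (snd c ` (fst c \<inter> U)) (\<lambda>x. \<alpha> (chart_inv c x) \<bullet> X (chart_inv c x))"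
    by (rule smooth_on_cong[OF o]) (use pairing_in chart_inv_in c in blast)
qed

lemma smooth_vec_on_scaleR:
  assumes "open U" "smooth_fun_on M U f" "smooth_vec_on M U X"
  shows "smooth_vec_on M U (\<lambda>p. f p *\<^sub>R X p)"
  using assms unfolding smooth_vec_on_def smooth_fun_on_def
  by (simp add: vec_in_def matrix_vector_mult_scaleR smooth_on_scaleR chart_image_open)

lemma smooth_vec_on_diff:
  assumes "open U" "smooth_vec_on M U X" "smooth_vec_on M U Y"
  shows "smooth_vec_on M U (\<lambda>p. X p - Y p)"
  using assms unfolding smooth_vec_on_def
  by (simp add: vec_in_def matrix_vector_mult_diff_distrib smooth_on_diff chart_image_open)

lemma smooth_vec_on_zero: "smooth_vec_on M U (\<lambda>p. 0)"
  by (simp add: smooth_vec_on_def vec_in_def smooth_on_const)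

lemma smooth_form_on_contract:
  assumes "open U" "smooth_tensor2 M T" "smooth_vec_on M U X"
  shows "smooth_form_on M U (\<lambda>p. T p *v X p)"
  unfolding smooth_form_on_def
proof
  fix c assume c: "c \<in> atlas M"
  note o = chart_image_open[OF c assms(1)]
  have "smooth_on (snd c ` (fst c \<inter> U)) (\<lambda>x. tensor2_in M c T (chart_inv c x))"
    using assms(2) c smooth_on_subset[of "snd c ` fst c" _ "snd c ` (fst c \<inter> U)"]
    by (auto simp: smooth_tensor2_def)
  then have "smooth_on (snd c ` (fst c \<inter> U))
      (\<lambda>x. tensor2_in M c T (chart_inv c x) *v vec_in M c X (chart_inv c x))"
    using assms c by (intro smooth_on_matrix_vector_mult o) (auto simp: smooth_vec_on_def)
  then show "smooth_on (snd c ` (fst c \<inter> U)) (\<lambda>x. form_in M c (\<lambda>p. T p *v X p) (chart_inv c x))"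
    by (rule smooth_on_cong[OF o]) (use tensor2_in_vec_in chart_inv_in c in blast)
qed

lemma smooth_tensor2_transpose: "smooth_tensor2 M T \<Longrightarrow> smooth_tensor2 M (\<lambda>p. transpose (T p))"
  unfolding smooth_tensor2_def tensor2_in_transpose
  using smooth_on_transpose[OF chart_image_open[OF _ open_UNIV], simplified] by blast

lemma smooth_vec_on_raise:
  assumes "open U" "smooth_tensor2 M T" "\<And>p. p \<in> U \<Longrightarrow> invertible (T p)" "smooth_form_on M U \<alpha>"
  shows "smooth_vec_on M U (\<lambda>p. matrix_inv (T p) *v \<alpha> p)"
  unfolding smooth_vec_on_def
proof
  fix c assume c: "c \<in> atlas M"
  note o = chart_image_open[OF c assms(1)]
  have 1: "smooth_on (snd c ` (fst c \<inter> U)) (\<lambda>x. tensor2_in M c T (chart_inv c x))"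
    using assms(2) c smooth_on_subset[of "snd c ` fst c" _ "snd c ` (fst c \<inter> U)"]
    by (auto simp: smooth_tensor2_def)
  have 2: "smooth_on (snd c ` (fst c \<inter> U)) (\<lambda>x. form_in M c \<alpha> (chart_inv c x))"
    using assms(4) c by (auto simp: smooth_form_on_def)
  have i: "invertible (tensor2_in M c T (chart_inv c x))" if "x \<in> snd c ` (fst c \<inter> U)" for x
    using chart_inv_in[OF c that] assms(3) by (intro tensor2_in_invertible(1) c) auto
  have "smooth_on (snd c ` (fst c \<inter> U))
      (\<lambda>x. matrix_inv (tensor2_in M c T (chart_inv c x)) *v form_in M c \<alpha> (chart_inv c x))"
    by (intro smooth_on_matrix_vector_mult smooth_on_matrix_inv o 1 2 i)
  then show "smooth_on (snd c ` (fst c \<inter> U)) (\<lambda>x. vec_in M c (\<lambda>p. matrix_inv (T p) *v \<alpha> p) (chart_inv c x))"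
    by (rule smooth_on_cong[OF o])
      (use chart_inv_in[OF c] assms(3) in \<open>auto intro!: tensor2_in_invertible(2)[OF c]\<close>)
qed

text \<open>The vector field on the domain of \<open>c\<close> with constant components \<open>v\<close> in that chart.\<close>

definition constant_field :: "('a, 'n) chart \<Rightarrow> real^'n \<Rightarrow> 'a \<Rightarrow> real^'n" where
  "constant_field c v p = jacobian c (chart_at M p) p *v v"

lemma vec_in_constant_field:
  assumes "c \<in> atlas M" "d \<in> atlas M" "p \<in> fst c" "p \<in> fst d"
  shows "vec_in M d (constant_field c v) p = jacobian c d p *v v"
  unfolding vec_in_def constant_field_def matrix_vector_mul_assoc
  by (subst jacobian_chain) (use assms chart_at in auto)

lemma smooth_constant_field:
  assumes c: "c \<in> atlas M"
  shows "smooth_vec_on M (fst c) (constant_field c v)"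
  unfolding smooth_vec_on_def
proof
  fix d assume d: "d \<in> atlas M"
  let ?S = "snd d ` (fst d \<inter> fst c)"
  note o = chart_image_open[OF d chart_open[OF c]]
  have "jacobian c d p = matrix_inv (jacobian d c p)" if "p \<in> fst d \<inter> fst c" for p
    using that by (intro matrix_inv_unique[symmetric] jacobian_inverse c d) auto
  moreover have inv: "invertible (jacobian d c (chart_inv d x))" if "x \<in> ?S" for x
    using chart_inv_in[OF d that] jacobian_inverse c d unfolding invertible_def by blast
  moreover have "smooth_on ?S (\<lambda>x. matrix_inv (jacobian d c (chart_inv d x)) *v v)"
    by (intro smooth_on_matrix_vector_mult smooth_on_matrix_inv o jacobian_smooth c d smooth_on_const inv)
  ultimately show "smooth_on ?S (\<lambda>x. vec_in M d (constant_field c v) (chart_inv d x))"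
    by (elim smooth_on_cong[OF o]) (use chart_inv_in[OF d] c d vec_in_constant_field in auto)
qed

lemma constant_field_components:
  assumes "c \<in> atlas M" "p \<in> fst c"
  shows "constant_field c (vec_in M c X p) p = X p"
  unfolding constant_field_def vec_in_def matrix_vector_mul_assoc
  using jacobian_inverse[OF assms(1) chart_at(1) assms(2) chart_at(2)] by simp

end

section \<open>The skew derivative of a 1-form\<close>

text \<open>Half the exterior derivative of \<open>\<alpha>\<close>, \<open>\<nabla>\<^sub>[\<^sub>a\<alpha>\<^sub>b\<^sub>]\<close>, at a point and in the coordinates of
  an arbitrary chart.\<close>

definition skew_deriv :: "('a, 'n::finite) optical_data \<Rightarrow> ('a \<Rightarrow> real^'n) \<Rightarrow> 'a \<Rightarrow> real^'n^'n" where
  "skew_deriv M \<alpha> p = (\<chi> a b. skew2 (nabla_form M \<alpha> p) a b)"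

definition skew_deriv_in :: "('a, 'n::finite) optical_data \<Rightarrow> ('a, 'n) chart \<Rightarrow> ('a \<Rightarrow> real^'n) \<Rightarrow> real^'n \<Rightarrow> real^'n^'n" where
  "skew_deriv_in M c \<alpha> x = (\<chi> a b. (partial a (\<lambda>y. form_in M c \<alpha> (chart_inv c y) $ b) x
      - partial b (\<lambda>y. form_in M c \<alpha> (chart_inv c y) $ a) x) / 2)"

lemma transpose_skew_deriv: "transpose (skew_deriv M \<alpha> p) = - skew_deriv M \<alpha> p"
  by (simp add: skew_deriv_def transpose_def vec_eq_iff skew2_def field_simps)

lemma frechet_derivative_components:
  fixes f :: "real^'n::finite \<Rightarrow> real"
  assumes "f differentiable (at x)"
  shows "frechet_derivative f (at x) v = (\<Sum>i\<in>UNIV. v $ i * partial i f x)"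
proof -
  note lin = linear_frechet_derivative[OF assms]
  have "frechet_derivative f (at x) (\<Sum>i\<in>UNIV. v $ i *\<^sub>R axis i 1) = (\<Sum>i\<in>UNIV. v $ i * partial i f x)"
    unfolding linear_sum[OF lin] linear_scale[OF lin] partial_def by simp
  moreover have "(\<Sum>i\<in>UNIV. v $ i *\<^sub>R axis i 1) = v"
    using basis_expansion[of v] by (simp add: scalar_mult_eq_scaleR)
  ultimately show ?thesis by simp
qed

lemma partial_cong:
  "open S \<Longrightarrow> x \<in> S \<Longrightarrow> (\<And>y. y \<in> S \<Longrightarrow> f y = g y) \<Longrightarrow> partial a f x = partial a g x"
  unfolding partial_def using frechet_derivative_cong_open by metis

lemma partial_mult:
  assumes "f differentiable (at x)" "g differentiable (at x)"
  shows "partial a (\<lambda>y. f y * g y) x = f x * partial a g x + partial a f x * g x"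
proof -
  have "((\<lambda>y. f y * g y) has_derivative
      (\<lambda>v. f x * frechet_derivative g (at x) v + frechet_derivative f (at x) v * g x)) (at x)"
    using assms[unfolded frechet_derivative_works] by (rule has_derivative_mult)
  from frechet_derivative_at[OF this] show ?thesis unfolding partial_def by metis
qed

lemma partial_sum:
  assumes "\<And>i. i \<in> I \<Longrightarrow> f i differentiable (at x)"
  shows "partial a (\<lambda>y. \<Sum>i\<in>I. f i y) x = (\<Sum>i\<in>I. partial a (f i) x)"
proof -
  have "((\<lambda>y. \<Sum>i\<in>I. f i y) has_derivative (\<lambda>v. \<Sum>i\<in>I. frechet_derivative (f i) (at x) v)) (at x)"
    using assms by (intro has_derivative_sum) (simp add: frechet_derivative_works[symmetric])
  from frechet_derivative_at[OF this] show ?thesis unfolding partial_def by metis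
qed

lemma partial_const: "partial a (\<lambda>y. r) x = 0"
  by (simp add: partial_def)

lemma christoffel_sym:
  assumes "\<And>q. transpose (metric M q) = metric M q"
  shows "christoffel M p e a b = christoffel M p e b a"
proof -
  have t: "transpose (tensor2_in M c (metric M) q) = tensor2_in M c (metric M) q" for c q
    unfolding tensor2_in_def by (simp add: matrix_transpose_mul matrix_mul_assoc assms)
  have "tensor2_in M c (metric M) q $ i $ j = tensor2_in M c (metric M) q $ j $ i" for c q i j
    by (subst t[symmetric]) (simp add: transpose_def)
  then show ?thesis
    unfolding christoffel_def Let_def by (simp add: add.commute)
qed

lemma skew_deriv_chart_at:
  assumes "\<And>q. transpose (metric M q) = metric M q"
  shows "skew_deriv M \<alpha> p = skew_deriv_in M (chart_at M p) \<alpha> (snd (chart_at M p) p)"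
  unfolding skew_deriv_def skew_deriv_in_def skew2_def nabla_form_def Let_def
  by (simp add: vec_eq_iff christoffel_sym[OF assms, of p])

context smooth_atlas
begin

lemma form_component_differentiable:
  assumes "c \<in> atlas M" "open U" "p \<in> fst c" "p \<in> U" "smooth_form_on M U \<alpha>"
  shows "(\<lambda>y. form_in M c \<alpha> (chart_inv c y) $ b) differentiable (at (snd c p))"
  using assms chart_image_open[OF assms(1,2)]
  by (intro smooth_on_differentiable[of "snd c ` (fst c \<inter> U)"] smooth_on_vec_nth)
    (simp_all add: smooth_form_on_def)

text \<open>The skew derivative is tensorial: the second derivatives of the transition map, which enter
  the derivative of the transformation law of \<open>\<alpha>\<close>, are symmetric.\<close>

lemma skew_deriv_in_change:
  assumes c: "c \<in> atlas M" and d: "d \<in> atlas M" and p: "p \<in> fst c" "p \<in> fst d"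
    and U: "open U" "p \<in> U" and \<alpha>: "smooth_form_on M U \<alpha>"
  shows "skew_deriv_in M c \<alpha> (snd c p) =
    transpose (jacobian c d p) ** skew_deriv_in M d \<alpha> (snd d p) ** jacobian c d p"
proof -
  let ?x = "snd c p" and ?\<phi> = "snd d \<circ> chart_inv c" and ?J = "jacobian c d p"
  let ?S = "snd c ` (fst c \<inter> (fst d \<inter> U))"
  define u where "u b y = form_in M c \<alpha> (chart_inv c y) $ b" for b y
  define w where "w e z = form_in M d \<alpha> (chart_inv d z) $ e" for e z
  define \<phi> where "\<phi> e y = ?\<phi> y $ e" for e y
  define J where "J e b y = frechet_derivative (\<phi> e) (at y) (axis b 1)" for e b y
  have S: "open ?S" "?x \<in> ?S"
    using p U by (auto intro!: chart_image_open c open_Int chart_open d)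
  have S': "open (snd c ` (fst c \<inter> fst d))" "?x \<in> snd c ` (fst c \<inter> fst d)"
    using p by (auto intro!: chart_image_open c chart_open d)
  have \<phi>: "smooth_on (snd c ` (fst c \<inter> fst d)) (\<phi> e)" for e
    unfolding \<phi>_def by (intro smooth_on_vec_nth S' transition_smooth c d)
  have J: "jacobian c d q $ e $ b = J e b (snd c q)" if "q \<in> fst c" "q \<in> fst d" for e b q
  proof -
    have "((\<lambda>y. ?\<phi> y $ e) has_derivative (\<lambda>v. (jacobian c d q *v v) $ e)) (at (snd c q))"
      by (intro bounded_linear.has_derivative[OF bounded_linear_vec_nth]
          transition_derivative[OF c d that])
    then have "frechet_derivative (\<phi> e) (at (snd c q)) = (\<lambda>v. (jacobian c d q *v v) $ e)"
      unfolding \<phi>_def by (rule frechet_derivative_at[symmetric])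
    then show ?thesis unfolding J_def by (simp add: matrix_vector_mult_basis column_def)
  qed
  have u: "u b y = (\<Sum>e\<in>UNIV. J e b y * w e (?\<phi> y))" if "y \<in> ?S" for b y
  proof -
    from that obtain q where q: "q \<in> fst c" "q \<in> fst d" "y = snd c q" by auto
    have "u b y = (transpose (jacobian c d q) *v form_in M d \<alpha> q) $ b"
      using form_in_change[OF c d q(1,2)] by (simp add: u_def q chart_inv_chart c)
    then show ?thesis
      using q c d by (simp add: matrix_vector_mult_def transpose_def w_def J chart_inv_chart)
  qed
  have wd: "w e differentiable (at (snd d p))" for e
    using form_component_differentiable[OF d U(1) p(2) U(2) \<alpha>] unfolding w_def by blast
  have D\<phi>: "(?\<phi> has_derivative (*v) ?J) (at ?x)" by (intro transition_derivative c d p)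
  have \<phi>x: "?\<phi> ?x = snd d p" by (simp add: chart_inv_chart c p)
  have w\<phi>: "((\<lambda>y. w e (?\<phi> y)) has_derivative
      (\<lambda>v. frechet_derivative (w e) (at (snd d p)) (?J *v v))) (at ?x)" for e
    using diff_chain_at[OF D\<phi>, of "w e"] wd[of e, unfolded frechet_derivative_works]
    unfolding \<phi>x by (simp add: o_def)
  have pw: "partial a (\<lambda>y. w e (?\<phi> y)) ?x = (\<Sum>f\<in>UNIV. ?J $ f $ a * partial f (w e) (snd d p))" for a e
    unfolding partial_def[of a] frechet_derivative_at[OF w\<phi>, symmetric]
    unfolding frechet_derivative_components[OF wd]
    by (simp add: matrix_vector_mult_basis column_def)
  have Jd: "J e b differentiable (at ?x)" for e b
    unfolding J_def by (intro smooth_on_differentiable[OF _ S'(2)] smooth_on_frechet_derivative \<phi>)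
  have pJ: "partial a (J e b) ?x = partial b (J e a) ?x" for a b e
    unfolding J_def partial_def by (rule frechet_derivative_commute[OF S' \<phi>])
  have wd': "(\<lambda>y. w e (?\<phi> y)) differentiable (at ?x)" for e
    using w\<phi> by (auto simp: differentiable_def)
  have pu: "partial a (u b) ?x = (\<Sum>e\<in>UNIV. ?J $ e $ b * (\<Sum>f\<in>UNIV. ?J $ f $ a * partial f (w e) (snd d p))
      + partial a (J e b) ?x * w e (snd d p))" for a b
  proof -
    have "partial a (u b) ?x = partial a (\<lambda>y. \<Sum>e\<in>UNIV. J e b y * w e (?\<phi> y)) ?x"
      by (rule partial_cong[OF S u])
    also have "\<dots> = (\<Sum>e\<in>UNIV. partial a (\<lambda>y. J e b y * w e (?\<phi> y)) ?x)"
      by (intro partial_sum differentiable_mult Jd wd')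
    finally show ?thesis
      unfolding partial_mult[OF Jd wd'] pw \<phi>x J[OF p, symmetric] .
  qed
  have "partial a (u b) ?x - partial b (u a) ?x =
      (\<Sum>e\<in>UNIV. \<Sum>f\<in>UNIV. ?J $ e $ a * (partial e (w f) (snd d p) - partial f (w e) (snd d p)) * ?J $ f $ b)" for a b
  proof -
    have 1: "partial a (u b) ?x - partial b (u a) ?x =
        (\<Sum>e\<in>UNIV. \<Sum>f\<in>UNIV. ?J $ e $ b * (?J $ f $ a * partial f (w e) (snd d p)))
        - (\<Sum>e\<in>UNIV. \<Sum>f\<in>UNIV. ?J $ e $ a * (?J $ f $ b * partial f (w e) (snd d p)))"
      unfolding pu by (simp add: sum.distrib sum_distrib_left pJ[of a _ b])
    have 2: "(\<Sum>e\<in>UNIV. \<Sum>f\<in>UNIV. ?J $ e $ b * (?J $ f $ a * partial f (w e) (snd d p))) =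
        (\<Sum>e\<in>UNIV. \<Sum>f\<in>UNIV. ?J $ f $ b * (?J $ e $ a * partial e (w f) (snd d p)))"
      by (rule sum.swap)
    show ?thesis unfolding 1 2
      by (simp add: sum_subtractf[symmetric] algebra_simps)
  qed
  note * = this
  have "(partial a (u b) ?x - partial b (u a) ?x) / 2 = (\<Sum>f\<in>UNIV. (\<Sum>e\<in>UNIV. ?J $ e $ a *
      ((partial e (w f) (snd d p) - partial f (w e) (snd d p)) / 2)) * ?J $ f $ b)" for a b
    unfolding * sum_divide_distrib sum_distrib_right
    by (subst sum.swap) simp
  then show ?thesis
    unfolding skew_deriv_in_def u_def[symmetric, abs_def] w_def[symmetric, abs_def]
    by (simp only: vec_eq_iff matrix_matrix_mult_def transpose_def vec_lambda_beta) simp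
qed

end

section \<open>Fields on a manifold with a metric\<close>

text \<open>A manifold with a nondegenerate smooth symmetric 2-tensor, of any signature.\<close>

locale metric_manifold = smooth_atlas M
  for M :: "('a::topological_space, 'n::finite) optical_data" +
  assumes metric_smooth: "smooth_tensor2 M (metric M)"
    and metric_sym: "\<And>q. transpose (metric M q) = metric M q"
    and metric_invertible: "\<And>q. invertible (metric M q)"
begin

lemma tensor2_in_skew_deriv:
  assumes "smooth_form_on M U \<alpha>" "open U" "p \<in> U" "c \<in> atlas M" "p \<in> fst c"
  shows "tensor2_in M c (skew_deriv M \<alpha>) p = skew_deriv_in M c \<alpha> (snd c p)"
  unfolding tensor2_in_def skew_deriv_chart_at[OF metric_sym]
  using skew_deriv_in_change[OF assms(4) chart_at(1) assms(5) chart_at(2) assms(2,3,1)] by simp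

lemma smooth_tensor2_skew_deriv:
  assumes "smooth_form_on M UNIV \<alpha>"
  shows "smooth_tensor2 M (skew_deriv M \<alpha>)"
  unfolding smooth_tensor2_def
proof
  fix c assume c: "c \<in> atlas M"
  let ?S = "snd c ` (fst c \<inter> UNIV)"
  note o = chart_image_open[OF c open_UNIV]
  have "smooth_on ?S (\<lambda>x. form_in M c \<alpha> (chart_inv c x) $ b)" for b
    using assms c unfolding smooth_form_on_def by (intro smooth_on_vec_nth o) blast
  then have "smooth_on ?S (\<lambda>x. (1/2) * (partial a (\<lambda>x. form_in M c \<alpha> (chart_inv c x) $ b) x
      - partial b (\<lambda>x. form_in M c \<alpha> (chart_inv c x) $ a) x))" for a b
    unfolding partial_def
    by (intro smooth_on_mult smooth_on_const smooth_on_diff smooth_on_frechet_derivative o)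
  then have "smooth_on ?S (skew_deriv_in M c \<alpha>)"
    unfolding skew_deriv_in_def by (intro smooth_on_vec_lambda o) simp
  then have "smooth_on ?S (\<lambda>x. tensor2_in M c (skew_deriv M \<alpha>) (chart_inv c x))"
    by (rule smooth_on_cong[OF o])
      (auto simp: tensor2_in_skew_deriv[OF assms open_UNIV UNIV_I c] chart_inv_chart[OF c])
  then show "smooth_on (snd c ` fst c) (\<lambda>x. tensor2_in M c (skew_deriv M \<alpha>) (chart_inv c x))"
    by simp
qed

lemma flat_eq: "flat M X p = metric M p *v X p"
proof -
  have "metric M p $ a $ b = metric M p $ b $ a" for a b
    by (subst metric_sym[symmetric]) (simp add: transpose_def)
  then show ?thesis
    unfolding flat_def matrix_vector_mult_def by (simp add: vec_eq_iff)
qed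

lemma smooth_form_on_flat: "open U \<Longrightarrow> smooth_vec_on M U X \<Longrightarrow> smooth_form_on M U (flat M X)"
  using smooth_form_on_contract[OF _ metric_smooth] by (simp add: flat_eq[abs_def])

lemma smooth_fun_on_gform:
  assumes "open U" "smooth_vec_on M U X" "smooth_vec_on M U Y"
  shows "smooth_fun_on M U (\<lambda>p. gform M p (X p) (Y p))"
  using smooth_fun_on_pairing[OF assms(1) smooth_form_on_flat[OF assms(1,3)] assms(2)]
  by (simp add: flat_eq eval2_inner inner_commute)

lemma smooth_fun_on_nonzero_open:
  assumes "open U" "smooth_fun_on M U f" "p \<in> U" "f p \<noteq> 0"
  shows "\<exists>W. open W \<and> p \<in> W \<and> W \<subseteq> U \<and> (\<forall>q\<in>W. f q \<noteq> 0)"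
proof -
  define c where "c = chart_at M p"
  have c: "c \<in> atlas M" "p \<in> fst c" using chart_at by (auto simp: c_def)
  let ?S = "snd c ` (fst c \<inter> U)"
  have "continuous_on ?S (\<lambda>x. f (chart_inv c x))"
    using assms(2) c by (intro smooth_on_continuous) (simp add: smooth_fun_on_def)
  then have "open (?S \<inter> (\<lambda>x. f (chart_inv c x)) -` (- {0}))"
    by (rule continuous_open_preimage) (simp_all add: chart_image_open c assms(1) open_Compl)
  from continuous_open_preimage[OF _ chart_open[OF c(1)] this, of "snd c"]
  have W: "open (fst c \<inter> snd c -` (?S \<inter> (\<lambda>x. f (chart_inv c x)) -` (- {0})))" (is "open ?W")
    using chart_homeomorphism[OF c(1)] by (simp add: homeomorphism_def)
  have p: "p \<in> ?W" using assms c chart_inv_chart by auto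
  have "q \<in> U \<and> f q \<noteq> 0" if "q \<in> ?W" for q
    using that chart_inv_in[OF c(1), of "snd c q" U] chart_inv_chart[OF c(1), of q] by auto
  then show ?thesis using W p by (intro exI[of _ ?W]) blast
qed

text \<open>The product rule \<open>d(f\<alpha>) = f d\<alpha> + df \<and> \<alpha>\<close> at a point; \<open>w\<close> is \<open>df\<close>.\<close>

lemma skew_deriv_scale:
  assumes U: "open U" "p \<in> U" and f: "smooth_fun_on M U f" and \<alpha>: "smooth_form_on M U \<alpha>"
    and eq: "\<And>q. q \<in> U \<Longrightarrow> \<beta> q = f q *\<^sub>R \<alpha> q"
  shows "\<exists>w. \<forall>a b. skew_deriv M \<beta> p $ a $ b =
    f p * skew_deriv M \<alpha> p $ a $ b + (w $ a * \<alpha> p $ b - w $ b * \<alpha> p $ a) / 2"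
proof -
  define c where "c = chart_at M p"
  have c: "c \<in> atlas M" "p \<in> fst c" using chart_at by (auto simp: c_def)
  let ?x = "snd c p" and ?S = "snd c ` (fst c \<inter> U)"
  have S: "open ?S" "?x \<in> ?S" using c U by (auto intro: chart_image_open)
  define F where "F y = f (chart_inv c y)" for y
  define A where "A b y = form_in M c \<alpha> (chart_inv c y) $ b" for b y
  have Fd: "F differentiable (at ?x)"
    using f c unfolding smooth_fun_on_def F_def by (intro smooth_on_differentiable[OF _ S(2)]) simp
  have Ad: "A b differentiable (at ?x)" for b
    unfolding A_def by (rule form_component_differentiable[OF c(1) U(1) c(2) U(2) \<alpha>])
  have F: "F ?x = f p" "A b ?x = \<alpha> p $ b" for b
    using c form_in_chart_at[of p \<alpha>] by (simp_all add: F_def A_def chart_inv_chart c_def[symmetric])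
  have p: "partial a (\<lambda>y. form_in M c \<beta> (chart_inv c y) $ b) ?x =
      f p * partial a (A b) ?x + partial a F ?x * \<alpha> p $ b" for a b
  proof -
    have "partial a (\<lambda>y. form_in M c \<beta> (chart_inv c y) $ b) ?x = partial a (\<lambda>y. F y * A b y) ?x"
    proof (rule partial_cong[OF S])
      fix y assume "y \<in> ?S"
      then have "chart_inv c y \<in> U" using chart_inv_in[OF c(1)] by blast
      then show "form_in M c \<beta> (chart_inv c y) $ b = F y * A b y"
        by (simp add: form_in_def eq F_def A_def matrix_vector_mult_scaleR)
    qed
    then show ?thesis by (simp add: partial_mult[OF Fd Ad] F)
  qed
  show ?thesis
    unfolding skew_deriv_chart_at[OF metric_sym] c_def[symmetric] skew_deriv_in_def
    by (rule exI[of _ "\<chi> a. partial a F ?x"])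
      (simp add: p A_def[abs_def] field_simps)
qed

text \<open>For a field of null vectors, the acceleration is, up to raising an index and a factor \<open>2\<close>,
  the contraction with the skew derivative of the associated 1-form.\<close>

lemma acceleration_eq:
  assumes U: "open U" "p \<in> U" and X: "smooth_vec_on M U X"
    and null: "\<And>q. q \<in> U \<Longrightarrow> gform M q (X q) (X q) = 0"
  shows "metric M p *v (\<chi> b. \<Sum>a\<in>UNIV. X p $ a * nabla_vec M X p a b) =
    2 *\<^sub>R (transpose (skew_deriv M (flat M X) p) *v X p)"
proof -
  define c where "c = chart_at M p"
  have c: "c \<in> atlas M" "p \<in> fst c" using chart_at by (auto simp: c_def)
  let ?x = "snd c p" and ?S = "snd c ` (fst c \<inter> U)"
  have S: "open ?S" "?x \<in> ?S" using c U by (auto intro: chart_image_open)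
  define g where "g i j y = tensor2_in M c (metric M) (chart_inv c y) $ i $ j" for i j y
  define Y where "Y b y = vec_in M c X (chart_inv c y) $ b" for b y
  define G where "G i j = metric M p $ i $ j" for i j
  define x where "x b = X p $ b" for b
  define dg where "dg a i j = partial a (g i j) ?x" for a i j
  define dY where "dY a b = partial a (Y b) ?x" for a b
  have gsym: "g i j = g j i" for i j
  proof -
    have t: "transpose (tensor2_in M c (metric M) q) = tensor2_in M c (metric M) q" for q
      unfolding tensor2_in_def by (simp add: matrix_transpose_mul matrix_mul_assoc metric_sym)
    have "tensor2_in M c (metric M) q $ i $ j = tensor2_in M c (metric M) q $ j $ i" for q
      by (subst t[symmetric]) (simp add: transpose_def)
    then show ?thesis unfolding g_def by simp
  qed
  then have dgsym: "dg a i j = dg a j i" for a i j unfolding dg_def by metis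
  have at_p: "g i j ?x = G i j" "Y b ?x = x b" for i j b
    using tensor2_in_chart_at[of p "metric M"] vec_in_chart_at[of p X] c
    by (simp_all add: g_def Y_def G_def x_def chart_inv_chart c_def[symmetric])
  have Gsym: "G i j = G j i" for i j using gsym at_p by metis
  have gd: "g i j differentiable (at ?x)" for i j
  proof -
    have "smooth_on ?S (\<lambda>y. tensor2_in M c (metric M) (chart_inv c y))"
      using metric_smooth c(1) unfolding smooth_tensor2_def
      by (blast intro: smooth_on_subset)
    then show ?thesis unfolding g_def
      by (intro smooth_on_differentiable[OF _ S(2)] smooth_on_vec_nth S)
  qed
  have Yd: "Y b differentiable (at ?x)" for b
    using X c unfolding smooth_vec_on_def Y_def
    by (intro smooth_on_differentiable[OF _ S(2)] smooth_on_vec_nth S) simp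
  have null': "0 = (\<Sum>i\<in>UNIV. \<Sum>j\<in>UNIV. dg b i j * x i * x j) + 2 * (\<Sum>i\<in>UNIV. \<Sum>j\<in>UNIV. G i j * dY b i * x j)" for b
  proof -
    have "0 = (\<Sum>i\<in>UNIV. \<Sum>j\<in>UNIV. g i j y * Y i y * Y j y)" if "y \<in> ?S" for y
    proof -
      have q: "chart_inv c y \<in> fst c" "chart_inv c y \<in> U" using chart_inv_in[OF c(1) that] by auto
      show ?thesis
        using null[OF q(2)] eval2_in[OF c(1) q(1), of "metric M" X X]
        by (simp add: eval2_def g_def Y_def)
    qed
    then have "partial b (\<lambda>y. 0) ?x = partial b (\<lambda>y. \<Sum>i\<in>UNIV. \<Sum>j\<in>UNIV. g i j y * Y i y * Y j y) ?x"
      by (intro partial_cong[OF S])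
    also have "\<dots> = (\<Sum>i\<in>UNIV. \<Sum>j\<in>UNIV. G i j * x i * dY b j + (G i j * dY b i + dg b i j * x i) * x j)"
      by (simp add: partial_sum partial_mult differentiable_mult differentiable_sum gd Yd at_p dg_def dY_def)
    also have "\<dots> = (\<Sum>i\<in>UNIV. \<Sum>j\<in>UNIV. dg b i j * x i * x j) + (\<Sum>i\<in>UNIV. \<Sum>j\<in>UNIV. G i j * dY b i * x j)
        + (\<Sum>i\<in>UNIV. \<Sum>j\<in>UNIV. G i j * x i * dY b j)"
      by (simp add: sum.distrib algebra_simps)
    also have "(\<Sum>i\<in>UNIV. \<Sum>j\<in>UNIV. G i j * x i * dY b j) = (\<Sum>i\<in>UNIV. \<Sum>j\<in>UNIV. G i j * dY b i * x j)"
      by (subst sum.swap) (simp add: Gsym mult_ac)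
    finally show ?thesis by (simp add: partial_const)
  qed
  have form: "form_in M c (flat M X) (chart_inv c y) $ b = (\<Sum>i\<in>UNIV. g b i y * Y i y)" if "y \<in> ?S" for b y
  proof -
    have q: "chart_inv c y \<in> fst c" using chart_inv_in[OF c(1) that] by auto
    show ?thesis
      using tensor2_in_vec_in[OF c(1) q, of "metric M" X]
      by (simp add: flat_eq[abs_def] g_def Y_def matrix_vector_mult_def[symmetric] vec_eq_iff)
        (simp add: matrix_vector_mult_def)
  qed
  have pform: "partial a (\<lambda>y. form_in M c (flat M X) (chart_inv c y) $ b) ?x =
      (\<Sum>i\<in>UNIV. G b i * dY a i + dg a b i * x i)" for a b
  proof -
    have "partial a (\<lambda>y. form_in M c (flat M X) (chart_inv c y) $ b) ?x =
        partial a (\<lambda>y. \<Sum>i\<in>UNIV. g b i y * Y i y) ?x"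
      by (rule partial_cong[OF S form])
    then show ?thesis
      by (simp add: partial_sum partial_mult differentiable_mult gd Yd at_p dg_def dY_def)
  qed
  define Q where "Q b = (\<Sum>a\<in>UNIV. \<Sum>i\<in>UNIV. x a * x i * dg a b i)" for b
  define R where "R b = (\<Sum>a\<in>UNIV. \<Sum>i\<in>UNIV. x a * G b i * dY a i)" for b
  define N where "N b = (\<Sum>i\<in>UNIV. \<Sum>j\<in>UNIV. dg b i j * x i * x j)" for b
  have rhs: "(2 *\<^sub>R (transpose (skew_deriv M (flat M X) p) *v X p)) $ b = Q b + R b - N b / 2" for b
  proof -
    have "(2 *\<^sub>R (transpose (skew_deriv M (flat M X) p) *v X p)) $ b =
        (\<Sum>a\<in>UNIV. x a * ((\<Sum>i\<in>UNIV. G b i * dY a i + dg a b i * x i) - (\<Sum>i\<in>UNIV. G a i * dY b i + dg b a i * x i)))"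
      unfolding skew_deriv_chart_at[OF metric_sym] c_def[symmetric] skew_deriv_in_def
      by (simp add: matrix_vector_mult_def transpose_def pform sum_distrib_left x_def mult_ac)
    also have "\<dots> = R b + Q b - ((\<Sum>a\<in>UNIV. \<Sum>i\<in>UNIV. G a i * dY b i * x a) + N b)"
      unfolding R_def Q_def N_def
      by (simp add: sum.distrib sum_subtractf sum_distrib_left algebra_simps)
    also have "(\<Sum>a\<in>UNIV. \<Sum>i\<in>UNIV. G a i * dY b i * x a) = - N b / 2"
      using null'[of b] unfolding N_def
      by (subst sum.swap) (simp add: Gsym mult_ac)
    finally show ?thesis by simp
  qed
  have Ginv: "(\<Sum>e\<in>UNIV. G b e * matrix_inv (metric M p) $ e $ d) = (if b = d then 1 else 0)" for b d
    using matrix_inv_mult(1)[OF metric_invertible[of p]]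
    by (simp add: vec_eq_iff matrix_matrix_mult_def mat_def G_def)
  have chr: "(\<Sum>e\<in>UNIV. G b e * christoffel M p e a i) = (dg a i b + dg i a b - dg b a i) / 2" for a b i
  proof -
    have "christoffel M p e a i =
        (\<Sum>d\<in>UNIV. matrix_inv (metric M p) $ e $ d * ((dg a i d + dg i a d - dg d a i) / 2))" for e
      unfolding christoffel_def Let_def c_def[symmetric] g_def[symmetric, abs_def] dg_def
      by (simp add: sum_distrib_left)
    then have "(\<Sum>e\<in>UNIV. G b e * christoffel M p e a i) =
        (\<Sum>d\<in>UNIV. (\<Sum>e\<in>UNIV. G b e * matrix_inv (metric M p) $ e $ d) * ((dg a i d + dg i a d - dg d a i) / 2))"
      by (simp only: sum_distrib_left sum_distrib_right mult.assoc) (rule sum.swap)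
    moreover have "(\<Sum>d\<in>UNIV. (if b = d then 1 else 0) * h d) = h b" for h :: "'n \<Rightarrow> real"
      by (simp add: if_distrib[of "\<lambda>t. t * _"] cong: if_cong)
    ultimately show ?thesis by (simp only: Ginv)
  qed
  have lhs: "(metric M p *v (\<chi> b. \<Sum>a\<in>UNIV. X p $ a * nabla_vec M X p a b)) $ b = R b + Q b - N b / 2" for b
  proof -
    have nv: "nabla_vec M X p a e = dY a e + (\<Sum>i\<in>UNIV. christoffel M p e a i * x i)" for a e
      unfolding nabla_vec_def Let_def c_def[symmetric] dY_def Y_def x_def by simp
    have "(metric M p *v (\<chi> b. \<Sum>a\<in>UNIV. X p $ a * nabla_vec M X p a b)) $ b =
        (\<Sum>e\<in>UNIV. \<Sum>a\<in>UNIV. G b e * (x a * nabla_vec M X p a e))"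
      by (simp add: matrix_vector_mult_def G_def x_def sum_distrib_left)
    also have "\<dots> = (\<Sum>a\<in>UNIV. \<Sum>e\<in>UNIV. G b e * (x a * nabla_vec M X p a e))"
      by (rule sum.swap)
    also have "\<dots> = (\<Sum>a\<in>UNIV. (\<Sum>e\<in>UNIV. x a * G b e * dY a e)
        + (\<Sum>e\<in>UNIV. \<Sum>i\<in>UNIV. x a * x i * (G b e * christoffel M p e a i)))"
      by (simp add: nv sum.distrib[symmetric] sum_distrib_left algebra_simps)
    also have "\<dots> = (\<Sum>a\<in>UNIV. (\<Sum>e\<in>UNIV. x a * G b e * dY a e)
        + (\<Sum>i\<in>UNIV. \<Sum>e\<in>UNIV. x a * x i * (G b e * christoffel M p e a i)))"
      by (subst sum.swap) rule
    also have "\<dots> = R b + (\<Sum>a\<in>UNIV. \<Sum>i\<in>UNIV. x a * x i * ((dg a i b + dg i a b - dg b a i) / 2))"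
      unfolding sum.distrib R_def sum_distrib_left[symmetric] chr ..
    also have "(\<Sum>a\<in>UNIV. \<Sum>i\<in>UNIV. x a * x i * ((dg a i b + dg i a b - dg b a i) / 2)) =
        (\<Sum>a\<in>UNIV. \<Sum>i\<in>UNIV. x a * x i * dg a b i) / 2 + (\<Sum>a\<in>UNIV. \<Sum>i\<in>UNIV. x a * x i * dg i b a) / 2 - N b / 2"
      unfolding N_def
      by (simp add: sum.distrib[symmetric] sum_subtractf[symmetric] sum_divide_distrib dgsym[of _ _ b] algebra_simps
          add_divide_distrib diff_divide_distrib)
    also have "(\<Sum>a\<in>UNIV. \<Sum>i\<in>UNIV. x a * x i * dg i b a) = Q b"
      unfolding Q_def by (subst sum.swap) (simp add: mult_ac)
    finally show ?thesis unfolding Q_def by simp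
  qed
  show ?thesis unfolding vec_eq_iff lhs rhs by simp
qed

end

section \<open>Lorentzian linear algebra along a null line\<close>

lemma eval2_add_left: "eval2 T (u + v) w = eval2 T u w + eval2 T v w"
  by (simp add: eval2_inner inner_add_left)

lemma eval2_add_right: "eval2 T u (v + w) = eval2 T u v + eval2 T u w"
  by (simp add: eval2_inner inner_add_right matrix_vector_right_distrib)

lemma eval2_diff_left: "eval2 T (u - v) w = eval2 T u w - eval2 T v w"
  by (simp add: eval2_inner inner_diff_left)

lemma eval2_diff_right: "eval2 T u (v - w) = eval2 T u v - eval2 T u w"
  by (simp add: eval2_inner inner_diff_right matrix_vector_mult_diff_distrib)

lemma eval2_scaleR_left: "eval2 T (r *\<^sub>R u) w = r * eval2 T u w"
  by (simp add: eval2_inner)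

lemma eval2_scaleR_right: "eval2 T u (r *\<^sub>R w) = r * eval2 T u w"
  by (simp add: eval2_inner matrix_vector_mult_scaleR)

lemma eval2_sum_left: "eval2 T (\<Sum>i\<in>I. f i) w = (\<Sum>i\<in>I. eval2 T (f i) w)"
  by (simp add: eval2_inner inner_sum_left)

lemma eval2_zero_left: "eval2 T 0 w = 0"
  by (simp add: eval2_inner)

lemma eval2_axis: "eval2 T (axis a 1) (axis b 1) = T $ a $ b"
  by (simp add: eval2_inner matrix_vector_mult_basis column_def inner_axis' inner_axis)

lemma eval2_transpose: "eval2 (transpose T) v w = eval2 T w v"
  by (simp add: eval2_inner dot_lmul_matrix[symmetric] inner_commute)

lemmas eval2_linear = eval2_add_left eval2_add_right eval2_diff_left eval2_diff_right
  eval2_scaleR_left eval2_scaleR_right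

lemma skew_form_swap:
  assumes "transpose F = - F"
  shows "F $ a $ b = - F $ b $ a" and "eval2 F v w = - eval2 F w v"
    and "transpose F *v w = - (F *v w)"
proof -
  have "transpose F $ b $ a = (- F) $ b $ a" by (simp only: assms)
  then show "F $ a $ b = - F $ b $ a"
    by (simp only: transpose_def vec_lambda_beta vector_uminus_component)
  show m: "transpose F *v w = - (F *v w)"
    unfolding assms by (simp add: vec_eq_iff matrix_vector_mult_def sum_negf)
  have "eval2 F w v = v \<bullet> (transpose F *v w)"
    using eval2_transpose[of F v w] unfolding eval2_inner by (rule sym)
  then show "eval2 F v w = - eval2 F w v"
    unfolding m by (simp add: eval2_inner)
qed

text \<open>A nonzero null vector \<open>k\<close> at a point, with the metric \<open>G\<close> there. Below, \<open>\<kappa>\<close> is the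
  covector \<open>g(k,\<cdot>)\<close>, so that \<open>k\<^sup>\<bottom>\<close> is the kernel of \<open>\<kappa>\<close>.\<close>

locale null_vector =
  fixes G :: "real^'n::finite^'n" and k :: "real^'n"
  assumes lorentzian: "lorentzian G" and null: "eval2 G k k = 0" and nonzero: "k \<noteq> 0"
begin

definition \<kappa> :: "real^'n" where "\<kappa> = G *v k"

text \<open>The inverse metric on covectors.\<close>

definition B :: "real^'n \<Rightarrow> real^'n \<Rightarrow> real" where "B x y = x \<bullet> (matrix_inv G *v y)"

lemma G_sym: "transpose G = G"
  using lorentzian by (simp add: lorentzian_def)

lemma eval2_sym: "eval2 G v w = eval2 G w v"
  using eval2_transpose[of G v w] by (simp add: G_sym)

text \<open>An orthonormal frame with one timelike vector, and the coefficients with respect to it.\<close>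

lemma frame:
  obtains e :: "'n \<Rightarrow> real^'n" and i0 where
    "\<forall>i j. eval2 G (e i) (e j) = (if i \<noteq> j then 0 else if i = i0 then -1 else 1)"
    "\<forall>v. \<exists>x. v = (\<Sum>i\<in>UNIV. x i *\<^sub>R e i)"
    "\<forall>x j. eval2 G (\<Sum>i\<in>UNIV. x i *\<^sub>R e i) (e j) = (if j = i0 then - x j else x j)"
proof -
  obtain e :: "'n \<Rightarrow> real^'n" and i0 where
    e: "\<And>i j. eval2 G (e i) (e j) = (if i \<noteq> j then 0 else if i = i0 then -1 else 1)"
    using lorentzian by (auto simp: lorentzian_def)
  have c: "eval2 G (\<Sum>i\<in>UNIV. x i *\<^sub>R e i) (e j) = (if j = i0 then - x j else x j)" for x j
  proof -
    have "eval2 G (\<Sum>i\<in>UNIV. x i *\<^sub>R e i) (e j) = (\<Sum>i\<in>UNIV. if i = j then (if j = i0 then - x j else x j) else 0)"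
      unfolding eval2_sum_left by (intro sum.cong) (auto simp: eval2_scaleR_left e)
    then show ?thesis by simp
  qed
  let ?f = "\<lambda>y :: real^'n. \<Sum>i\<in>UNIV. y $ i *\<^sub>R e i"
  have lin: "linear ?f"
    by (rule linearI) (simp_all add: scaleR_add_left sum.distrib scaleR_sum_right)
  have "y = 0" if "?f y = 0" for y
  proof -
    have "(if j = i0 then - y $ j else y $ j) = 0" for j
      using c[of "\<lambda>i. y $ i" j] that by (simp add: eval2_zero_left)
    then show ?thesis by (simp add: vec_eq_iff) (metis neg_equal_0_iff_equal)
  qed
  then have "inj ?f" using linear_injective_0[OF lin] by blast
  then have "surj ?f" using linear_injective_imp_surjective[OF lin] by blast
  then have s: "\<exists>x. v = (\<Sum>i\<in>UNIV. x i *\<^sub>R e i)" for v using surjD[of ?f v] by blast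
  show ?thesis by (rule that[of e i0]) (use e s c in blast)+
qed

lemma nondegenerate:
  assumes "\<And>w. eval2 G v w = 0"
  shows "v = 0"
proof -
  obtain e :: "'n \<Rightarrow> real^'n" and i0 where e0: "\<forall>i j. eval2 G (e i) (e j) = (if i \<noteq> j then 0 else if i = i0 then -1 else 1)"
    "\<forall>v. \<exists>x. v = (\<Sum>i\<in>UNIV. x i *\<^sub>R e i)"
    "\<forall>x j. eval2 G (\<Sum>i\<in>UNIV. x i *\<^sub>R e i) (e j) = (if j = i0 then - x j else x j)"
    by (rule frame)
  note e = e0[rule_format]
  obtain x where x: "v = (\<Sum>i\<in>UNIV. x i *\<^sub>R e i)" using e(2) by blast
  have "x j = 0" for j using e(3)[of x j] assms[of "e j"] x by (simp split: if_splits)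
  then show ?thesis by (simp add: x)
qed

lemma G_invertible: "invertible G"
proof -
  have "v = 0" if "G *v v = 0" for v
  proof (rule nondegenerate)
    show "eval2 G v w = 0" for w
      using that eval2_sym[of v w] by (simp add: eval2_inner)
  qed
  then show ?thesis
    by (simp add: invertible_left_inverse matrix_left_invertible_ker)
qed

lemma G_inv: "G *v (matrix_inv G *v x) = x" "matrix_inv G *v (G *v x) = x"
  by (simp_all only: matrix_vector_mul_assoc matrix_inv_mult[OF G_invertible] matrix_vector_mul_lid)

lemma eval2_kappa: "eval2 G k v = \<kappa> \<bullet> v"
  using eval2_sym[of k v] by (simp add: \<kappa>_def eval2_inner inner_commute)

lemma kappa_k: "\<kappa> \<bullet> k = 0"
  using null eval2_kappa by simp

lemma kappa_nonzero: "\<kappa> \<noteq> 0"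
  using nonzero G_inv(2)[of k] by (auto simp: \<kappa>_def)

lemma inv_kappa: "matrix_inv G *v \<kappa> = k"
  by (simp add: \<kappa>_def G_inv)

lemma B_eval2: "B x y = eval2 G (matrix_inv G *v x) (matrix_inv G *v y)"
  using eval2_sym[of "matrix_inv G *v y" "matrix_inv G *v x"]
  by (simp add: B_def eval2_inner G_inv inner_commute)

lemma B_sym: "B x y = B y x"
  unfolding B_eval2 by (rule eval2_sym)

lemma B_kappa: "B x \<kappa> = x \<bullet> k" "B \<kappa> x = k \<bullet> x"
  using B_sym[of \<kappa> x] by (simp_all add: B_def inv_kappa inner_commute)

lemma B_linear:
  "B (x + y) z = B x z + B y z" "B x (y + z) = B x y + B x z"
  "B (x - y) z = B x z - B y z" "B x (y - z) = B x y - B x z"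
  "B (r *\<^sub>R x) z = r * B x z" "B x (r *\<^sub>R z) = r * B x z"
  by (simp_all add: B_def inner_add_left inner_add_right inner_diff_left inner_diff_right
      matrix_vector_right_distrib matrix_vector_mult_diff_distrib matrix_vector_mult_scaleR)

lemma B_sum_left: "B (\<Sum>i\<in>I. f i) z = (\<Sum>i\<in>I. B (f i) z)"
  by (simp add: B_def inner_sum_left)

lemma B_sum_right: "B x (\<Sum>i\<in>I. f i) = (\<Sum>i\<in>I. B x (f i))"
  using B_sum_left[of f I x] by (simp add: B_sym)

text \<open>The metric is positive semidefinite on the orthogonal complement of a null vector, and
  degenerate only along that vector.\<close>

lemma perp_semidefinite:
  assumes v: "\<kappa> \<bullet> v = 0"
  shows "eval2 G v v \<ge> 0" and "eval2 G v v = 0 \<Longrightarrow> \<exists>t. v = t *\<^sub>R k"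
proof -
  obtain e :: "'n \<Rightarrow> real^'n" and i0 where e0: "\<forall>i j. eval2 G (e i) (e j) = (if i \<noteq> j then 0 else if i = i0 then -1 else 1)"
    "\<forall>v. \<exists>x. v = (\<Sum>i\<in>UNIV. x i *\<^sub>R e i)"
    "\<forall>x j. eval2 G (\<Sum>i\<in>UNIV. x i *\<^sub>R e i) (e j) = (if j = i0 then - x j else x j)"
    by (rule frame)
  note e = e0[rule_format]
  obtain x where x: "v = (\<Sum>i\<in>UNIV. x i *\<^sub>R e i)" using e(2) by blast
  obtain y where y: "k = (\<Sum>i\<in>UNIV. y i *\<^sub>R e i)" using e(2) by blast
  let ?I = "UNIV - {i0}"
  have prod: "eval2 G (\<Sum>i\<in>UNIV. a i *\<^sub>R e i) (\<Sum>i\<in>UNIV. b i *\<^sub>R e i) = (\<Sum>i\<in>?I. a i * b i) - a i0 * b i0" for a b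
  proof -
    have "eval2 G (\<Sum>i\<in>UNIV. b i *\<^sub>R e i) (\<Sum>i\<in>UNIV. a i *\<^sub>R e i) =
        (\<Sum>i\<in>UNIV. b i * (if i = i0 then - a i else a i))"
      unfolding eval2_sum_left eval2_scaleR_left
      by (simp only: eval2_sym[of "e _" "\<Sum>i\<in>UNIV. a i *\<^sub>R e i"] e(3))
    also have "\<dots> = (\<Sum>i\<in>?I. a i * b i) - a i0 * b i0"
      by (subst sum.remove[of _ i0]) (auto intro!: sum.cong)
    finally show ?thesis by (rule trans[OF eval2_sym])
  qed
  have 1: "(\<Sum>i\<in>?I. y i * y i) = y i0 * y i0" using null prod[of y y] unfolding y[symmetric] by simp
  have 2: "(\<Sum>i\<in>?I. y i * x i) = y i0 * x i0" 
    using v[folded eval2_kappa] prod[of y x] unfolding y[symmetric] x[symmetric] by simp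
  have 3: "eval2 G v v = (\<Sum>i\<in>?I. x i * x i) - x i0 * x i0" using prod[of x x] unfolding x[symmetric] .
  have y0: "y i0 \<noteq> 0"
  proof
    assume "y i0 = 0"
    then have "(\<Sum>i\<in>?I. y i * y i) = 0" using 1 by simp
    then have "\<forall>i\<in>?I. y i * y i = 0" by (subst (asm) sum_nonneg_eq_0_iff) auto
    then have "y i = 0" for i using \<open>y i0 = 0\<close> by (cases "i = i0") auto
    then show False using y nonzero by simp
  qed
  \<comment> \<open>A sum of squares, because \<open>k\<close> is null and orthogonal to \<open>v\<close>.\<close>
  have 4: "y i0 * y i0 * eval2 G v v = (\<Sum>i\<in>?I. (y i0 * x i - x i0 * y i) * (y i0 * x i - x i0 * y i))"
  proof -
    have "(\<Sum>i\<in>?I. (y i0 * x i - x i0 * y i) * (y i0 * x i - x i0 * y i)) =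
      y i0 * y i0 * (\<Sum>i\<in>?I. x i * x i) - 2 * y i0 * x i0 * (\<Sum>i\<in>?I. y i * x i)
        + x i0 * x i0 * (\<Sum>i\<in>?I. y i * y i)"
      by (simp add: sum_distrib_left sum.distrib sum_subtractf algebra_simps)
    then show ?thesis unfolding 1 2 3 by (simp add: algebra_simps)
  qed
  have "y i0 * y i0 * eval2 G v v \<ge> 0" unfolding 4 by (intro sum_nonneg) simp
  then show "eval2 G v v \<ge> 0" using y0
    by (metis mult.commute not_real_square_gt_zero zero_le_mult_iff order.strict_iff_not)
  assume "eval2 G v v = 0"
  then have "\<forall>i\<in>?I. (y i0 * x i - x i0 * y i) * (y i0 * x i - x i0 * y i) = 0"
    using 4 by (subst (asm) (2) eq_commute) (simp add: sum_nonneg_eq_0_iff)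
  then have "y i0 * x i = x i0 * y i" for i by (cases "i = i0") auto
  then have xi: "x i = (x i0 / y i0) * y i" for i using y0 by (simp add: field_simps)
  have "v = (\<Sum>i\<in>UNIV. ((x i0 / y i0) * y i) *\<^sub>R e i)" unfolding x by (intro sum.cong refl arg_cong2[of _ _ _ _ "(*\<^sub>R)"] xi)
  also have "\<dots> = (x i0 / y i0) *\<^sub>R k" by (simp add: y scaleR_sum_right)
  finally show "\<exists>t. v = t *\<^sub>R k" by blast
qed

lemma perp_nondegenerate:
  assumes v: "\<kappa> \<bullet> v = 0" and "\<And>w. \<kappa> \<bullet> w = 0 \<Longrightarrow> eval2 G v w = 0"
  shows "\<exists>t. v = t *\<^sub>R k"
  using assms by (intro perp_semidefinite(2)) auto

lemma transversal: obtains l where "\<kappa> \<bullet> l = 1"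
  using kappa_nonzero that[of "\<kappa> /\<^sub>R (\<kappa> \<bullet> \<kappa>)"] by simp

text \<open>In dimension at least 4 one further linear condition still leaves a vector of \<open>k\<^sup>\<bottom>\<close> not
  proportional to \<open>k\<close>.\<close>

lemma spacelike_in_perp:
  assumes n: "CARD('n) \<ge> 4"
  obtains v where "\<kappa> \<bullet> v = 0" "\<beta> \<bullet> v = 0" "eval2 G v v > 0"
proof -
  let ?A = "span {\<kappa>, \<beta>}" and ?K = "{v. \<kappa> \<bullet> v = 0 \<and> \<beta> \<bullet> v = 0}"
  have "dim {y \<in> UNIV. \<forall>x\<in>?A. orthogonal x y} + dim ?A = dim (UNIV :: (real^'n) set)"
    by (rule dim_subspace_orthogonal_to_vectors) auto
  moreover have "dim ?A \<le> 2"
    using dim_le_card'[of "{\<kappa>, \<beta>}"] by (simp add: card_insert_if split: if_splits)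
  moreover have "{y \<in> UNIV. \<forall>x\<in>?A. orthogonal x y} \<subseteq> ?K"
    by (auto simp: orthogonal_def span_base)
  then have "dim {y \<in> UNIV. \<forall>x\<in>?A. orthogonal x y} \<le> dim ?K" by (rule dim_subset)
  ultimately have "dim ?K \<ge> 2" using n by simp
  moreover have "dim (span {k}) \<le> 1" by simp
  ultimately have "\<not> ?K \<subseteq> span {k}" using dim_subset[of ?K "span {k}"] by linarith
  then obtain v where v: "\<kappa> \<bullet> v = 0" "\<beta> \<bullet> v = 0" "v \<notin> span {k}" by auto
  then have "eval2 G v v \<noteq> 0" using perp_semidefinite(2)[OF v(1)] by (auto simp: span_singleton)
  then have "eval2 G v v > 0" using perp_semidefinite(1)[OF v(1)] by simp
  with v that show ?thesis by blast
qed

end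

section \<open>The algebraic equation for the 3-form\<close>

text \<open>The contraction of a vector with the first slot of a 2-tensor.\<close>

definition contract :: "real^'n^'n \<Rightarrow> real^'n \<Rightarrow> real^'n" where
  "contract T v = transpose T *v v"

lemma contract_inner: "contract T v \<bullet> w = eval2 T v w" "w \<bullet> contract T v = eval2 T v w"
  using eval2_transpose[of T w v] by (simp_all add: contract_def eval2_inner inner_commute)

lemma contract_nth: "contract T v $ b = (\<Sum>a\<in>UNIV. v $ a * T $ a $ b)"
  by (simp add: contract_def matrix_vector_mult_def transpose_def mult.commute)

lemma contract_linear:
  "contract T (v + w) = contract T v + contract T w"
  "contract T (v - w) = contract T v - contract T w"
  "contract T (r *\<^sub>R v) = r *\<^sub>R contract T v"
  by (simp_all add: contract_def matrix_vector_right_distrib matrix_vector_mult_diff_distrib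
      matrix_vector_mult_scaleR)

lemma sum4_pair_swap:
  fixes f :: "'n::finite \<Rightarrow> 'n \<Rightarrow> 'n \<Rightarrow> 'n \<Rightarrow> real"
  shows "(\<Sum>a\<in>UNIV. \<Sum>b\<in>UNIV. \<Sum>c\<in>UNIV. \<Sum>d\<in>UNIV. f a b c d) =
    (\<Sum>c\<in>UNIV. \<Sum>d\<in>UNIV. \<Sum>a\<in>UNIV. \<Sum>b\<in>UNIV. f a b c d)"
proof -
  have "(\<Sum>a\<in>UNIV. \<Sum>b\<in>UNIV. \<Sum>c\<in>UNIV. \<Sum>d\<in>UNIV. f a b c d) =
      (\<Sum>a\<in>UNIV. \<Sum>c\<in>UNIV. \<Sum>b\<in>UNIV. \<Sum>d\<in>UNIV. f a b c d)"
    by (rule sum.cong[OF refl], rule sum.swap)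
  also have "\<dots> = (\<Sum>c\<in>UNIV. \<Sum>a\<in>UNIV. \<Sum>b\<in>UNIV. \<Sum>d\<in>UNIV. f a b c d)"
    by (rule sum.swap)
  also have "\<dots> = (\<Sum>c\<in>UNIV. \<Sum>a\<in>UNIV. \<Sum>d\<in>UNIV. \<Sum>b\<in>UNIV. f a b c d)"
    by (rule sum.cong[OF refl], rule sum.cong[OF refl], rule sum.swap)
  also have "\<dots> = (\<Sum>c\<in>UNIV. \<Sum>d\<in>UNIV. \<Sum>a\<in>UNIV. \<Sum>b\<in>UNIV. f a b c d)"
    by (rule sum.cong[OF refl], rule sum.swap)
  finally show ?thesis .
qed

text \<open>The components of \<open>3 \<kappa>\<^sub>[\<^sub>a F\<^sub>b\<^sub>c\<^sub>]\<close> for a skew-symmetric \<open>F\<close>.\<close>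

definition wedge3 :: "real^'n \<Rightarrow> real^'n^'n \<Rightarrow> 'n \<Rightarrow> 'n \<Rightarrow> 'n \<Rightarrow> real" where
  "wedge3 \<kappa> F a b c = \<kappa> $ a * F $ b $ c + \<kappa> $ b * F $ c $ a + \<kappa> $ c * F $ a $ b"

lemma sum4_ad_bc:
  fixes x y :: "'n::finite \<Rightarrow> 'n \<Rightarrow> real"
  shows "(\<Sum>a\<in>UNIV. \<Sum>b\<in>UNIV. \<Sum>c\<in>UNIV. \<Sum>d\<in>UNIV. x a d * y b c) =
    (\<Sum>a\<in>UNIV. \<Sum>d\<in>UNIV. x a d) * (\<Sum>b\<in>UNIV. \<Sum>c\<in>UNIV. y b c)"
  by (simp only: sum_distrib_right[symmetric] sum_distrib_left[symmetric])

lemma sum4_ac_bd: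
  fixes x y :: "'n::finite \<Rightarrow> 'n \<Rightarrow> real"
  shows "(\<Sum>a\<in>UNIV. \<Sum>b\<in>UNIV. \<Sum>c\<in>UNIV. \<Sum>d\<in>UNIV. x a c * y b d) =
    (\<Sum>a\<in>UNIV. \<Sum>c\<in>UNIV. x a c) * (\<Sum>b\<in>UNIV. \<Sum>d\<in>UNIV. y b d)"
  by (simp only: sum_distrib_right[symmetric] sum_distrib_left[symmetric])

context null_vector
begin

text \<open>For the 3-form \<open>T\<close> with components \<open>wedge3 \<kappa> F\<close>: \<open>row3 F a b\<close> is the covector \<open>T\<^sub>a\<^sub>b\<^sub>c\<close> with
  free index \<open>c\<close>, \<open>row3_1\<close> and \<open>row3_2\<close> have one and two vectors in place of the indices \<open>a\<close> and \<open>b\<close>,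
  \<open>contr\<close> is \<open>T\<^sub>a\<^sup>e\<^sup>f T\<^sub>d\<^sub>e\<^sub>f\<close>, and \<open>contr2\<close> its value on two vectors. In these terms the equation of the
  theorem reads \<open>B T\<^sub>a\<^sub>b T\<^sub>c\<^sub>d = r (Q\<^sub>a\<^sub>d g\<^sub>b\<^sub>c - Q\<^sub>a\<^sub>c g\<^sub>b\<^sub>d - Q\<^sub>b\<^sub>d g\<^sub>a\<^sub>c + Q\<^sub>b\<^sub>c g\<^sub>a\<^sub>d)\<close> with \<open>r = -1/(2m)\<close>.\<close>

definition row3 :: "real^'n^'n \<Rightarrow> 'n \<Rightarrow> 'n \<Rightarrow> real^'n" where
  "row3 F a b = \<kappa> $ a *\<^sub>R F $ b - \<kappa> $ b *\<^sub>R F $ a + F $ a $ b *\<^sub>R \<kappa>"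

definition row3_1 :: "real^'n^'n \<Rightarrow> real^'n \<Rightarrow> 'n \<Rightarrow> real^'n" where
  "row3_1 F u b = (\<kappa> \<bullet> u) *\<^sub>R F $ b - \<kappa> $ b *\<^sub>R (contract F u) + (contract F u) $ b *\<^sub>R \<kappa>"

definition row3_2 :: "real^'n^'n \<Rightarrow> real^'n \<Rightarrow> real^'n \<Rightarrow> real^'n" where
  "row3_2 F u v = (\<kappa> \<bullet> u) *\<^sub>R (contract F v) - (\<kappa> \<bullet> v) *\<^sub>R (contract F u)
     + ((contract F u) \<bullet> v) *\<^sub>R \<kappa>"

definition contr :: "real^'n^'n \<Rightarrow> 'n \<Rightarrow> 'n \<Rightarrow> real" where
  "contr F a d = (\<Sum>i\<in>UNIV. \<Sum>e\<in>UNIV. matrix_inv G $ i $ e * B (row3 F a i) (row3 F d e))"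

definition contr2 :: "real^'n^'n \<Rightarrow> real^'n \<Rightarrow> real^'n \<Rightarrow> real" where
  "contr2 F u w = (\<Sum>a\<in>UNIV. \<Sum>d\<in>UNIV. u $ a * w $ d * contr F a d)"

lemma sum_rows: "(\<Sum>a\<in>UNIV. u $ a *\<^sub>R F $ a) = contract F u"
  by (simp add: vec_eq_iff contract_nth)

lemma sum_row3: "(\<Sum>a\<in>UNIV. u $ a *\<^sub>R row3 F a b) = row3_1 F u b"
proof -
  have 1: "(\<Sum>a\<in>UNIV. u $ a *\<^sub>R (\<kappa> $ a *\<^sub>R F $ b)) = (\<kappa> \<bullet> u) *\<^sub>R F $ b"
    by (simp add: scaleR_sum_left[symmetric] inner_vec_def mult.commute)
  have 2: "(\<Sum>a\<in>UNIV. u $ a *\<^sub>R (\<kappa> $ b *\<^sub>R F $ a)) = \<kappa> $ b *\<^sub>R (contract F u)"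
    by (simp add: sum_rows[symmetric] scaleR_sum_right mult_ac)
  have 3: "(\<Sum>a\<in>UNIV. u $ a *\<^sub>R (F $ a $ b *\<^sub>R \<kappa>)) = (contract F u) $ b *\<^sub>R \<kappa>"
    by (simp add: contract_nth scaleR_sum_left[symmetric])
  show ?thesis
    unfolding row3_def row3_1_def scaleR_add_right scaleR_diff_right sum.distrib sum_subtractf 1 2 3 ..
qed

lemma sum_row3_1: "(\<Sum>b\<in>UNIV. v $ b *\<^sub>R row3_1 F u b) = row3_2 F u v"
proof -
  have 1: "(\<Sum>b\<in>UNIV. v $ b *\<^sub>R ((\<kappa> \<bullet> u) *\<^sub>R F $ b)) = (\<kappa> \<bullet> u) *\<^sub>R (contract F v)"
    by (simp add: sum_rows[symmetric] scaleR_sum_right mult_ac)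
  have 2: "(\<Sum>b\<in>UNIV. v $ b *\<^sub>R (\<kappa> $ b *\<^sub>R (contract F u))) = (\<kappa> \<bullet> v) *\<^sub>R (contract F u)"
    by (simp add: scaleR_sum_left[symmetric] inner_vec_def mult.commute)
  have 3: "(\<Sum>b\<in>UNIV. v $ b *\<^sub>R ((contract F u) $ b *\<^sub>R \<kappa>)) = ((contract F u) \<bullet> v) *\<^sub>R \<kappa>"
    by (simp add: scaleR_sum_left[symmetric] inner_vec_def mult.commute)
  show ?thesis
    unfolding row3_2_def row3_1_def scaleR_add_right scaleR_diff_right sum.distrib sum_subtractf 1 2 3 ..
qed

lemma contr2_eq: "contr2 F u w = (\<Sum>i\<in>UNIV. \<Sum>e\<in>UNIV. matrix_inv G $ i $ e * B (row3_1 F u i) (row3_1 F w e))"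
proof -
  have "contr2 F u w = (\<Sum>a\<in>UNIV. \<Sum>d\<in>UNIV. \<Sum>i\<in>UNIV. \<Sum>e\<in>UNIV.
      matrix_inv G $ i $ e * (u $ a * w $ d * B (row3 F a i) (row3 F d e)))"
    unfolding contr2_def contr_def by (simp add: sum_distrib_left mult_ac)
  also have "\<dots> = (\<Sum>i\<in>UNIV. \<Sum>e\<in>UNIV. \<Sum>a\<in>UNIV. \<Sum>d\<in>UNIV.
      matrix_inv G $ i $ e * (u $ a * w $ d * B (row3 F a i) (row3 F d e)))"
    by (rule sum4_pair_swap)
  also have "\<dots> = (\<Sum>i\<in>UNIV. \<Sum>e\<in>UNIV. matrix_inv G $ i $ e *
      B (\<Sum>a\<in>UNIV. u $ a *\<^sub>R row3 F a i) (\<Sum>d\<in>UNIV. w $ d *\<^sub>R row3 F d e))"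
    unfolding B_sum_left unfolding B_sum_right unfolding B_linear by (simp add: sum_distrib_left mult_ac)
  finally show ?thesis unfolding sum_row3 .
qed

text \<open>The contraction of the equation with four vectors. The factor \<open>s\<close> is \<open>1\<close> for the equation
  itself, and \<open>0\<close> to conclude from the vanishing of its right-hand side.\<close>

lemma contract4:
  assumes "\<And>a b c d. s * B (row3 F a b) (row3 F c d) =
    r * (contr F a d * G $ b $ c - contr F a c * G $ b $ d - contr F b d * G $ a $ c + contr F b c * G $ a $ d)"
  shows "s * B (row3_2 F u v) (row3_2 F w z) =
    r * (contr2 F u z * eval2 G v w - contr2 F u w * eval2 G v z
      - contr2 F v z * eval2 G u w + contr2 F v w * eval2 G u z)"
proof -
  define Q where "Q u w a d = u $ a * w $ d * contr F a d" for u w :: "real^'n" and a d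
  define g where "g v w a b = v $ a * w $ b * G $ a $ b" for v w :: "real^'n" and a b
  have "row3_2 F u v = (\<Sum>b\<in>UNIV. \<Sum>a\<in>UNIV. (u $ a * v $ b) *\<^sub>R row3 F a b)" for u v
    by (simp add: sum_row3_1[symmetric] sum_row3[symmetric] scaleR_sum_right mult_ac)
  then have R: "row3_2 F u v = (\<Sum>a\<in>UNIV. \<Sum>b\<in>UNIV. (u $ a * v $ b) *\<^sub>R row3 F a b)" for u v
    by (rule trans) (rule sum.swap)
  have "s * B (row3_2 F u v) (row3_2 F w z) = (\<Sum>a\<in>UNIV. \<Sum>b\<in>UNIV. \<Sum>c\<in>UNIV. \<Sum>d\<in>UNIV.
      (u $ a * v $ b) * (w $ c * z $ d) * (s * B (row3 F a b) (row3 F c d)))"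
    unfolding R unfolding B_sum_left unfolding B_sum_right unfolding B_linear by (simp add: sum_distrib_left mult_ac)
  also have "\<dots> = (\<Sum>a\<in>UNIV. \<Sum>b\<in>UNIV. \<Sum>c\<in>UNIV. \<Sum>d\<in>UNIV.
      r * (Q u z a d * g v w b c - Q u w a c * g v z b d - g u w a c * Q v z b d + g u z a d * Q v w b c))"
    unfolding assms by (intro sum.cong refl) (simp add: Q_def g_def algebra_simps)
  also have "\<dots> = r * ((\<Sum>a\<in>UNIV. \<Sum>b\<in>UNIV. \<Sum>c\<in>UNIV. \<Sum>d\<in>UNIV. Q u z a d * g v w b c)
      - (\<Sum>a\<in>UNIV. \<Sum>b\<in>UNIV. \<Sum>c\<in>UNIV. \<Sum>d\<in>UNIV. Q u w a c * g v z b d)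
      - (\<Sum>a\<in>UNIV. \<Sum>b\<in>UNIV. \<Sum>c\<in>UNIV. \<Sum>d\<in>UNIV. g u w a c * Q v z b d)
      + (\<Sum>a\<in>UNIV. \<Sum>b\<in>UNIV. \<Sum>c\<in>UNIV. \<Sum>d\<in>UNIV. g u z a d * Q v w b c))"
    by (simp only: sum_distrib_left[symmetric] sum.distrib sum_subtractf)
  also have "\<dots> = r * (contr2 F u z * eval2 G v w - contr2 F u w * eval2 G v z
      - contr2 F v z * eval2 G u w + contr2 F v w * eval2 G u z)"
    unfolding sum4_ad_bc sum4_ac_bd
    by (simp add: contr2_def eval2_def Q_def g_def mult_ac)
  finally show ?thesis .
qed

lemma inv_sym: "matrix_inv G $ i $ e = matrix_inv G $ e $ i"
proof -
  have t: "transpose (matrix_inv G) = matrix_inv G"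
  proof (rule matrix_inv_unique[symmetric])
    have "transpose (matrix_inv G ** G) = mat 1" "transpose (G ** matrix_inv G) = mat 1"
      by (simp_all only: matrix_inv_mult[OF G_invertible] transpose_mat)
    then show "G ** transpose (matrix_inv G) = mat 1" "transpose (matrix_inv G) ** G = mat 1"
      by (simp_all add: matrix_transpose_mul G_sym)
  qed
  show ?thesis by (subst t[symmetric]) (simp add: transpose_def)
qed

lemma sum_inv: "(\<Sum>i\<in>UNIV. x $ i * matrix_inv G $ i $ e) = (matrix_inv G *v x) $ e"
  by (simp add: matrix_vector_mult_def inv_sym[of _ e] mult.commute)

lemma contr2_perp:
  assumes F: "transpose F = - F" and u: "\<kappa> \<bullet> u = 0" and \<beta>: "\<beta> = contract F k"
  shows "contr2 F u w = - 2 * (\<kappa> \<bullet> w) * B \<beta> (contract F u) - 2 * (\<beta> \<bullet> u) * (\<beta> \<bullet> w)"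
proof -
  let ?\<phi> = "\<lambda>u. contract F u" and ?H = "matrix_inv G"
  have kF: "k \<bullet> ?\<phi> y = - (\<beta> \<bullet> y)" "?\<phi> y \<bullet> k = - (\<beta> \<bullet> y)" for y
    using skew_form_swap(2)[OF F, of y k] unfolding \<beta> by (simp_all add: contract_inner)
  have "contr2 F u w = (\<Sum>i\<in>UNIV. \<Sum>e\<in>UNIV. ?H $ i $ e *
      ((?\<phi> u) $ i * B \<kappa> (row3_1 F w e) - \<kappa> $ i * B (?\<phi> u) (row3_1 F w e)))"
    unfolding contr2_eq row3_1_def[of F u] by (simp add: u B_linear)
  also have "\<dots> = (\<Sum>e\<in>UNIV. \<Sum>i\<in>UNIV. ?H $ i $ e *
      ((?\<phi> u) $ i * B \<kappa> (row3_1 F w e) - \<kappa> $ i * B (?\<phi> u) (row3_1 F w e)))"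
    by (rule sum.swap)
  also have "\<dots> = (\<Sum>e\<in>UNIV. (\<Sum>i\<in>UNIV. ?\<phi> u $ i * ?H $ i $ e) * B \<kappa> (row3_1 F w e)
      - (\<Sum>i\<in>UNIV. \<kappa> $ i * ?H $ i $ e) * B (?\<phi> u) (row3_1 F w e))"
    by (simp only: sum_distrib_left sum_distrib_right sum_subtractf[symmetric] right_diff_distrib mult_ac)
  also have "\<dots> = B \<kappa> (\<Sum>e\<in>UNIV. (?H *v ?\<phi> u) $ e *\<^sub>R row3_1 F w e)
      - B (?\<phi> u) (\<Sum>e\<in>UNIV. k $ e *\<^sub>R row3_1 F w e)"
    unfolding sum_inv inv_kappa by (simp add: B_sum_right B_linear sum_subtractf)
  also have "\<dots> = B \<kappa> (row3_2 F w (?H *v ?\<phi> u)) - B (?\<phi> u) (row3_2 F w k)"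
    unfolding sum_row3_1 ..
  also have "B \<kappa> (row3_2 F w (?H *v ?\<phi> u)) = - (\<kappa> \<bullet> w) * B \<beta> (?\<phi> u) - (\<beta> \<bullet> u) * (\<beta> \<bullet> w)"
  proof -
    have "\<kappa> \<bullet> (?H *v ?\<phi> u) = - (\<beta> \<bullet> u)" by (simp add: B_def[symmetric] B_kappa kF)
    then show ?thesis
      by (simp add: row3_2_def B_linear B_kappa kF kappa_k inner_commute[of k \<kappa>] B_def[of \<beta>])
  qed
  also have "B (?\<phi> u) (row3_2 F w k) = (\<kappa> \<bullet> w) * B \<beta> (?\<phi> u) + (\<beta> \<bullet> u) * (\<beta> \<bullet> w)"
    by (simp add: row3_2_def B_linear B_kappa kF kappa_k \<beta>[symmetric] B_sym[of _ \<beta>] inner_commute[of w])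
  finally show ?thesis by (simp add: algebra_simps)
qed

text \<open>The equation forces \<open>k \<lrcorner> F\<close> to be a multiple of \<open>\<kappa>\<close>. Let \<open>\<beta> = k \<lrcorner> F\<close> and choose a spacelike \<open>x\<close> in
  \<open>k\<^sup>\<bottom>\<close> with \<open>\<beta>(x) = 0\<close>. Contracted with \<open>k, x, x, l\<close>, where \<open>\<kappa>(l) = 1\<close>, the left-hand side vanishes and
  the right-hand side is a nonzero multiple of \<open>|\<beta>|\<^sup>2 g(x,x)\<close>. Hence \<open>\<beta>\<close> is null; it also annihilates
  \<open>k\<close>, and so it is proportional to \<open>\<kappa>\<close>.\<close>

lemma equation_imp_geodesic:
  assumes F: "transpose F = - F" and n: "CARD('n) \<ge> 4" and r: "r \<noteq> 0"
    and eq: "\<And>a b c d. B (row3 F a b) (row3 F c d) =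
    r * (contr F a d * G $ b $ c - contr F a c * G $ b $ d - contr F b d * G $ a $ c + contr F b c * G $ a $ d)"
  shows "\<exists>t. contract F k = t *\<^sub>R \<kappa>"
proof -
  define \<beta> where "\<beta> = contract F k"
  obtain x where x: "\<kappa> \<bullet> x = 0" "\<beta> \<bullet> x = 0" "eval2 G x x > 0" using spacelike_in_perp[OF n] by blast
  obtain l where l: "\<kappa> \<bullet> l = 1" by (rule transversal)
  have \<beta>k: "\<beta> \<bullet> k = 0"
    using skew_form_swap(2)[OF F, of k k] unfolding \<beta>_def by (simp add: contract_inner)
  have "1 * B (row3_2 F k x) (row3_2 F x l) =
    r * (contr2 F k l * eval2 G x x - contr2 F k x * eval2 G x l
      - contr2 F x l * eval2 G k x + contr2 F x x * eval2 G k l)"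
    by (rule contract4) (simp add: eq)
  moreover have "row3_2 F k x = 0"
    by (simp add: row3_2_def x kappa_k \<beta>_def[symmetric])
  moreover have "contr2 F k x = 0" "contr2 F x x = 0" "contr2 F k l = - 2 * B \<beta> \<beta>"
    by (simp_all add: contr2_perp[OF F _ \<beta>_def] kappa_k x l \<beta>k \<beta>_def[symmetric])
  moreover have "eval2 G k x = 0" by (simp add: eval2_kappa x)
  ultimately have "B \<beta> \<beta> = 0" using r x(3) by (simp add: B_def)
  then have "eval2 G (matrix_inv G *v \<beta>) (matrix_inv G *v \<beta>) = 0" by (simp add: B_eval2)
  moreover have "\<kappa> \<bullet> (matrix_inv G *v \<beta>) = 0"
    using B_kappa(2)[of \<beta>] \<beta>k by (simp add: B_def inner_commute)
  ultimately obtain t where "matrix_inv G *v \<beta> = t *\<^sub>R k" using perp_semidefinite(2) by blast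
  then have "G *v (matrix_inv G *v \<beta>) = t *\<^sub>R \<kappa>"
    by (simp add: \<kappa>_def matrix_vector_mult_scaleR)
  then show ?thesis unfolding G_inv \<beta>_def by blast
qed

text \<open>If the contraction with \<open>k\<close> is a multiple of \<open>\<kappa>\<close>, then \<open>F\<close> may be replaced by a form
  annihilated by \<open>k\<close> without changing \<open>\<kappa> \<and> F\<close> or the restriction to \<open>k\<^sup>\<bottom>\<close>.\<close>

lemma reduce_form:
  assumes F: "transpose F = - F" and c: "contract F k = t *\<^sub>R \<kappa>"
  obtains W where "transpose W = - W" "W *v k = 0" "wedge3 \<kappa> F = wedge3 \<kappa> W"
    "\<And>v. \<kappa> \<bullet> v = 0 \<Longrightarrow> \<exists>s. contract F v = contract W v + s *\<^sub>R \<kappa>"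
proof -
  obtain l where l: "\<kappa> \<bullet> l = 1" by (rule transversal)
  define \<mu> where "\<mu> = contract F l"
  \<comment> \<open>\<open>W = F - \<kappa> \<and> (l \<lrcorner> F)\<close>.\<close>
  define W where "W = (\<chi> a b. F $ a $ b - \<kappa> $ a * \<mu> $ b + \<mu> $ a * \<kappa> $ b)"
  have Fs: "F $ a $ b = - F $ b $ a" for a b by (rule skew_form_swap(1)[OF F])
  have W: "transpose W = - W"
    unfolding vec_eq_iff
  proof (intro allI)
    show "transpose W $ a $ b = (- W) $ a $ b" for a b
      using Fs[of b a] by (simp add: transpose_def W_def)
  qed
  have Wt: "contract W v = contract F v - (\<kappa> \<bullet> v) *\<^sub>R \<mu> + (\<mu> \<bullet> v) *\<^sub>R \<kappa>" for v
    by (simp add: vec_eq_iff contract_nth W_def inner_vec_def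
        sum_distrib_left sum_distrib_right algebra_simps sum.distrib sum_subtractf)
  have "\<mu> \<bullet> k = - (contract F k \<bullet> l)"
    using skew_form_swap(2)[OF F, of l k] by (simp add: \<mu>_def contract_inner)
  then have "\<mu> \<bullet> k = - t" by (simp add: c l)
  then have "contract W k = 0" unfolding Wt c by (simp add: kappa_k)
  then have "W *v k = 0" using skew_form_swap(3)[OF W, of k] by (simp add: contract_def)
  moreover have "wedge3 \<kappa> F = wedge3 \<kappa> W"
    by (simp add: wedge3_def W_def fun_eq_iff algebra_simps)
  moreover have "\<exists>s. contract F v = contract W v + s *\<^sub>R \<kappa>" if "\<kappa> \<bullet> v = 0" for v
    by (rule exI[of _ "- (\<mu> \<bullet> v)"]) (simp add: Wt that)
  ultimately show ?thesis by (rule that[OF W])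
qed

lemma B_rows:
  assumes W: "transpose W = - W" and k: "W *v k = 0"
  shows "B \<kappa> (W $ a) = 0" "B (W $ a) \<kappa> = 0" "B \<kappa> (contract W v) = 0" "B (contract W v) \<kappa> = 0"
    and "contract W k = 0"
proof -
  have "(W *v k) $ a = 0" for a by (simp add: k)
  then show "B \<kappa> (W $ a) = 0" "B (W $ a) \<kappa> = 0"
    by (simp_all add: B_kappa inner_vec_def matrix_vector_mult_def mult.commute)
  show "B \<kappa> (contract W v) = 0" "B (contract W v) \<kappa> = 0"
    by (simp_all add: B_kappa contract_inner) (simp_all add: eval2_inner k)
  show "contract W k = 0"
    using skew_form_swap(3)[OF W, of k] by (simp add: contract_def k)
qed

text \<open>The squared norm of a form annihilated by \<open>k\<close>.\<close>

definition norm2 :: "real^'n^'n \<Rightarrow> real" where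
  "norm2 W = (\<Sum>i\<in>UNIV. \<Sum>e\<in>UNIV. matrix_inv G $ i $ e * B (W $ i) (W $ e))"

lemma B_row3:
  assumes W: "transpose W = - W" and k: "W *v k = 0"
  shows "B (row3 W a b) (row3 W c d) =
    \<kappa> $ a * \<kappa> $ c * B (W $ b) (W $ d) - \<kappa> $ a * \<kappa> $ d * B (W $ b) (W $ c)
    - \<kappa> $ b * \<kappa> $ c * B (W $ a) (W $ d) + \<kappa> $ b * \<kappa> $ d * B (W $ a) (W $ c)"
  using B_rows(1,2)[OF assms]
  by (simp add: row3_def B_linear B_kappa kappa_k algebra_simps)

lemma contr_reduced:
  assumes W: "transpose W = - W" and k: "W *v k = 0"
  shows "contr W a d = \<kappa> $ a * \<kappa> $ d * norm2 W"
proof -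
  let ?H = "matrix_inv G"
  have z: "(\<Sum>i\<in>UNIV. \<Sum>e\<in>UNIV. ?H $ i $ e * (\<kappa> $ i * h e)) = (\<Sum>e\<in>UNIV. k $ e * h e)" for h
  proof -
    have "(\<Sum>i\<in>UNIV. \<Sum>e\<in>UNIV. ?H $ i $ e * (\<kappa> $ i * h e)) =
        (\<Sum>e\<in>UNIV. (\<Sum>i\<in>UNIV. \<kappa> $ i * ?H $ i $ e) * h e)"
      by (subst sum.swap) (simp add: sum_distrib_left mult_ac)
    then show ?thesis by (simp only: sum_inv inv_kappa)
  qed
  have row: "(\<Sum>e\<in>UNIV. k $ e * B (W $ b) (W $ e)) = 0" for b
  proof -
    have "(\<Sum>e\<in>UNIV. k $ e * B (W $ b) (W $ e)) = B (W $ b) (\<Sum>e\<in>UNIV. k $ e *\<^sub>R W $ e)"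
      by (simp add: B_sum_right B_linear)
    then show ?thesis by (simp add: sum_rows B_rows(5)[OF assms]) (simp add: B_def)
  qed
  have kk: "(\<Sum>e\<in>UNIV. k $ e * \<kappa> $ e) = 0"
    using kappa_k by (simp add: inner_vec_def mult.commute)
  have e: "?H $ i $ e * B (row3 W a i) (row3 W d e) =
    \<kappa> $ a * \<kappa> $ d * (?H $ i $ e * B (W $ i) (W $ e)) - \<kappa> $ a * (?H $ i $ e * (\<kappa> $ e * B (W $ d) (W $ i)))
    - \<kappa> $ d * (?H $ i $ e * (\<kappa> $ i * B (W $ a) (W $ e))) + B (W $ a) (W $ d) * (?H $ i $ e * (\<kappa> $ i * \<kappa> $ e))" for i e
    unfolding B_row3[OF assms] B_sym[of "W $ i" "W $ d"] by (simp add: algebra_simps)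
  have z': "(\<Sum>i\<in>UNIV. \<Sum>e\<in>UNIV. ?H $ i $ e * (\<kappa> $ e * B (W $ d) (W $ i))) = 0"
  proof -
    have "(\<Sum>i\<in>UNIV. \<Sum>e\<in>UNIV. ?H $ i $ e * (\<kappa> $ e * B (W $ d) (W $ i))) =
        (\<Sum>i\<in>UNIV. \<Sum>e\<in>UNIV. ?H $ e $ i * (\<kappa> $ e * B (W $ d) (W $ i)))"
      by (intro sum.cong refl arg_cong2[of _ _ _ _ "(*)"] inv_sym)
    also have "\<dots> = (\<Sum>e\<in>UNIV. k $ e * B (W $ d) (W $ e))"
      by (subst sum.swap) (rule z)
    finally show ?thesis by (simp only: row)
  qed
  have "contr W a d = \<kappa> $ a * \<kappa> $ d * norm2 W
    - \<kappa> $ a * (\<Sum>i\<in>UNIV. \<Sum>e\<in>UNIV. ?H $ i $ e * (\<kappa> $ e * B (W $ d) (W $ i)))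
    - \<kappa> $ d * (\<Sum>i\<in>UNIV. \<Sum>e\<in>UNIV. ?H $ i $ e * (\<kappa> $ i * B (W $ a) (W $ e)))
    + B (W $ a) (W $ d) * (\<Sum>i\<in>UNIV. \<Sum>e\<in>UNIV. ?H $ i $ e * (\<kappa> $ i * \<kappa> $ e))"
    unfolding contr_def norm2_def e by (simp only: sum.distrib sum_subtractf sum_distrib_left)
  then show ?thesis unfolding z z' row kk by simp
qed

lemma contr2_reduced:
  assumes W: "transpose W = - W" and k: "W *v k = 0"
  shows "contr2 W u w = (\<kappa> \<bullet> u) * (\<kappa> \<bullet> w) * norm2 W"
proof -
  have "contr2 W u w = (\<Sum>a\<in>UNIV. \<Sum>d\<in>UNIV. (\<kappa> $ a * u $ a) * (\<kappa> $ d * w $ d)) * norm2 W"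
    unfolding contr2_def contr_reduced[OF assms] by (simp add: sum_distrib_left mult_ac)
  then show ?thesis by (simp only: inner_vec_def inner_real_def sum_product)
qed

text \<open>On vectors orthogonal to \<open>k\<close> the equation says that the reduced form is conformal.\<close>

lemma equation_imp_conformal:
  assumes W: "transpose W = - W" and k: "W *v k = 0"
    and eq: "\<And>a b c d. B (row3 W a b) (row3 W c d) =
    r * (contr W a d * G $ b $ c - contr W a c * G $ b $ d - contr W b d * G $ a $ c + contr W b c * G $ a $ d)"
    and v: "\<kappa> \<bullet> v = 0" and w: "\<kappa> \<bullet> w = 0"
  shows "B (contract W v) (contract W w) = - r * norm2 W * eval2 G v w"
proof -
  obtain l where l: "\<kappa> \<bullet> l = 1" by (rule transversal)
  have "1 * B (row3_2 W l v) (row3_2 W l w) =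
    r * (contr2 W l w * eval2 G v l - contr2 W l l * eval2 G v w
      - contr2 W v w * eval2 G l l + contr2 W v l * eval2 G l w)"
    by (rule contract4) (simp add: eq)
  moreover have "B (row3_2 W l v) (row3_2 W l w) = B (contract W v) (contract W w)"
    by (simp add: row3_2_def v w l B_linear B_rows[OF W k]) (simp add: B_kappa kappa_k)
  ultimately show ?thesis by (simp add: contr2_reduced[OF W k] v w l)
qed

text \<open>Conversely, let the reduced form be conformal on \<open>k\<^sup>\<bottom>\<close>. Then \<open>W\<^sub>a\<^sup>e W\<^sub>b\<^sub>e - \<mu> g\<^sub>a\<^sub>b\<close> vanishes on \<open>k\<^sup>\<bottom>\<close>, so it
  is a symmetric product of \<open>\<kappa>\<close> with some \<open>\<nu>\<close>, which drops out of the skew-symmetrised equation. Taking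
  the trace, where \<open>\<nu>(k) = -\<mu>\<close>, determines the norm.\<close>

lemma norm2_conformal:
  assumes W: "transpose W = - W" and Wk: "W *v k = 0"
    and \<mu>: "\<And>v w. \<kappa> \<bullet> v = 0 \<Longrightarrow> \<kappa> \<bullet> w = 0 \<Longrightarrow> B (contract W v) (contract W w) = \<mu> * eval2 G v w"
  shows "norm2 W = \<mu> * (real CARD('n) - 2)"
    and "\<exists>\<nu>. \<forall>a b. B (W $ a) (W $ b) = \<mu> * G $ a $ b + \<kappa> $ a * \<nu> $ b + \<nu> $ a * \<kappa> $ b"
proof -
  obtain l where l: "\<kappa> \<bullet> l = 1" by (rule transversal)
  define D where "D v w = B (contract W v) (contract W w) - \<mu> * eval2 G v w" for v w
  have Dlin: "D (u + v) w = D u w + D v w" "D w (u + v) = D w u + D w v" "D (s *\<^sub>R u) w = s * D u w"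
    "D w (s *\<^sub>R u) = s * D w u" "D (u - v) w = D u w - D v w" "D w (u - v) = D w u - D w v" for u v w s
    by (simp_all add: D_def contract_linear B_linear eval2_linear algebra_simps)
  have Dsym: "D u w = D w u" for u w unfolding D_def by (simp only: B_sym eval2_sym)
  have D0: "D v w = 0" if "\<kappa> \<bullet> v = 0" "\<kappa> \<bullet> w = 0" for v w
    using \<mu>[OF that] by (simp add: D_def)
  have D: "D v w = (\<kappa> \<bullet> v) * D l w + (\<kappa> \<bullet> w) * D l v - (\<kappa> \<bullet> v) * (\<kappa> \<bullet> w) * D l l" for v w
  proof -
    have "D (v - (\<kappa> \<bullet> v) *\<^sub>R l) (w - (\<kappa> \<bullet> w) *\<^sub>R l) = 0"
      by (rule D0) (simp_all add: inner_diff_right l)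
    then show ?thesis unfolding Dlin Dsym[of v l] by (simp add: algebra_simps)
  qed
  define \<nu> where "\<nu> = (\<chi> b. D l (axis b 1) - D l l * \<kappa> $ b / 2)"
  have caxis: "contract W (axis a 1) = W $ a" for a
    by (simp add: vec_eq_iff contract_nth axis_def if_distrib[of "\<lambda>t. t * _"] cong: if_cong)
  have kaxis: "\<kappa> \<bullet> axis a 1 = \<kappa> $ a" for a by (simp add: inner_axis)
  have S: "B (W $ a) (W $ b) = \<mu> * G $ a $ b + \<kappa> $ a * \<nu> $ b + \<nu> $ a * \<kappa> $ b" for a b
    using D[of "axis a 1" "axis b 1"] unfolding D_def[of "axis a 1" "axis b 1"] caxis eval2_axis kaxis
    by (simp add: \<nu>_def field_simps)
  then show "\<exists>\<nu>. \<forall>a b. B (W $ a) (W $ b) = \<mu> * G $ a $ b + \<kappa> $ a * \<nu> $ b + \<nu> $ a * \<kappa> $ b" by blast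
  have kk: "(\<Sum>e\<in>UNIV. k $ e * \<kappa> $ e) = 0"
    using kappa_k by (simp add: inner_vec_def mult.commute)
  have k\<nu>: "(\<Sum>e\<in>UNIV. k $ e * \<nu> $ e) = - \<mu>"
  proof -
    have k: "(\<Sum>e\<in>UNIV. k $ e *\<^sub>R axis e 1) = k"
      using basis_expansion[of k] by (simp add: scalar_mult_eq_scaleR)
    have s: "D l (\<Sum>e\<in>I. k $ e *\<^sub>R axis e 1) = (\<Sum>e\<in>I. k $ e * D l (axis e 1))" if "finite I" for I
      using that by (induction I rule: finite_induct) (simp_all add: Dlin, simp add: D_def B_def contract_def eval2_inner)
    have "D l k = (\<Sum>e\<in>UNIV. k $ e * D l (axis e 1))" using s[of UNIV, OF finite] unfolding k .
    moreover have "D l k = - \<mu>"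
      using eval2_kappa[of l] by (simp add: D_def B_rows[OF W Wk] eval2_sym[of l k] l) (simp add: B_def)
    moreover have "(\<Sum>e\<in>UNIV. k $ e * \<nu> $ e) = (\<Sum>e\<in>UNIV. k $ e * D l (axis e 1))
        - D l l / 2 * (\<Sum>e\<in>UNIV. k $ e * \<kappa> $ e)"
      by (simp add: \<nu>_def right_diff_distrib sum_subtractf sum_distrib_left mult_ac)
    ultimately show ?thesis by (simp add: kk)
  qed
  have tr: "(\<Sum>i\<in>UNIV. \<Sum>e\<in>UNIV. matrix_inv G $ i $ e * G $ i $ e) = real CARD('n)"
  proof -
    have "(\<Sum>e\<in>UNIV. matrix_inv G $ i $ e * G $ i $ e) = 1" for i
    proof -
      have "(matrix_inv G ** G) $ i $ i = 1" by (simp only: matrix_inv_mult[OF G_invertible]) (simp add: mat_def)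
      moreover have "G $ e $ i = G $ i $ e" for e
        by (subst G_sym[symmetric]) (simp add: transpose_def)
      ultimately show ?thesis by (simp add: matrix_matrix_mult_def)
    qed
    then show ?thesis by simp
  qed
  have z: "(\<Sum>i\<in>UNIV. \<Sum>e\<in>UNIV. matrix_inv G $ i $ e * (\<kappa> $ i * \<nu> $ e)) = - \<mu>"
  proof -
    have "(\<Sum>i\<in>UNIV. \<Sum>e\<in>UNIV. matrix_inv G $ i $ e * (\<kappa> $ i * \<nu> $ e)) =
        (\<Sum>e\<in>UNIV. (\<Sum>i\<in>UNIV. \<kappa> $ i * matrix_inv G $ i $ e) * \<nu> $ e)"
      by (subst sum.swap) (simp add: sum_distrib_left mult_ac)
    then show ?thesis by (simp only: sum_inv inv_kappa k\<nu>)
  qed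
  have z': "(\<Sum>i\<in>UNIV. \<Sum>e\<in>UNIV. matrix_inv G $ i $ e * (\<nu> $ i * \<kappa> $ e)) = - \<mu>"
    unfolding z[symmetric] by (subst sum.swap) (simp add: inv_sym mult_ac)
  have "norm2 W = \<mu> * (\<Sum>i\<in>UNIV. \<Sum>e\<in>UNIV. matrix_inv G $ i $ e * G $ i $ e)
     + (\<Sum>i\<in>UNIV. \<Sum>e\<in>UNIV. matrix_inv G $ i $ e * (\<kappa> $ i * \<nu> $ e))
     + (\<Sum>i\<in>UNIV. \<Sum>e\<in>UNIV. matrix_inv G $ i $ e * (\<nu> $ i * \<kappa> $ e))"
    unfolding norm2_def S by (simp add: sum_distrib_left sum.distrib[symmetric] algebra_simps)
  then show "norm2 W = \<mu> * (real CARD('n) - 2)"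
    unfolding tr z z' by (simp add: algebra_simps)
qed

lemma conformal_imp_equation:
  assumes W: "transpose W = - W" and k: "W *v k = 0"
    and \<mu>: "\<And>v w. \<kappa> \<bullet> v = 0 \<Longrightarrow> \<kappa> \<bullet> w = 0 \<Longrightarrow> B (contract W v) (contract W w) = \<mu> * eval2 G v w"
    and r: "r * (real CARD('n) - 2) = - 1"
  shows "B (row3 W a b) (row3 W c d) =
    r * (contr W a d * G $ b $ c - contr W a c * G $ b $ d - contr W b d * G $ a $ c + contr W b c * G $ a $ d)"
proof -
  obtain \<nu> where S: "\<And>a b. B (W $ a) (W $ b) = \<mu> * G $ a $ b + \<kappa> $ a * \<nu> $ b + \<nu> $ a * \<kappa> $ b"
    using norm2_conformal(2)[OF W k \<mu>] by blast
  have rn: "r * (x * norm2 W * y) = - \<mu> * x * y" for x y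
  proof -
    have "r * (x * norm2 W * y) = (r * (real CARD('n) - 2)) * \<mu> * x * y"
      by (simp only: norm2_conformal(1)[OF W k \<mu>] mult_ac)
    then show ?thesis by (simp add: r)
  qed
  show ?thesis
    unfolding B_row3[OF W k] contr_reduced[OF W k] S right_diff_distrib distrib_left rn
    by (simp add: algebra_simps)
qed

lemma row3_nth:
  assumes F: "transpose F = - F"
  shows "row3 F a b $ c = wedge3 \<kappa> F a b c"
  using skew_form_swap(1)[OF F, of c a] by (simp add: row3_def wedge3_def)

lemma equation_lhs:
  assumes F: "transpose F = - F"
  shows "(\<Sum>e\<in>UNIV. raise3 G (wedge3 \<kappa> F) a b e * wedge3 \<kappa> F e c d) = B (row3 F a b) (row3 F c d)"
proof -
  have "wedge3 \<kappa> F e c d = row3 F c d $ e" for e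
    by (simp add: row3_nth[OF F]) (simp add: wedge3_def)
  moreover have "raise3 G (wedge3 \<kappa> F) a b e = (matrix_inv G *v row3 F a b) $ e" for e
    unfolding raise3_def row3_nth[OF F, symmetric] by (rule sum_inv)
  ultimately show ?thesis
    by (simp add: B_sym[of "row3 F a b"]) (simp add: B_def inner_vec_def mult.commute)
qed

lemma equation_rhs:
  assumes F: "transpose F = - F"
  shows "skew_square G (wedge3 \<kappa> F) a b c d = (contr F a d * G $ b $ c - contr F a c * G $ b $ d
    - contr F b d * G $ a $ c + contr F b c * G $ a $ d) / 4"
proof -
  have r: "raise23 G (wedge3 \<kappa> F) a e f =
      (\<Sum>i\<in>UNIV. matrix_inv G $ i $ e * (matrix_inv G *v row3 F a i) $ f)" for a e f
    unfolding raise23_def sum_inv[symmetric] row3_nth[OF F] by (simp add: sum_distrib_left mult_ac)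
  have Q: "(\<Sum>e\<in>UNIV. \<Sum>f\<in>UNIV. raise23 G (wedge3 \<kappa> F) a e f * x * wedge3 \<kappa> F d e f) = contr F a d * x" for a d x
  proof -
    have "(\<Sum>f\<in>UNIV. raise23 G (wedge3 \<kappa> F) a e f * x * wedge3 \<kappa> F d e f) =
        (\<Sum>i\<in>UNIV. matrix_inv G $ i $ e * B (row3 F a i) (row3 F d e)) * x" for e
    proof -
      have "(\<Sum>f\<in>UNIV. raise23 G (wedge3 \<kappa> F) a e f * x * wedge3 \<kappa> F d e f) =
          (\<Sum>f\<in>UNIV. \<Sum>i\<in>UNIV. matrix_inv G $ i $ e * ((matrix_inv G *v row3 F a i) $ f * row3 F d e $ f) * x)"
        unfolding r row3_nth[OF F, symmetric] by (simp add: sum_distrib_right sum_distrib_left mult_ac)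
      also have "\<dots> = (\<Sum>i\<in>UNIV. \<Sum>f\<in>UNIV. matrix_inv G $ i $ e * ((matrix_inv G *v row3 F a i) $ f * row3 F d e $ f) * x)"
        by (rule sum.swap)
      also have "\<dots> = (\<Sum>i\<in>UNIV. matrix_inv G $ i $ e * B (row3 F d e) (row3 F a i)) * x"
        unfolding B_def inner_vec_def by (simp add: sum_distrib_right sum_distrib_left mult_ac)
      finally show ?thesis by (simp only: B_sym)
    qed
    then have "(\<Sum>e\<in>UNIV. \<Sum>f\<in>UNIV. raise23 G (wedge3 \<kappa> F) a e f * x * wedge3 \<kappa> F d e f) =
        (\<Sum>e\<in>UNIV. \<Sum>i\<in>UNIV. matrix_inv G $ i $ e * B (row3 F a i) (row3 F d e)) * x"
      by (simp add: sum_distrib_right)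
    then show ?thesis unfolding contr_def by (subst (2) sum.swap)
  qed
  show ?thesis
    unfolding skew_square_def skew2_def Q by (simp add: field_simps)
qed

lemma B_endo: "B (contract F v) (contract F w) =
    eval2 G (matrix_inv G *v contract F v) (matrix_inv G *v contract F w)"
  by (rule B_eval2)

text \<open>The equation holds for \<open>\<kappa> \<and> F\<close>, with nonzero right-hand side, iff \<open>k\<close> contracts \<open>F\<close> to a
  multiple of \<open>\<kappa>\<close> and the endomorphism of \<open>k\<^sup>\<bottom>\<close> modulo \<open>k\<close> defined by \<open>F\<close> is conformal.\<close>

lemma equation_iff:
  assumes F: "transpose F = - F" and n: "CARD('n) = 2 * m + 2" and m: "m \<ge> 1"
  shows "((\<forall>a b c d. (\<Sum>e\<in>UNIV. raise3 G (wedge3 \<kappa> F) a b e * wedge3 \<kappa> F e c d) =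
         - (2 / real m) * skew_square G (wedge3 \<kappa> F) a b c d) \<and>
       (\<exists>a b c d. - (2 / real m) * skew_square G (wedge3 \<kappa> F) a b c d \<noteq> 0)) \<longleftrightarrow>
    (\<exists>t. contract F k = t *\<^sub>R \<kappa>) \<and>
    (\<exists>\<mu>>0. \<forall>v w. \<kappa> \<bullet> v = 0 \<longrightarrow> \<kappa> \<bullet> w = 0 \<longrightarrow>
       eval2 G (matrix_inv G *v contract F v) (matrix_inv G *v contract F w) = \<mu> * eval2 G v w)"
    (is "?E \<and> ?N \<longleftrightarrow> ?g \<and> ?c")
proof -
  define r where "r = - 1 / (2 * real m)"
  define R where "R F a b c d = contr F a d * G $ b $ c - contr F a c * G $ b $ d - contr F b d * G $ a $ c + contr F b c * G $ a $ d" for F a b c d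
  have r0: "r \<noteq> 0" and rn: "r * (real CARD('n) - 2) = - 1" using m n by (simp_all add: r_def)
  have n4: "CARD('n) \<ge> 4" using m n by simp
  have "- (2 / real m) * (x / 4) = r * x" for x by (simp add: r_def field_simps)
  then have RHS: "- (2 / real m) * skew_square G (wedge3 \<kappa> F) a b c d = r * R F a b c d" for a b c d
    unfolding equation_rhs[OF F] R_def .
  have E: "?E \<longleftrightarrow> (\<forall>a b c d. B (row3 F a b) (row3 F c d) = r * R F a b c d)"
    unfolding equation_lhs[OF F] RHS ..
  have N: "?N \<longleftrightarrow> (\<exists>a b c d. R F a b c d \<noteq> 0)"
    unfolding RHS using r0 by simp
  have red: "\<exists>W. transpose W = - W \<and> W *v k = 0 \<and> (\<forall>a b. row3 F a b = row3 W a b) \<and>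
      (\<forall>v w. \<kappa> \<bullet> v = 0 \<longrightarrow> \<kappa> \<bullet> w = 0 \<longrightarrow> B (contract F v) (contract F w) = B (contract W v) (contract W w))"
    if "contract F k = t *\<^sub>R \<kappa>" for t
  proof -
    obtain W where W: "transpose W = - W" "W *v k = 0" "wedge3 \<kappa> F = wedge3 \<kappa> W"
      "\<And>v. \<kappa> \<bullet> v = 0 \<Longrightarrow> \<exists>s. contract F v = contract W v + s *\<^sub>R \<kappa>"
      using reduce_form[OF F \<open>contract F k = t *\<^sub>R \<kappa>\<close>] by blast
    have "row3 F a b = row3 W a b" for a b
      using W(3) by (simp add: vec_eq_iff row3_nth[OF F] row3_nth[OF W(1)])
    moreover have "B (contract F v) (contract F w) = B (contract W v) (contract W w)"
      if vw: "\<kappa> \<bullet> v = 0" "\<kappa> \<bullet> w = 0" for v w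
    proof -
      obtain s s' where "contract F v = contract W v + s *\<^sub>R \<kappa>" "contract F w = contract W w + s' *\<^sub>R \<kappa>"
        using W(4) vw by blast
      then show ?thesis by (simp add: B_linear B_rows[OF W(1,2)]) (simp add: B_kappa kappa_k)
    qed
    ultimately show ?thesis using W by blast
  qed
  show ?thesis
  proof
    assume "?E \<and> ?N"
    then have eq: "\<And>a b c d. B (row3 F a b) (row3 F c d) = r * R F a b c d"
      and ne: "\<exists>a b c d. R F a b c d \<noteq> 0" using E N by blast+
    have g: "?g"
      using equation_imp_geodesic[OF F n4 r0] eq unfolding R_def contract_def by blast
    then obtain W where W: "transpose W = - W" "W *v k = 0" "\<And>a b. row3 F a b = row3 W a b"
      "\<And>v w. \<kappa> \<bullet> v = 0 \<Longrightarrow> \<kappa> \<bullet> w = 0 \<Longrightarrow> B (contract F v) (contract F w) = B (contract W v) (contract W w)"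
      using red by blast
    have RW: "R F a b c d = R W a b c d" for a b c d
      unfolding R_def contr_def W(3) ..
    have conf: "B (contract W v) (contract W w) = - r * norm2 W * eval2 G v w" if "\<kappa> \<bullet> v = 0" "\<kappa> \<bullet> w = 0" for v w
      using equation_imp_conformal[OF W(1,2) _ that] eq unfolding W(3) RW unfolding R_def by blast
    have n0: "norm2 W \<noteq> 0"
    proof
      assume "norm2 W = 0"
      then have "R W a b c d = 0" for a b c d by (simp add: R_def contr_reduced[OF W(1,2)])
      then show False using ne RW by simp
    qed
    define \<mu> where "\<mu> = - r * norm2 W"
    obtain x where x: "\<kappa> \<bullet> x = 0" "eval2 G x x > 0" using spacelike_in_perp[OF n4] by blast
    have "\<mu> * eval2 G x x \<ge> 0"
    proof -
      have "\<kappa> \<bullet> (matrix_inv G *v contract W x) = 0"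
        using B_rows(3)[OF W(1,2), of x] by (simp add: B_def)
      then show ?thesis
        unfolding \<mu>_def conf[OF x(1) x(1), symmetric] B_endo by (rule perp_semidefinite(1))
    qed
    then have "\<mu> \<ge> 0" using x(2) by (simp add: zero_le_mult_iff)
    moreover have "\<mu> \<noteq> 0" using r0 n0 by (simp add: \<mu>_def)
    ultimately have "\<mu> > 0" by simp
    then have "?c" using conf[folded \<mu>_def] W(4) unfolding B_endo by (intro exI[of _ \<mu>]) simp
    with g show "?g \<and> ?c" by blast
  next
    assume gc: "?g \<and> ?c"
    then obtain W where W: "transpose W = - W" "W *v k = 0" "\<And>a b. row3 F a b = row3 W a b"
      "\<And>v w. \<kappa> \<bullet> v = 0 \<Longrightarrow> \<kappa> \<bullet> w = 0 \<Longrightarrow> B (contract F v) (contract F w) = B (contract W v) (contract W w)"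
      using red by blast
    have RW: "R F a b c d = R W a b c d" for a b c d
      unfolding R_def contr_def W(3) ..
    obtain \<mu> where \<mu>: "\<mu> > 0"
      "\<And>v w. \<kappa> \<bullet> v = 0 \<Longrightarrow> \<kappa> \<bullet> w = 0 \<Longrightarrow> B (contract W v) (contract W w) = \<mu> * eval2 G v w"
      using gc W(4) unfolding B_endo by metis
    have "?E" unfolding E W(3) RW unfolding R_def
      by (intro allI, rule conformal_imp_equation[OF W(1,2) _ rn]) (rule \<mu>(2))
    moreover
    have "\<exists>a b c d. R F a b c d \<noteq> 0"
    proof (rule ccontr)
      assume "\<not> (\<exists>a b c d. R F a b c d \<noteq> 0)"
      then have R0: "R W a b c d = 0" for a b c d using RW by simp
      obtain x where x: "\<kappa> \<bullet> x = 0" "eval2 G x x > 0" using spacelike_in_perp[OF n4] by blast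
      obtain l where l: "\<kappa> \<bullet> l = 1" by (rule transversal)
      have "0 * B (row3_2 W l x) (row3_2 W x l) = 1 * (contr2 W l l * eval2 G x x - contr2 W l x * eval2 G x l
          - contr2 W x l * eval2 G l x + contr2 W x x * eval2 G l l)"
        by (rule contract4) (use R0 in \<open>simp add: R_def\<close>)
      then have "norm2 W * eval2 G x x = 0"
        by (simp only: contr2_reduced[OF W(1,2)] l x(1)) simp
      then have "norm2 W = 0" using x(2) by simp
      moreover have "norm2 W = \<mu> * (real CARD('n) - 2)"
        by (rule norm2_conformal(1)[OF W(1,2)]) (rule \<mu>(2))
      ultimately have "\<mu> * (real CARD('n) - 2) = 0" by simp
      then have "real CARD('n) - 2 = 0" using \<mu>(1) by simp
      then show False using rn by (simp only:)
    qed
    then have "?N" by (rule iffD2[OF N])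
    ultimately show "?E \<and> ?N" by (rule conjI)
  qed
qed

end

section \<open>The screen bundle\<close>

text \<open>The part of an optical geometry that the arguments use, on a manifold without the separation
  and countability axioms.\<close>

locale optical_manifold = metric_manifold M
  for M :: "('a::topological_space, 'n::finite) optical_data" +
  assumes lorentz: "\<And>p. lorentzian (metric M p)"
    and null_line: "null_line_distribution M"
    and time_oriented: "time_orientation M"

text \<open>A positively oriented section \<open>k\<close> of the null line distribution.\<close>

locale optical_field = optical_manifold M
  for M :: "('a::topological_space, 'n::finite) optical_data" +
  fixes k :: "'a \<Rightarrow> real^'n"
  assumes optical: "optical_vector_field M k"
begin

abbreviation \<kappa> :: "'a \<Rightarrow> real^'n" where "\<kappa> \<equiv> flat M k"

abbreviation F :: "'a \<Rightarrow> real^'n^'n" where "F \<equiv> skew_deriv M \<kappa>"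

text \<open>The endomorphism of the tangent space obtained from \<open>\<nabla>\<^sub>[\<^sub>a\<kappa>\<^sub>b\<^sub>]\<close> by raising the second index.\<close>

definition A :: "'a \<Rightarrow> real^'n \<Rightarrow> real^'n" where
  "A p v = matrix_inv (metric M p) *v contract (F p) v"

lemma k_smooth: "smooth_vec_on M UNIV k"
  and k_line: "k p \<in> line M p" and k_nonzero: "k p \<noteq> 0"
  and k_future: "t \<in> future M p \<Longrightarrow> gform M p (k p) t < 0"
  using optical by (auto simp: optical_vector_field_def)

lemma line_subspace: "subspace (line M p)" and line_dim: "dim (line M p) = 1"
  and line_null: "v \<in> line M p \<Longrightarrow> gform M p v v = 0"
  using null_line by (auto simp: null_line_distribution_def)

lemma null_vector: "null_vector (metric M p) (k p)"
  using lorentz line_null[OF k_line] k_nonzero by (simp add: null_vector_def)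

lemma kappa_eq: "null_vector.\<kappa> (metric M p) (k p) = \<kappa> p"
  by (simp add: null_vector.\<kappa>_def[OF null_vector] flat_eq)

lemma line_eq: "line M p = span {k p}"
proof -
  have "span {k p} = line M p"
  proof (rule subspace_dim_equal)
    show "span {k p} \<subseteq> line M p"
      using k_line line_subspace by (intro span_minimal) auto
    show "dim (line M p) \<le> dim (span {k p})"
      using k_nonzero line_dim by simp
  qed (use line_subspace in auto)
  then show ?thesis ..
qed

lemma line_iff: "v \<in> line M p \<longleftrightarrow> (\<exists>t. v = t *\<^sub>R k p)"
  by (auto simp: line_eq span_singleton)

lemma g_sym: "gform M p v w = gform M p w v"
  using eval2_transpose[of "metric M p" v w] by (simp add: metric_sym)

lemma g_k: "gform M p (k p) v = \<kappa> p \<bullet> v"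
  using g_sym[of p "k p" v] by (simp add: flat_eq eval2_inner inner_commute)

lemma perp_iff: "v \<in> perp M p \<longleftrightarrow> \<kappa> p \<bullet> v = 0"
proof
  assume "v \<in> perp M p"
  then have "gform M p (k p) v = 0" using k_line unfolding perp_def by blast
  then show "\<kappa> p \<bullet> v = 0" by (simp only: g_k)
next
  assume "\<kappa> p \<bullet> v = 0"
  then show "v \<in> perp M p"
    by (auto simp: perp_def line_iff eval2_scaleR_left g_k)
qed

lemma perp_subspace: "subspace (perp M p)"
  by (rule subspaceI) (simp_all add: perp_iff inner_add_right)

lemma line_perp: "v \<in> line M p \<Longrightarrow> v \<in> perp M p"
  using null_vector.kappa_k[OF null_vector, of p] by (auto simp: line_iff perp_iff kappa_eq)

lemma g_line: "u \<in> line M p \<Longrightarrow> v \<in> perp M p \<Longrightarrow> gform M p u v = 0"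
  by (auto simp: perp_def)

lemma line_nondegenerate:
  assumes "v \<in> perp M p" "\<And>w. w \<in> perp M p \<Longrightarrow> gform M p v w = 0"
  shows "v \<in> line M p"
  using null_vector.perp_nondegenerate[OF null_vector, of p v] assms
  unfolding kappa_eq perp_iff line_iff by blast

lemma screen_class_iff: "w \<in> screen_class M p v \<longleftrightarrow> v \<in> perp M p \<and> w \<in> perp M p \<and> v - w \<in> line M p"
  by (simp add: screen_rel_def)

lemma screen_class_self: "v \<in> perp M p \<Longrightarrow> v \<in> screen_class M p v"
  unfolding screen_class_iff using subspace_0[OF line_subspace] by simp

lemma screen_class_eq_iff:
  assumes "v \<in> perp M p" "w \<in> perp M p"
  shows "screen_class M p v = screen_class M p w \<longleftrightarrow> v - w \<in> line M p"
proof
  assume "screen_class M p v = screen_class M p w"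
  then show "v - w \<in> line M p" using screen_class_self[OF assms(2)] screen_class_iff by blast
next
  assume d: "v - w \<in> line M p"
  have "v - u \<in> line M p \<longleftrightarrow> w - u \<in> line M p" for u
    using subspace_diff[OF line_subspace _ d, of "v - u"] subspace_add[OF line_subspace _ d, of "w - u"]
    by auto
  then show "screen_class M p v = screen_class M p w"
    using assms by (intro set_eqI) (simp only: screen_class_iff)
qed

lemma screen_iff: "V \<in> screen M p \<longleftrightarrow> (\<exists>v\<in>perp M p. V = screen_class M p v)"
  unfolding screen_def quotient_def by blast

lemma screen_class_in: "v \<in> perp M p \<Longrightarrow> screen_class M p v \<in> screen M p"
  using screen_iff by blast

lemma screen_add_class:
  assumes "v \<in> perp M p" "w \<in> perp M p"
  shows "screen_add M p (screen_class M p v) (screen_class M p w) = screen_class M p (v + w)"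
proof -
  have eq: "screen_class M p (v' + w') = screen_class M p (v + w)"
    if "v' \<in> screen_class M p v" "w' \<in> screen_class M p w" for v' w'
  proof -
    have "(v - v') + (w - w') \<in> line M p"
      using that subspace_add[OF line_subspace] unfolding screen_class_iff by blast
    then have "(v + w) - (v' + w') \<in> line M p" by (simp add: algebra_simps)
    then show ?thesis
      using that assms subspace_add[OF perp_subspace] screen_class_eq_iff[of "v + w" p "v' + w'"]
      unfolding screen_class_iff by metis
  qed
  then show ?thesis
    using screen_class_self[OF assms(1)] screen_class_self[OF assms(2)]
    unfolding screen_add_def by blast
qed

lemma screen_scale_class:
  assumes "v \<in> perp M p"
  shows "screen_scale M p r (screen_class M p v) = screen_class M p (r *\<^sub>R v)"
proof -
  have eq: "screen_class M p (r *\<^sub>R v') = screen_class M p (r *\<^sub>R v)"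
    if "v' \<in> screen_class M p v" for v'
  proof -
    have "r *\<^sub>R v - r *\<^sub>R v' \<in> line M p"
      using that subspace_scale[OF line_subspace, of "v - v'" p r] unfolding screen_class_iff
      by (simp add: scaleR_diff_right)
    then show ?thesis
      using that assms subspace_scale[OF perp_subspace] screen_class_eq_iff[of "r *\<^sub>R v" p "r *\<^sub>R v'"]
      unfolding screen_class_iff by metis
  qed
  then show ?thesis
    using screen_class_self[OF assms(1)] unfolding screen_scale_def by blast
qed

text \<open>The value on two classes of a bilinear form that descends to the screen space.\<close>

lemma the_elem_class:
  assumes "v \<in> perp M p" "w \<in> perp M p"
    and T: "\<And>u x. u \<in> line M p \<Longrightarrow> x \<in> perp M p \<Longrightarrow> eval2 T u x = 0 \<and> eval2 T x u = 0"
  shows "the_elem (\<Union>v'\<in>screen_class M p v. \<Union>w'\<in>screen_class M p w. {eval2 T v' w'}) = eval2 T v w"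
proof -
  have "eval2 T v' w' = eval2 T v w" if "v' \<in> screen_class M p v" "w' \<in> screen_class M p w" for v' w'
  proof -
    have "v' \<in> perp M p" "w' \<in> perp M p" "v - v' \<in> line M p" "w - w' \<in> line M p"
      using that unfolding screen_class_iff by blast+
    then have "eval2 T (v - v') w = 0" "eval2 T v' (w - w') = 0"
      using T assms(1,2) by blast+
    then show ?thesis by (simp add: eval2_linear)
  qed
  then have "(\<Union>v'\<in>screen_class M p v. \<Union>w'\<in>screen_class M p w. {eval2 T v' w'}) = {eval2 T v w}"
    using screen_class_self[OF assms(1)] screen_class_self[OF assms(2)] by blast
  then show ?thesis by simp
qed

lemma screen_metric_class:
  assumes "v \<in> perp M p" "w \<in> perp M p"
  shows "screen_metric M p (screen_class M p v) (screen_class M p w) = gform M p v w"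
  unfolding screen_metric_def
  by (rule the_elem_class[OF assms]) (metis g_line g_sym)

section \<open>The twist endomorphism\<close>

text \<open>The condition \<open>k\<^sup>a\<nabla>\<^sub>[\<^sub>a\<kappa>\<^sub>b\<^sub>] = t\<kappa>\<^sub>b\<close>. It makes \<open>\<nabla>\<^sub>[\<^sub>a\<kappa>\<^sub>b\<^sub>]\<close> descend to the screen space, and it holds at
  every point iff the congruence is geodesic.\<close>

definition geod :: "'a \<Rightarrow> bool" where
  "geod p \<longleftrightarrow> (\<exists>t. contract (F p) (k p) = t *\<^sub>R \<kappa> p)"

lemma F_skew: "transpose (F p) = - F p"
  by (rule transpose_skew_deriv)

lemma g_A: "gform M p (A p v) w = eval2 (F p) v w"
  using g_sym[of p "A p v" w] null_vector.G_inv(1)[OF null_vector, of p "contract (F p) v"]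
  by (simp add: A_def eval2_inner[of "metric M p"] contract_inner)

lemma A_linear: "A p (v + w) = A p v + A p w" "A p (v - w) = A p v - A p w" "A p (r *\<^sub>R v) = r *\<^sub>R A p v"
  by (simp_all add: A_def contract_linear matrix_vector_right_distrib matrix_vector_mult_diff_distrib
      matrix_vector_mult_scaleR)

lemma F_k:
  assumes "geod p" "u \<in> line M p" "v \<in> perp M p"
  shows "eval2 (F p) u v = 0" "eval2 (F p) v u = 0"
proof -
  obtain t where t: "contract (F p) (k p) = t *\<^sub>R \<kappa> p" using assms(1) by (auto simp: geod_def)
  obtain r where r: "u = r *\<^sub>R k p" using assms(2) by (auto simp: line_iff)
  have "contract (F p) (k p) \<bullet> v = 0" using assms(3) by (simp add: t perp_iff)
  then show "eval2 (F p) u v = 0" by (simp add: r eval2_linear contract_inner)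
  then show "eval2 (F p) v u = 0" using skew_form_swap(2)[OF F_skew, of p v u] by simp
qed

lemma A_perp: "geod p \<Longrightarrow> v \<in> perp M p \<Longrightarrow> A p v \<in> perp M p"
  using F_k(2)[of p "k p" v] k_line g_A[of p v "k p"] g_sym[of p "A p v"]
  by (simp add: perp_iff g_k[symmetric])

lemma A_line:
  assumes "geod p" "u \<in> line M p"
  shows "A p u \<in> line M p"
  using assms A_perp[OF assms(1) line_perp[OF assms(2)]] F_k(1)[OF assms]
  by (intro line_nondegenerate) (simp_all add: g_A)

lemma twist_class:
  assumes "geod p" "v \<in> perp M p" "w \<in> perp M p"
  shows "twist M k p (screen_class M p v) (screen_class M p w) = eval2 (F p) v w"
  unfolding twist_def skew_deriv_def[symmetric]
  using F_k[OF assms(1)] by (intro the_elem_class assms) blast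

lemma twist_endo_class:
  assumes "geod p" "v \<in> perp M p"
  shows "twist_endo M k p (screen_class M p v) = screen_class M p (A p v)"
  unfolding twist_endo_def
proof (rule the_equality)
  note Av = A_perp[OF assms]
  show "screen_class M p (A p v) \<in> screen M p \<and> (\<forall>W\<in>screen M p.
      screen_metric M p (screen_class M p (A p v)) W = twist M k p (screen_class M p v) W)"
    using Av assms by (auto simp: screen_class_in screen_iff screen_metric_class twist_class g_A)
  fix Z assume Z: "Z \<in> screen M p \<and> (\<forall>W\<in>screen M p. screen_metric M p Z W = twist M k p (screen_class M p v) W)"
  then obtain z where z: "z \<in> perp M p" "Z = screen_class M p z" by (auto simp: screen_iff)
  have "gform M p (z - A p v) w = 0" if w: "w \<in> perp M p" for w
  proof -
    have "screen_metric M p Z (screen_class M p w) = twist M k p (screen_class M p v) (screen_class M p w)"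
      using Z screen_class_in[OF w] by blast
    then show ?thesis
      by (simp add: z(2) screen_metric_class[OF z(1) w] twist_class[OF assms w] eval2_linear g_A)
  qed
  then have "z - A p v \<in> line M p"
    using z(1) Av by (intro line_nondegenerate subspace_diff[OF perp_subspace])
  then show "Z = screen_class M p (A p v)"
    using screen_class_eq_iff[OF z(1) Av] z(2) by simp
qed

text \<open>The twist endomorphism of the screen space is conformal with squared factor \<open>\<mu>\<close>.\<close>

definition conformal :: "'a \<Rightarrow> real \<Rightarrow> bool" where
  "conformal p \<mu> \<longleftrightarrow> (\<forall>v\<in>perp M p. \<forall>w\<in>perp M p. gform M p (A p v) (A p w) = \<mu> * gform M p v w)"

text \<open>A skew-symmetric isometry squares to \<open>-1\<close>.\<close>

lemma conformal_square:
  assumes g: "geod p" and "conformal p 1" and v: "v \<in> perp M p"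
  shows "A p (A p v) + v \<in> line M p"
proof (rule line_nondegenerate)
  note Av = A_perp[OF g v]
  show "A p (A p v) + v \<in> perp M p"
    using A_perp[OF g Av] v by (rule subspace_add[OF perp_subspace])
  fix w assume w: "w \<in> perp M p"
  have "gform M p (A p w) (A p v) = gform M p w v"
    using assms(2) v w by (simp add: conformal_def)
  then have "eval2 (F p) w (A p v) = gform M p w v" by (simp only: g_A)
  then show "gform M p (A p (A p v) + v) w = 0"
    using skew_form_swap(2)[OF F_skew, of p "A p v" w] g_sym[of p v w] by (simp add: eval2_linear g_A)
qed

lemma smooth_F: "smooth_tensor2 M F"
  by (intro smooth_tensor2_skew_deriv smooth_form_on_flat k_smooth open_UNIV)

lemma smooth_A:
  assumes "open U" "smooth_vec_on M U X"
  shows "smooth_vec_on M U (\<lambda>p. A p (X p))"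
  unfolding A_def contract_def
  by (intro smooth_vec_on_raise smooth_form_on_contract smooth_tensor2_transpose
      smooth_F metric_smooth metric_invertible assms)

text \<open>The vector field \<open>A(X)\<close> represents the image of the section of the screen bundle defined by \<open>X\<close>,
  whence the smoothness of the twist endomorphism.\<close>

lemma twist_is_complex_structure_iff:
  assumes g: "\<And>p. geod p"
  shows "twist_is_complex_structure M k \<longleftrightarrow> (\<forall>p. conformal p 1)"
proof -
  have c: "screen_compatible M (twist_endo M k) \<longleftrightarrow> (\<forall>p. conformal p 1)"
  proof -
    have "(\<forall>V\<in>screen M p. \<forall>W\<in>screen M p.
        screen_metric M p (twist_endo M k p V) (twist_endo M k p W) = screen_metric M p V W) \<longleftrightarrow>
      (\<forall>v\<in>perp M p. \<forall>w\<in>perp M p. gform M p (A p v) (A p w) = gform M p v w)" for p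
    proof -
      have "screen M p = screen_class M p ` perp M p" using screen_iff by blast
      then show ?thesis
        using A_perp[OF g] by (simp add: twist_endo_class[OF g] screen_metric_class)
    qed
    then show ?thesis by (simp add: screen_compatible_def conformal_def)
  qed
  have "bundle_complex_structure M (twist_endo M k)" if conf: "\<forall>p. conformal p 1"
    unfolding bundle_complex_structure_def
  proof (intro conjI allI)
    fix p
    show "screen_linear M p (twist_endo M k p)"
      unfolding screen_linear_def
    proof (intro conjI ballI allI)
      fix V assume "V \<in> screen M p"
      then obtain v where v: "v \<in> perp M p" "V = screen_class M p v" unfolding screen_iff by blast
      show "twist_endo M k p V \<in> screen M p"
        unfolding v(2) twist_endo_class[OF g v(1)] using A_perp[OF g v(1)] by (rule screen_class_in)
      fix r
      show "twist_endo M k p (screen_scale M p r V) = screen_scale M p r (twist_endo M k p V)"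
        unfolding v(2) screen_scale_class[OF v(1)] twist_endo_class[OF g v(1)]
          twist_endo_class[OF g subspace_scale[OF perp_subspace v(1)]]
          screen_scale_class[OF A_perp[OF g v(1)]] A_linear ..
    next
      fix V W assume "V \<in> screen M p" "W \<in> screen M p"
      then obtain v w where v: "v \<in> perp M p" "V = screen_class M p v"
        and w: "w \<in> perp M p" "W = screen_class M p w" unfolding screen_iff by blast
      show "twist_endo M k p (screen_add M p V W) = screen_add M p (twist_endo M k p V) (twist_endo M k p W)"
        unfolding v(2) w(2) screen_add_class[OF v(1) w(1)] twist_endo_class[OF g v(1)] twist_endo_class[OF g w(1)]
          twist_endo_class[OF g subspace_add[OF perp_subspace v(1) w(1)]]
          screen_add_class[OF A_perp[OF g v(1)] A_perp[OF g w(1)]] A_linear ..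
    qed
    show "\<forall>V\<in>screen M p. twist_endo M k p (twist_endo M k p V) = screen_scale M p (- 1) V"
    proof
      fix V assume "V \<in> screen M p"
      then obtain v where v: "v \<in> perp M p" "V = screen_class M p v" by (auto simp: screen_iff)
      have "A p (A p v) - (- 1) *\<^sub>R v \<in> line M p"
        using conformal_square[OF g _ v(1)] conf by simp
      moreover have "A p (A p v) \<in> perp M p" "(- 1) *\<^sub>R v \<in> perp M p"
        using A_perp[OF g] v(1) subspace_scale[OF perp_subspace] by blast+
      ultimately have "screen_class M p (A p (A p v)) = screen_class M p ((- 1) *\<^sub>R v)"
        using screen_class_eq_iff by blast
      then show "twist_endo M k p (twist_endo M k p V) = screen_scale M p (- 1) V"
        unfolding v(2) screen_scale_class[OF v(1)] twist_endo_class[OF g v(1)]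
          twist_endo_class[OF g A_perp[OF g v(1)]] .
    qed
  next
    fix U X
    show "open U \<and> smooth_vec_on M U X \<and> (\<forall>q\<in>U. X q \<in> perp M q) \<longrightarrow>
        (\<forall>p\<in>U. \<exists>U' Y. open U' \<and> p \<in> U' \<and> U' \<subseteq> U \<and> smooth_vec_on M U' Y \<and>
           (\<forall>q\<in>U'. Y q \<in> perp M q \<and>
              twist_endo M k q (screen_class M q (X q)) = screen_class M q (Y q)))"
      using smooth_A A_perp[OF g] twist_endo_class[OF g]
      by (intro impI ballI exI[of _ U] exI[of _ "\<lambda>q. A q (X q)"]) blast
  qed
  then show ?thesis using c by (auto simp: twist_is_complex_structure_def)
qed

lemma conformal_unique:
  assumes "CARD('n) \<ge> 4" "conformal p \<mu>" "conformal p \<mu>'"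
  shows "\<mu> = \<mu>'"
proof -
  obtain v where v: "v \<in> perp M p" "gform M p v v > 0"
    using null_vector.spacelike_in_perp[OF null_vector assms(1), of p] unfolding kappa_eq perp_iff by metis
  have "\<mu> * gform M p v v = \<mu>' * gform M p v v"
    using assms(2,3) v(1) unfolding conformal_def by metis
  then show ?thesis using v(2) by simp
qed

lemma tau3_eq: "tau3 M \<kappa> p = wedge3 (\<kappa> p) (F p)"
  by (simp add: fun_eq_iff tau3_def skew3_def wedge3_def skew_deriv_def skew2_def field_simps)

lemma equation_iff_conformal:
  assumes "CARD('n) = 2 * m + 2" "m \<ge> 1"
  shows "((\<forall>a b c d.
           (\<Sum>e\<in>UNIV. raise3 (metric M p) (tau3 M \<kappa> p) a b e * tau3 M \<kappa> p e c d) =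
             - (2 / real m) * skew_square (metric M p) (tau3 M \<kappa> p) a b c d) \<and>
         (\<exists>a b c d. - (2 / real m) * skew_square (metric M p) (tau3 M \<kappa> p) a b c d \<noteq> 0)) \<longleftrightarrow>
    geod p \<and> (\<exists>\<mu>>0. conformal p \<mu>)"
proof -
  have "conformal p \<mu> \<longleftrightarrow> (\<forall>v w. \<kappa> p \<bullet> v = 0 \<longrightarrow> \<kappa> p \<bullet> w = 0 \<longrightarrow>
      gform M p (A p v) (A p w) = \<mu> * gform M p v w)" for \<mu>
    unfolding conformal_def perp_iff[symmetric] by blast
  then show ?thesis
    using null_vector.equation_iff[OF null_vector[of p] F_skew[of p] assms]
    unfolding kappa_eq tau3_eq[symmetric] A_def[symmetric] geod_def[symmetric] by (simp only:)
qed

section \<open>Local sections of the distributions\<close>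

lemma smooth_pairing_kappa:
  assumes "open U" "smooth_vec_on M U X"
  shows "smooth_fun_on M U (\<lambda>q. \<kappa> q \<bullet> X q)"
  using assms k_smooth smooth_vec_on_subset[of UNIV k U] by (intro smooth_fun_on_pairing smooth_form_on_flat) auto

lemma transversal_field:
  obtains c l W where "c \<in> atlas M" "open W" "p \<in> W" "W \<subseteq> fst c"
    "\<forall>q\<in>W. \<kappa> q \<bullet> constant_field c l q \<noteq> 0"
proof -
  let ?c = "chart_at M p"
  obtain t where t: "\<kappa> p \<bullet> t = 1"
    using null_vector.transversal[OF null_vector, of p] unfolding kappa_eq by blast
  define l where "l = vec_in M ?c (\<lambda>_. t) p"
  have "constant_field ?c l p = t"
    unfolding l_def by (rule constant_field_components[OF chart_at])
  then have "\<exists>W. open W \<and> p \<in> W \<and> W \<subseteq> fst ?c \<and> (\<forall>q\<in>W. \<kappa> q \<bullet> constant_field ?c l q \<noteq> 0)"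
    by (intro smooth_fun_on_nonzero_open smooth_pairing_kappa chart_open smooth_constant_field chart_at)
      (simp add: t)
  then show ?thesis using that chart_at(1) by blast
qed

text \<open>The projection to \<open>K\<^sup>\<bottom>\<close> along a transversal field.\<close>

definition proj :: "('a \<Rightarrow> real^'n) \<Rightarrow> ('a \<Rightarrow> real^'n) \<Rightarrow> 'a \<Rightarrow> real^'n" where
  "proj T X q = X q - ((\<kappa> q \<bullet> X q) / (\<kappa> q \<bullet> T q)) *\<^sub>R T q"

lemma proj_perp: "\<kappa> q \<bullet> T q \<noteq> 0 \<Longrightarrow> proj T X q \<in> perp M q"
  by (simp add: proj_def perp_iff inner_diff_right)

lemma proj_id: "X q \<in> perp M q \<Longrightarrow> proj T X q = X q"
  by (simp add: proj_def perp_iff)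

lemma smooth_proj:
  assumes "open U" "smooth_vec_on M U T" "smooth_vec_on M U X" "\<And>q. q \<in> U \<Longrightarrow> \<kappa> q \<bullet> T q \<noteq> 0"
  shows "smooth_vec_on M U (proj T X)"
  unfolding proj_def
  by (intro smooth_vec_on_diff smooth_vec_on_scaleR smooth_fun_on_divide smooth_pairing_kappa assms)

text \<open>A smooth section of \<open>K\<^sup>\<bottom>\<close> through a given vector: a field with constant components in a chart is
  projected along another such field transversal to \<open>K\<^sup>\<bottom>\<close>.\<close>

lemma local_perp_section:
  assumes "v \<in> perp M p"
  obtains W X where "open W" "p \<in> W" "smooth_vec_on M W X" "\<forall>q\<in>W. X q \<in> perp M q" "X p = v"
proof -
  obtain c l W where c: "c \<in> atlas M" and W: "open W" "p \<in> W" "W \<subseteq> fst c"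
    and T: "\<forall>q\<in>W. \<kappa> q \<bullet> constant_field c l q \<noteq> 0" by (rule transversal_field)
  define V where "V = constant_field c (vec_in M c (\<lambda>_. v) p)"
  have Vp: "V p = v"
    unfolding V_def using constant_field_components[OF c, of p "\<lambda>_. v"] W by blast
  have s: "smooth_vec_on M W (constant_field c l)" "smooth_vec_on M W V"
    unfolding V_def using smooth_constant_field[OF c] smooth_vec_on_subset W(3) by blast+
  show ?thesis
  proof (rule that[OF W(1,2)])
    show "smooth_vec_on M W (proj (constant_field c l) V)"
      using T by (intro smooth_proj W s) blast
    show "\<forall>q\<in>W. proj (constant_field c l) V q \<in> perp M q" using T proj_perp by blast
    show "proj (constant_field c l) V p = v" using proj_id[of V p] assms Vp by simp
  qed
qed

text \<open>A section of \<open>K\<close> is a smooth multiple of \<open>k\<close>.\<close>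

lemma line_section_ratio:
  assumes U: "open U" and X: "smooth_vec_on M U X" and line: "\<And>q. q \<in> U \<Longrightarrow> X q \<in> line M q"
  obtains f where "smooth_fun_on M U f" "\<forall>q\<in>U. X q = f q *\<^sub>R k q"
proof -
  have "\<forall>q\<in>U. \<exists>t. X q = t *\<^sub>R k q" using line line_iff by blast
  then obtain f where f: "\<forall>q\<in>U. X q = f q *\<^sub>R k q" by metis
  have "smooth_fun_on M U f"
  proof (rule smooth_fun_on_local)
    fix p assume p: "p \<in> U"
    obtain c l W where c: "c \<in> atlas M" and W: "open W" "p \<in> W" "W \<subseteq> fst c"
      and T: "\<forall>q\<in>W. \<kappa> q \<bullet> constant_field c l q \<noteq> 0" by (rule transversal_field)
    let ?T = "constant_field c l" and ?W = "W \<inter> U"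
    have o: "open ?W" using W U by blast
    have s: "smooth_vec_on M ?W ?T" "smooth_vec_on M ?W X"
      using smooth_constant_field[OF c] X smooth_vec_on_subset W(3) by blast+
    have n: "gform M q (k q) (?T q) \<noteq> 0" if "q \<in> ?W" for q
      using T that by (simp only: g_k) blast
    have "smooth_fun_on M ?W (\<lambda>q. gform M q (X q) (?T q) / gform M q (k q) (?T q))"
      using smooth_vec_on_subset[OF k_smooth, of ?W] n
      by (intro smooth_fun_on_divide smooth_fun_on_gform o s) auto
    then have "smooth_fun_on M ?W f"
      by (rule smooth_fun_on_cong[OF o]) (use f n in \<open>simp add: eval2_linear\<close>)
    then show "\<exists>W. open W \<and> p \<in> W \<and> smooth_fun_on M W f" using o W p by blast
  qed
  with f that show ?thesis by blast
qed

lemma contract_skew_deriv_scale: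
  assumes "open U" "p \<in> U" "smooth_fun_on M U f" "smooth_form_on M U \<alpha>"
    and "\<And>q. q \<in> U \<Longrightarrow> \<beta> q = f q *\<^sub>R \<alpha> q"
  shows "\<exists>w. \<forall>v. contract (skew_deriv M \<beta> p) v =
    f p *\<^sub>R contract (skew_deriv M \<alpha> p) v + ((w \<bullet> v) / 2) *\<^sub>R \<alpha> p - ((\<alpha> p \<bullet> v) / 2) *\<^sub>R w"
proof -
  obtain w where w: "\<forall>a b. skew_deriv M \<beta> p $ a $ b =
      f p * skew_deriv M \<alpha> p $ a $ b + (w $ a * \<alpha> p $ b - w $ b * \<alpha> p $ a) / 2"
    using skew_deriv_scale[OF assms] by blast
  show ?thesis
    by (rule exI[of _ w]) (simp add: vec_eq_iff contract_nth w inner_vec_def sum_distrib_left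
        sum_distrib_right sum_divide_distrib add_divide_distrib diff_divide_distrib sum.distrib
        sum_subtractf algebra_simps)
qed

text \<open>By the formula for the acceleration of a field of null vectors, applied to \<open>k\<close> in one direction and
  to an arbitrary local section \<open>X = fk\<close> in the other.\<close>

lemma geodesic_iff: "geodesic M \<longleftrightarrow> (\<forall>p. geod p)"
proof
  assume g: "geodesic M"
  show "\<forall>p. geod p"
  proof
    fix p
    let ?a = "\<chi> b. \<Sum>a\<in>UNIV. k p $ a * nabla_vec M k p a b"
    have "?a \<in> line M p"
      using g k_smooth k_line unfolding geodesic_def by blast
    then obtain t where t: "?a = t *\<^sub>R k p" unfolding line_iff by blast
    have "metric M p *v ?a = 2 *\<^sub>R contract (F p) (k p)"
      unfolding contract_def
      by (rule acceleration_eq[OF open_UNIV UNIV_I k_smooth]) (rule line_null[OF k_line])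
    then have "2 *\<^sub>R contract (F p) (k p) = t *\<^sub>R \<kappa> p"
      unfolding t by (simp only: flat_eq matrix_vector_mult_scaleR)
    then have "(1/2) *\<^sub>R 2 *\<^sub>R contract (F p) (k p) = (1/2) *\<^sub>R t *\<^sub>R \<kappa> p" by (simp only:)
    then have "contract (F p) (k p) = (t / 2) *\<^sub>R \<kappa> p" by simp
    then show "geod p" unfolding geod_def by blast
  qed
next
  assume g: "\<forall>p. geod p"
  show "geodesic M"
    unfolding geodesic_def
  proof (intro allI impI ballI)
    fix U X p assume UX: "open U \<and> smooth_vec_on M U X \<and> (\<forall>q\<in>U. X q \<in> line M q)" and p: "p \<in> U"
    let ?a = "\<chi> b. \<Sum>a\<in>UNIV. X p $ a * nabla_vec M X p a b"
    obtain f where f: "smooth_fun_on M U f" "\<forall>q\<in>U. X q = f q *\<^sub>R k q"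
      using UX by (auto intro: line_section_ratio)
    have kU: "smooth_form_on M U \<kappa>"
      using UX smooth_form_on_flat smooth_vec_on_subset[OF k_smooth] by blast
    have "flat M X q = f q *\<^sub>R \<kappa> q" if "q \<in> U" for q
      using f(2) that by (simp add: flat_eq matrix_vector_mult_scaleR)
    then obtain w where c: "\<forall>v. contract (skew_deriv M (flat M X) p) v =
        f p *\<^sub>R contract (F p) v + ((w \<bullet> v) / 2) *\<^sub>R \<kappa> p - ((\<kappa> p \<bullet> v) / 2) *\<^sub>R w"
      using contract_skew_deriv_scale[OF _ p f(1) kU] UX by blast
    have "\<kappa> p \<bullet> X p = 0" using UX p line_perp perp_iff by blast
    obtain t where t: "contract (F p) (k p) = t *\<^sub>R \<kappa> p" using g geod_def by blast
    have "metric M p *v ?a = 2 *\<^sub>R contract (skew_deriv M (flat M X) p) (X p)"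
      unfolding contract_def
      using UX p line_null by (intro acceleration_eq[of U]) auto
    also have "\<dots> = (2 * (f p * f p * t + (w \<bullet> X p) / 2)) *\<^sub>R \<kappa> p"
      unfolding c[rule_format] \<open>\<kappa> p \<bullet> X p = 0\<close> using f(2) p
      by (simp add: contract_linear t scaleR_add_left algebra_simps)
    finally have "matrix_inv (metric M p) *v (metric M p *v ?a) =
        (2 * (f p * f p * t + (w \<bullet> X p) / 2)) *\<^sub>R (matrix_inv (metric M p) *v (metric M p *v k p))"
      by (simp only: flat_eq matrix_vector_mult_scaleR)
    then show "?a \<in> line M p"
      unfolding null_vector.G_inv[OF null_vector] line_iff by blast
  qed
qed

end

section \<open>Rescaling of optical vector fields\<close>

context optical_field
begin

text \<open>If the endomorphism is conformal at every point, its factor is a smooth function.\<close>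

lemma conformal_factor_smooth:
  assumes n: "CARD('n) \<ge> 4" and g: "\<And>p. geod p" and \<mu>: "\<And>p. conformal p (\<mu> p)"
  shows "smooth_fun_on M UNIV \<mu>"
proof (rule smooth_fun_on_local)
  fix p
  obtain v where v: "v \<in> perp M p" "gform M p v v > 0"
    using null_vector.spacelike_in_perp[OF null_vector n, of p] unfolding kappa_eq perp_iff by metis
  obtain W X where W: "open W" "p \<in> W" and X: "smooth_vec_on M W X" "\<forall>q\<in>W. X q \<in> perp M q" "X p = v"
    using local_perp_section[OF v(1)] by metis
  have "\<exists>W'. open W' \<and> p \<in> W' \<and> W' \<subseteq> W \<and> (\<forall>q\<in>W'. gform M q (X q) (X q) \<noteq> 0)"
    by (rule smooth_fun_on_nonzero_open[OF W(1) smooth_fun_on_gform[OF W(1) X(1) X(1)] W(2)])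
      (use v X(3) in simp)
  then obtain W' where W': "open W'" "p \<in> W'" "W' \<subseteq> W" "\<And>q. q \<in> W' \<Longrightarrow> gform M q (X q) (X q) \<noteq> 0" by blast
  note X' = smooth_vec_on_subset[OF X(1) W'(3)]
  have "smooth_fun_on M W' (\<lambda>q. gform M q (A q (X q)) (A q (X q)) / gform M q (X q) (X q))"
    by (intro smooth_fun_on_divide smooth_fun_on_gform smooth_A X' W')
  then have "smooth_fun_on M W' \<mu>"
  proof (rule smooth_fun_on_cong[OF W'(1)])
    fix q assume q: "q \<in> W'"
    then have "gform M q (A q (X q)) (A q (X q)) = \<mu> q * gform M q (X q) (X q)"
      using \<mu>[of q] X(2) W'(3) unfolding conformal_def by blast
    then show "gform M q (A q (X q)) (A q (X q)) / gform M q (X q) (X q) = \<mu> q"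
      using W'(4)[OF q] by simp
  qed
  then show "\<exists>W. open W \<and> p \<in> W \<and> smooth_fun_on M W \<mu>" using W' by blast
qed

end

text \<open>Two optical vector fields \<open>k\<close> and \<open>k' = fk\<close>. On \<open>K\<^sup>\<bottom>\<close> the skew derivatives of the two 1-forms differ
  by the factor \<open>f\<close>, since \<open>df \<and> \<kappa>\<close> vanishes there.\<close>

locale optical_pair = optical_field M k + other: optical_field M k'
  for M :: "('a::topological_space, 'n::finite) optical_data" and k k' :: "'a \<Rightarrow> real^'n"
begin

lemma positive_ratio:
  obtains f where "smooth_fun_on M UNIV f" "\<And>p. k' p = f p *\<^sub>R k p" "\<And>p. f p > 0"
proof -
  obtain f where f: "smooth_fun_on M UNIV f" "\<forall>p\<in>UNIV. k' p = f p *\<^sub>R k p"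
    by (rule line_section_ratio[OF open_UNIV other.k_smooth other.k_line])
  have "f p > 0" for p
  proof -
    have "\<exists>t. gform M p t t < 0 \<and> future M p = {u. gform M p u u < 0 \<and> gform M p t u < 0}"
      using conjunct1[OF time_oriented[unfolded time_orientation_def]] by (rule spec)
    then obtain t where "gform M p t t < 0" "future M p = {u. gform M p u u < 0 \<and> gform M p t u < 0}"
      by (elim exE conjE)
    then have "t \<in> future M p" by simp
    then have "gform M p (k p) t < 0" "gform M p (k' p) t < 0" using k_future other.k_future by blast+
    then show ?thesis using f(2) by (simp add: eval2_linear mult_less_0_iff)
  qed
  with f that show ?thesis by blast
qed

lemma other_geod: "(\<And>p. geod p) \<Longrightarrow> other.geod p"
  using geodesic_iff other.geodesic_iff by blast

lemma conformal_rescale: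
  assumes g: "\<And>p. geod p" and f: "smooth_fun_on M UNIV f" "\<And>p. k' p = f p *\<^sub>R k p"
    and c: "conformal p \<mu>"
  shows "other.conformal p ((f p)\<^sup>2 * \<mu>)"
proof -
  note g' = other_geod[OF g]
  have kU: "smooth_form_on M UNIV \<kappa>"
    by (intro smooth_form_on_flat k_smooth open_UNIV)
  have "other.\<kappa> q = f q *\<^sub>R \<kappa> q" for q
    by (simp add: flat_eq f(2) matrix_vector_mult_scaleR)
  then obtain w where c': "\<forall>v. contract (other.F p) v =
      f p *\<^sub>R contract (F p) v + ((w \<bullet> v) / 2) *\<^sub>R \<kappa> p - ((\<kappa> p \<bullet> v) / 2) *\<^sub>R w"
    using contract_skew_deriv_scale[OF open_UNIV UNIV_I f(1) kU] by blast
  have F': "eval2 (other.F p) v u = f p * eval2 (F p) v u" if "v \<in> perp M p" "u \<in> perp M p" for v u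
    using that unfolding perp_iff contract_inner(1)[symmetric]
    by (simp add: c' inner_add_left inner_diff_left)
  have A': "other.A p v - f p *\<^sub>R A p v \<in> line M p" if v: "v \<in> perp M p" for v
  proof (rule line_nondegenerate)
    show "other.A p v - f p *\<^sub>R A p v \<in> perp M p"
      by (intro subspace_diff[OF perp_subspace] subspace_scale[OF perp_subspace] A_perp g v other.A_perp g')
    show "gform M p (other.A p v - f p *\<^sub>R A p v) u = 0" if "u \<in> perp M p" for u
      using F'[OF v that] by (simp add: eval2_linear g_A other.g_A)
  qed
  show ?thesis
    unfolding other.conformal_def
  proof (intro ballI)
    fix v u assume v: "v \<in> perp M p" and u: "u \<in> perp M p"
    have 1: "gform M p (other.A p v - f p *\<^sub>R A p v) (other.A p u) = 0"
      using A'[OF v] other.A_perp[OF g' u] by (rule g_line)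
    have 2: "gform M p (other.A p u - f p *\<^sub>R A p u) (A p v) = 0"
      using A'[OF u] A_perp[OF g v] by (rule g_line)
    have "gform M p (A p v) (A p u) = \<mu> * gform M p v u"
      using c v u by (simp add: conformal_def)
    then show "gform M p (other.A p v) (other.A p u) = (f p)\<^sup>2 * \<mu> * gform M p v u"
      using 1 2 g_sym[of p "A p v" "other.A p u"] g_sym[of p "A p v" "A p u"]
      by (simp add: eval2_linear power2_eq_square)
  qed
qed

end

section \<open>The almost Robinson structure\<close>

text \<open>The complex vector with given real and imaginary parts.\<close>

definition cvec :: "real^'n \<Rightarrow> real^'n \<Rightarrow> complex^'n" where
  "cvec a b = (\<chi> i. Complex (a $ i) (b $ i))"

lemma re_cvec [simp]: "re_vec (cvec a b) = a" and im_cvec [simp]: "im_vec (cvec a b) = b"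
  by (simp_all add: cvec_def re_vec_def im_vec_def vec_eq_iff)

lemma cvec_eqI: "re_vec v = re_vec w \<Longrightarrow> im_vec v = im_vec w \<Longrightarrow> v = w"
  by (simp add: re_vec_def im_vec_def vec_eq_iff complex_eq_iff)

lemma re_im_vec:
  "re_vec (v + w) = re_vec v + re_vec w" "im_vec (v + w) = im_vec v + im_vec w"
  "re_vec (v - w) = re_vec v - re_vec w" "im_vec (v - w) = im_vec v - im_vec w"
  "re_vec (c *s v) = Re c *\<^sub>R re_vec v - Im c *\<^sub>R im_vec v"
  "im_vec (c *s v) = Re c *\<^sub>R im_vec v + Im c *\<^sub>R re_vec v"
  "re_vec 0 = 0" "im_vec 0 = 0" "re_vec (- v) = - re_vec v" "im_vec (- v) = - im_vec v"
  "re_vec (cnj_vec v) = re_vec v" "im_vec (cnj_vec v) = - im_vec v"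
  by (simp_all add: re_vec_def im_vec_def cnj_vec_def vec_eq_iff)

lemma re_im_vec_sum:
  "re_vec (\<Sum>i\<in>I. f i) = (\<Sum>i\<in>I. re_vec (f i))" "im_vec (\<Sum>i\<in>I. f i) = (\<Sum>i\<in>I. im_vec (f i))"
  by (induction I rule: infinite_finite_induct) (simp_all add: re_im_vec)

lemma cnj_vec_cnj_vec: "cnj_vec (cnj_vec v) = v"
  by (simp add: cnj_vec_def vec_eq_iff)

lemma cnj_vec_image_iff: "v \<in> cnj_vec ` S \<longleftrightarrow> cnj_vec v \<in> S"
  by (metis cnj_vec_cnj_vec image_iff)

lemma cgform_re_im: "cgform M p v w =
    Complex (gform M p (re_vec v) (re_vec w) - gform M p (im_vec v) (im_vec w))
      (gform M p (re_vec v) (im_vec w) + gform M p (im_vec v) (re_vec w))"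
  by (simp add: cgform_def eval2_def complex_eq_iff re_vec_def im_vec_def
      sum_subtractf[symmetric] sum.distrib[symmetric] algebra_simps)

lemma cnj_vec_subspace:
  fixes S :: "(complex^'n::finite) set"
  assumes "vec.subspace S"
  shows "vec.subspace {v. cnj_vec v \<in> S}"
proof -
  have "cnj_vec (x + y) = cnj_vec x + cnj_vec y" "cnj_vec (c *s x) = cnj c *s cnj_vec x"
    "cnj_vec 0 = (0 :: complex^'n)" for c and x y :: "complex^'n"
    by (simp_all add: cnj_vec_def vec_eq_iff)
  then show ?thesis
    using vec.subspace_0[OF assms] vec.subspace_add[OF assms] vec.subspace_scale[OF assms]
    by (intro vec.subspaceI) simp_all
qed

text \<open>Conjugation is only semilinear, but it maps a basis of \<open>S\<close> to a spanning set of the conjugate of \<open>S\<close>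
  of at most the same cardinality.\<close>

lemma dim_cnj_vec: "vec.dim (cnj_vec ` S) = vec.dim S"
proof -
  have le: "vec.dim (cnj_vec ` S) \<le> vec.dim S" for S :: "(complex^'n::finite) set"
  proof -
    obtain B where B: "B \<subseteq> S" "vec.independent B" "S \<subseteq> vec.span B" "card B = vec.dim S"
      using vec.basis_exists by metis
    have f: "finite B" using B(2) by (rule vec.finiteI_independent)
    let ?V = "{v. cnj_vec v \<in> vec.span (cnj_vec ` B)}"
    have "vec.subspace ?V" by (rule cnj_vec_subspace[OF vec.subspace_span])
    moreover have "B \<subseteq> ?V" by (auto intro: vec.span_base)
    ultimately have "vec.span B \<subseteq> ?V" by (intro vec.span_minimal)
    with B(3) have "S \<subseteq> ?V" by (rule subset_trans)
    then have "cnj_vec ` S \<subseteq> vec.span (cnj_vec ` B)" by auto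
    then have "vec.dim (cnj_vec ` S) \<le> card (cnj_vec ` B)" using f by (intro vec.dim_le_card) auto
    also have "\<dots> \<le> card B" using f by (rule card_image_le)
    finally show ?thesis using B(4) by simp
  qed
  have "cnj_vec ` cnj_vec ` S = S" by (simp add: image_image cnj_vec_cnj_vec)
  then show ?thesis using le[of S] le[of "cnj_vec ` S"] by simp
qed

context optical_field
begin

lemma complexification_subspace: "subspace S \<Longrightarrow> vec.subspace (complexification S)"
  by (rule vec.subspaceI)
    (auto simp: complexification_def re_im_vec subspace_0 subspace_add subspace_diff subspace_scale)

lemma dim_complexification_line: "vec.dim (complexification (line M p)) = 1"
proof -
  let ?k = "cvec (k p) 0"
  have "complexification (line M p) = vec.span {?k}"
  proof (intro set_eqI iffI)
    fix v assume "v \<in> complexification (line M p)"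
    then obtain s t where "re_vec v = s *\<^sub>R k p" "im_vec v = t *\<^sub>R k p"
      by (auto simp: complexification_def line_iff)
    then have "v = Complex s t *s ?k" by (intro cvec_eqI) (simp_all add: re_im_vec)
    then show "v \<in> vec.span {?k}" by (simp add: vec.span_base vec.span_scale)
  next
    have "vec.span {?k} \<subseteq> complexification (line M p)"
      using k_line line_subspace
      by (intro vec.span_minimal complexification_subspace) (auto simp: complexification_def subspace_0)
    then show "v \<in> vec.span {?k} \<Longrightarrow> v \<in> complexification (line M p)" for v by blast
  qed
  moreover have "?k \<noteq> 0"
    using k_nonzero[of p] re_cvec[of "k p" 0] by (metis re_im_vec(7))
  ultimately show ?thesis by (simp add: vec.dim_singleton)
qed

lemma dim_complexification_perp: "vec.dim (complexification (perp M p)) + 1 = CARD('n)"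
proof -
  obtain l where l: "\<kappa> p \<bullet> l = 1"
    using null_vector.transversal[OF null_vector, of p] unfolding kappa_eq by blast
  let ?P = "complexification (perp M p)" and ?l = "cvec l 0" and ?L = "vec.span {cvec l 0}"
  have L: "v \<in> ?L \<Longrightarrow> \<exists>c. v = c *s ?l" for v by (auto simp: vec.span_singleton)
  have "?P \<inter> ?L = {0}"
  proof (intro equalityI subsetI)
    fix v assume v: "v \<in> ?P \<inter> ?L"
    then obtain c where c: "v = c *s ?l" using L by blast
    have "\<kappa> p \<bullet> re_vec v = 0" "\<kappa> p \<bullet> im_vec v = 0"
      using v by (auto simp: complexification_def perp_iff)
    then have "Re c = 0" "Im c = 0" by (simp_all add: c re_im_vec l)
    then show "v \<in> {0}" by (simp add: c complex_eq_iff)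
  next
    show "v \<in> ?P \<inter> ?L" if "v \<in> {0}" for v
      using that vec.subspace_0[OF complexification_subspace[OF perp_subspace]] vec.span_zero by auto
  qed
  moreover have "{x + y |x y. x \<in> ?P \<and> y \<in> ?L} = UNIV"
  proof -
    have "\<exists>x y. v = x + y \<and> x \<in> ?P \<and> y \<in> ?L" for v
    proof (intro exI conjI)
      let ?c = "Complex (\<kappa> p \<bullet> re_vec v) (\<kappa> p \<bullet> im_vec v)"
      show "v = (v - ?c *s ?l) + ?c *s ?l" by simp
      show "?c *s ?l \<in> ?L" by (simp add: vec.span_base vec.span_scale)
      show "v - ?c *s ?l \<in> ?P"
        by (simp add: complexification_def perp_iff re_im_vec inner_diff_right l)
    qed
    then show ?thesis by blast
  qed
  moreover have "?l \<noteq> 0" using l re_cvec[of l 0] by (metis inner_zero_right re_im_vec(7) zero_neq_one)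
  ultimately show ?thesis
    using vec.dim_sums_Int[OF complexification_subspace[OF perp_subspace[of p]] vec.subspace_span, of "{?l}"]
    by (simp add: vec.dim_singleton card_cart_basis vec.dim_UNIV)
qed

lemma conformal_graph:
  assumes g: "geod p" and c: "conformal p 1"
    and x: "x \<in> perp M p" and d: "y - A p x \<in> line M p"
  shows "y \<in> perp M p" "A p y + x \<in> line M p"
proof -
  show "y \<in> perp M p"
    using subspace_add[OF perp_subspace line_perp[OF d] A_perp[OF g x]] by simp
  have "A p y - A p (A p x) \<in> line M p"
    using A_line[OF g d] by (simp add: A_linear)
  from subspace_add[OF line_subspace this conformal_square[OF g c x]]
  show "A p y + x \<in> line M p" by simp
qed

text \<open>The Robinson distribution consists of the \<open>x + \<i>(Jx + K)\<close> with \<open>x\<close> in \<open>K\<^sup>\<bottom>\<close>.\<close>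

lemma robinson_distribution_eq:
  assumes g: "geod p" and c: "conformal p 1"
  shows "robinson_distribution M (twist_endo M k) p =
    {v. re_vec v \<in> perp M p \<and> im_vec v - A p (re_vec v) \<in> line M p}"
proof -
  have cls: "u \<in> cscreen_class M p v \<longleftrightarrow> re_vec u \<in> perp M p \<and> im_vec u \<in> perp M p \<and>
      re_vec u - re_vec v \<in> line M p \<and> im_vec u - im_vec v \<in> line M p" for u v
    by (auto simp: cscreen_class_def complexification_def re_im_vec)
  have ce: "complexify_endo M p (twist_endo M k p) (cscreen_class M p v) =
      {w. re_vec w \<in> screen_class M p (A p (re_vec v)) \<and> im_vec w \<in> screen_class M p (A p (im_vec v))}"
    if v: "re_vec v \<in> perp M p" "im_vec v \<in> perp M p" for v
  proof -
    have e: "twist_endo M k p (screen_class M p x) = screen_class M p (A p y)"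
      if "x \<in> perp M p" "y \<in> perp M p" "x - y \<in> line M p" for x y
    proof -
      have "screen_class M p x = screen_class M p y" using that screen_class_eq_iff by blast
      then show ?thesis using twist_endo_class[OF g that(2)] by simp
    qed
    have "v \<in> cscreen_class M p v" using v subspace_0[OF line_subspace] by (simp add: cls)
    moreover have "twist_endo M k p (screen_class M p (re_vec u)) = screen_class M p (A p (re_vec v))"
        "twist_endo M k p (screen_class M p (im_vec u)) = screen_class M p (A p (im_vec v))"
      if "u \<in> cscreen_class M p v" for u
      using that e v unfolding cls by blast+
    ultimately show ?thesis unfolding complexify_endo_def by blast
  qed
  show ?thesis
  proof (intro set_eqI iffI)
    fix v assume "v \<in> robinson_distribution M (twist_endo M k) p"
    then have v: "re_vec v \<in> perp M p" "im_vec v \<in> perp M p"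
      and eq: "complexify_endo M p (twist_endo M k p) (cscreen_class M p v) = cscreen_class M p ((- \<i>) *s v)"
      by (auto simp: robinson_distribution_def complexification_def)
    have "(- \<i>) *s v \<in> cscreen_class M p ((- \<i>) *s v)"
      using v subspace_0[OF line_subspace] subspace_neg[OF perp_subspace] by (simp add: cls re_im_vec)
    then have "im_vec v \<in> screen_class M p (A p (re_vec v))"
      unfolding eq[symmetric] ce[OF v] by (simp add: re_im_vec del: Image_singleton_iff)
    then have "A p (re_vec v) - im_vec v \<in> line M p" unfolding screen_class_iff by blast
    then have "- (A p (re_vec v) - im_vec v) \<in> line M p" by (rule subspace_neg[OF line_subspace])
    then show "v \<in> {v. re_vec v \<in> perp M p \<and> im_vec v - A p (re_vec v) \<in> line M p}"
      using v by simp
  next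
    fix v assume "v \<in> {v. re_vec v \<in> perp M p \<and> im_vec v - A p (re_vec v) \<in> line M p}"
    then have r: "re_vec v \<in> perp M p" and d: "im_vec v - A p (re_vec v) \<in> line M p" by auto
    note Ar = A_perp[OF g r]
    note i = conformal_graph(1)[OF g c r d] and d2 = conformal_graph(2)[OF g c r d]
    note Ai = A_perp[OF g i]
    have s: "A p (re_vec v) - x \<in> line M p \<longleftrightarrow> x - im_vec v \<in> line M p" for x
    proof
      assume "A p (re_vec v) - x \<in> line M p"
      from subspace_neg[OF line_subspace subspace_add[OF line_subspace this d]]
      show "x - im_vec v \<in> line M p" by simp
    next
      assume "x - im_vec v \<in> line M p"
      from subspace_neg[OF line_subspace subspace_add[OF line_subspace this d]]
      show "A p (re_vec v) - x \<in> line M p" by simp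
    qed
    have s2: "A p (im_vec v) - x \<in> line M p \<longleftrightarrow> x + re_vec v \<in> line M p" for x
    proof
      assume "A p (im_vec v) - x \<in> line M p"
      from subspace_diff[OF line_subspace d2 this]
      show "x + re_vec v \<in> line M p" by (simp add: add.commute)
    next
      assume "x + re_vec v \<in> line M p"
      from subspace_diff[OF line_subspace d2 this]
      show "A p (im_vec v) - x \<in> line M p" by simp
    qed
    have "complexify_endo M p (twist_endo M k p) (cscreen_class M p v) = cscreen_class M p ((- \<i>) *s v)"
      unfolding ce[OF r i]
    proof (rule set_eqI)
      fix x
      show "x \<in> {w. re_vec w \<in> screen_class M p (A p (re_vec v)) \<and> im_vec w \<in> screen_class M p (A p (im_vec v))}
          \<longleftrightarrow> x \<in> cscreen_class M p ((- \<i>) *s v)"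
        unfolding mem_Collect_eq screen_class_iff cls by (auto simp: re_im_vec s s2 Ar Ai)
    qed
    then show "v \<in> robinson_distribution M (twist_endo M k) p"
      using r i by (simp add: robinson_distribution_def complexification_def)
  qed
qed

text \<open>A local spanning family: \<open>k\<close> and the \<open>e\<^sub>i + \<i>Je\<^sub>i\<close>, where the \<open>e\<^sub>i\<close> are the coordinate vector fields
  projected to \<open>K\<^sup>\<bottom>\<close>.\<close>

lemma robinson_local_frame:
  assumes g: "\<And>p. geod p" and c: "\<And>p. conformal p 1"
    and N: "\<And>p. vec.subspace (robinson_distribution M (twist_endo M k) p)"
  shows "\<exists>U Fam. open U \<and> p \<in> U \<and> finite Fam \<and> (\<forall>Z\<in>Fam. smooth_cvec_on M U Z) \<and>
    (\<forall>q\<in>U. robinson_distribution M (twist_endo M k) q = vec.span ((\<lambda>Z. Z q) ` Fam))"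
proof -
  obtain d l W where d: "d \<in> atlas M" and W: "open W" "p \<in> W" "W \<subseteq> fst d"
    and T: "\<forall>q\<in>W. \<kappa> q \<bullet> constant_field d l q \<noteq> 0" by (rule transversal_field)
  let ?T = "constant_field d l"
  define V where "V i = constant_field d (axis i 1)" for i
  define e where "e i = proj ?T (V i)" for i
  define Z where "Z i q = cvec (e i q) (A q (e i q))" for i q
  define K where "K q = cvec (k q) 0" for q
  define Fam where "Fam = insert K (range Z)"
  have s: "smooth_vec_on M W ?T" "smooth_vec_on M W (V i)" for i
    unfolding V_def using smooth_constant_field[OF d] smooth_vec_on_subset W(3) by blast+
  have es: "smooth_vec_on M W (e i)" for i
    unfolding e_def using T by (intro smooth_proj W s) blast
  have ep: "e i q \<in> perp M q" if "q \<in> W" for i q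
    unfolding e_def using T that by (intro proj_perp) blast
  have "smooth_cvec_on M W K"
    unfolding smooth_cvec_on_def K_def
    using smooth_vec_on_subset[OF k_smooth] smooth_vec_on_zero by simp
  moreover have "smooth_cvec_on M W (Z i)" for i
    unfolding smooth_cvec_on_def Z_def using es smooth_A[OF W(1) es] by simp
  ultimately have sm: "\<forall>Z\<in>Fam. smooth_cvec_on M W Z" by (auto simp: Fam_def)
  have "robinson_distribution M (twist_endo M k) q = vec.span ((\<lambda>Z. Z q) ` Fam)" if q: "q \<in> W" for q
  proof
    have "K q \<in> robinson_distribution M (twist_endo M k) q"
      using k_line[of q] line_perp A_line[OF g k_line, of q] subspace_neg[OF line_subspace]
      by (simp add: robinson_distribution_eq[OF g c] K_def)
    moreover have "Z i q \<in> robinson_distribution M (twist_endo M k) q" for i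
      using ep[OF q] subspace_0[OF line_subspace] by (simp add: robinson_distribution_eq[OF g c] Z_def)
    ultimately show "vec.span ((\<lambda>Z. Z q) ` Fam) \<subseteq> robinson_distribution M (twist_endo M k) q"
      by (intro vec.span_minimal N) (auto simp: Fam_def)
    show "robinson_distribution M (twist_endo M k) q \<subseteq> vec.span ((\<lambda>Z. Z q) ` Fam)"
    proof
      fix v assume "v \<in> robinson_distribution M (twist_endo M k) q"
      then have r: "re_vec v \<in> perp M q" and i: "im_vec v - A q (re_vec v) \<in> line M q"
        by (auto simp: robinson_distribution_eq[OF g c])
      define x where "x = vec_in M d (\<lambda>_. re_vec v) q"
      have dq: "q \<in> fst d" using W q by blast
      have lin: "linear ((*v) (jacobian d (chart_at M q) q))" by simp
      have "re_vec v = constant_field d x q"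
        unfolding x_def using constant_field_components[OF d dq, of "\<lambda>_. re_vec v"] by simp
      also have "\<dots> = (\<Sum>i\<in>UNIV. x $ i *\<^sub>R V i q)"
      proof -
        have "x = (\<Sum>i\<in>UNIV. x $ i *\<^sub>R axis i 1)"
          using basis_expansion[of x] by (simp add: scalar_mult_eq_scaleR)
        then have "constant_field d x q = jacobian d (chart_at M q) q *v (\<Sum>i\<in>UNIV. x $ i *\<^sub>R axis i 1)"
          unfolding constant_field_def by (rule arg_cong)
        then show ?thesis
          unfolding linear_sum[OF lin] linear_scale[OF lin] V_def constant_field_def .
      qed
      finally have rV: "re_vec v = (\<Sum>i\<in>UNIV. x $ i *\<^sub>R V i q)" .
      have "(\<Sum>i\<in>UNIV. x $ i *\<^sub>R e i q) = (\<Sum>i\<in>UNIV. x $ i *\<^sub>R V i q)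
          - ((\<kappa> q \<bullet> (\<Sum>i\<in>UNIV. x $ i *\<^sub>R V i q)) / (\<kappa> q \<bullet> ?T q)) *\<^sub>R ?T q"
        by (simp add: e_def proj_def scaleR_diff_right sum_subtractf inner_sum_right sum_divide_distrib
            scaleR_sum_left)
      then have re: "re_vec v = (\<Sum>i\<in>UNIV. x $ i *\<^sub>R e i q)"
        using r by (simp add: rV[symmetric] perp_iff)
      obtain t where t: "im_vec v - A q (re_vec v) = t *\<^sub>R k q" using i by (auto simp: line_iff)
      have Asum: "A q (\<Sum>i\<in>I. f i) = (\<Sum>i\<in>I. A q (f i))" if "finite I" for I :: "'n set" and f
        using that by (induction I rule: finite_induct) (simp_all add: A_linear, simp add: A_def contract_def)
      have "im_vec v = (\<Sum>i\<in>UNIV. x $ i *\<^sub>R A q (e i q)) + t *\<^sub>R k q"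
        using t unfolding re Asum[OF finite] A_linear by (simp add: algebra_simps)
      then have "v = (\<Sum>i\<in>UNIV. of_real (x $ i) *s Z i q) + (\<i> * of_real t) *s K q"
        by (intro cvec_eqI) (simp_all add: re_im_vec re_im_vec_sum Z_def K_def re)
      moreover have "(\<Sum>i\<in>UNIV. of_real (x $ i) *s Z i q) + (\<i> * of_real t) *s K q \<in> vec.span ((\<lambda>Z. Z q) ` Fam)"
        by (intro vec.span_add vec.span_sum vec.span_scale vec.span_base) (auto simp: Fam_def)
      ultimately show "v \<in> vec.span ((\<lambda>Z. Z q) ` Fam)" by simp
    qed
  qed
  then show ?thesis using W sm by (intro exI[of _ W] exI[of _ Fam]) (auto simp: Fam_def)
qed

text \<open>The rank follows from \<open>N \<inter> cnj N\<close> being the complexification of \<open>K\<close> and \<open>N + cnj N\<close> that of \<open>K\<^sup>\<bottom>\<close>.\<close>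

lemma robinson_distribution_almost_robinson:
  assumes g: "\<And>p. geod p" and c: "\<And>p. conformal p 1"
  shows "almost_robinson_structure M (robinson_distribution M (twist_endo M k))"
proof -
  let ?N = "robinson_distribution M (twist_endo M k)"
  have N: "v \<in> ?N p \<longleftrightarrow> re_vec v \<in> perp M p \<and> im_vec v - A p (re_vec v) \<in> line M p" for v p
    by (simp add: robinson_distribution_eq[OF g c])
  have im: "A p (im_vec v) + re_vec v \<in> line M p" "im_vec v \<in> perp M p" if "v \<in> ?N p" for v p
    using that conformal_graph[OF g c] by (auto simp: N)
  have sub: "vec.subspace (?N p)" for p
  proof (rule vec.subspaceI)
    show "0 \<in> ?N p"
      using subspace_0[OF perp_subspace] subspace_0[OF line_subspace] A_linear(3)[of p 0 0]
      by (simp add: N re_im_vec)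
    show "x + y \<in> ?N p" if "x \<in> ?N p" "y \<in> ?N p" for x y
    proof -
      have "(im_vec x - A p (re_vec x)) + (im_vec y - A p (re_vec y)) \<in> line M p"
        using that by (intro subspace_add[OF line_subspace]) (auto simp: N)
      then show ?thesis
        using that subspace_add[OF perp_subspace] by (simp add: N re_im_vec A_linear algebra_simps)
    qed
    show "z *s x \<in> ?N p" if x: "x \<in> ?N p" for z x
    proof -
      have "Re z *\<^sub>R (im_vec x - A p (re_vec x)) + Im z *\<^sub>R (A p (im_vec x) + re_vec x) \<in> line M p"
        using x im[OF x]
        by (intro subspace_add[OF line_subspace subspace_scale[OF line_subspace] subspace_scale[OF line_subspace]])
          (auto simp: N)
      moreover have "im_vec (z *s x) - A p (re_vec (z *s x)) =
          Re z *\<^sub>R (im_vec x - A p (re_vec x)) + Im z *\<^sub>R (A p (im_vec x) + re_vec x)"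
        by (simp add: re_im_vec A_linear algebra_simps)
      moreover have "re_vec (z *s x) \<in> perp M p"
        using x im[OF x] unfolding re_im_vec
        by (intro subspace_diff[OF perp_subspace] subspace_scale[OF perp_subspace]) (auto simp: N)
      ultimately show ?thesis unfolding N by simp
    qed
  qed
  have null: "cgform M p v w = 0" if v: "v \<in> ?N p" and w: "w \<in> ?N p" for v w p
  proof -
    define u u' where "u = im_vec v - A p (re_vec v)" and "u' = im_vec w - A p (re_vec w)"
    have i: "im_vec v = A p (re_vec v) + u" "im_vec w = A p (re_vec w) + u'" by (simp_all add: u_def u'_def)
    have l: "u \<in> line M p" "u' \<in> line M p" and r: "re_vec v \<in> perp M p" "re_vec w \<in> perp M p"
      using v w by (auto simp: N u_def u'_def)
    note z = g_line[OF l(1)] g_line[OF l(2)]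
    have z': "gform M p x u = 0" "gform M p x u' = 0" if "x \<in> perp M p" for x
      using z that g_sym[of p x u] g_sym[of p x u'] by simp_all
    have "gform M p (A p (re_vec v)) (A p (re_vec w)) = gform M p (re_vec v) (re_vec w)"
      using c[of p] r by (simp add: conformal_def)
    moreover have "gform M p (re_vec v) (A p (re_vec w)) = - gform M p (A p (re_vec v)) (re_vec w)"
      using g_sym[of p "re_vec v" "A p (re_vec w)"] skew_form_swap(2)[OF F_skew, of p "re_vec w" "re_vec v"]
      by (simp add: g_A)
    ultimately show ?thesis
      unfolding cgform_re_im i
      by (simp add: eval2_linear z z' r A_perp[OF g] line_perp l complex_eq_iff)
  qed
  have int: "?N p \<inter> cnj_vec ` ?N p = complexification (line M p)" for p
  proof (intro set_eqI iffI)
    fix v assume "v \<in> ?N p \<inter> cnj_vec ` ?N p"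
    then have v: "v \<in> ?N p" and 2: "- im_vec v - A p (re_vec v) \<in> line M p"
      by (auto simp: cnj_vec_image_iff) (simp add: N re_im_vec)
    then have r: "re_vec v \<in> perp M p" and 1: "im_vec v - A p (re_vec v) \<in> line M p" by (auto simp: N)
    have "(- 1/2) *\<^sub>R ((- im_vec v - A p (re_vec v)) + (im_vec v - A p (re_vec v))) \<in> line M p"
      by (intro subspace_scale[OF line_subspace] subspace_add[OF line_subspace] 1 2)
    moreover have "(- 1/2) *\<^sub>R ((- y - x) + (y - x)) = x" for x y :: "real^'n"
    proof -
      have "(- y - x) + (y - x) = (-2) *\<^sub>R x" by (simp add: scaleR_2)
      then show ?thesis by simp
    qed
    ultimately have Ar: "A p (re_vec v) \<in> line M p" by simp
    from subspace_add[OF line_subspace 1 Ar] have "im_vec v \<in> line M p" by simp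
    moreover from subspace_diff[OF line_subspace conformal_square[OF g c r] A_line[OF g Ar]]
    have "re_vec v \<in> line M p" by simp
    ultimately show "v \<in> complexification (line M p)" by (simp add: complexification_def)
  next
    fix v assume "v \<in> complexification (line M p)"
    then have r: "re_vec v \<in> line M p" and i: "im_vec v \<in> line M p" by (auto simp: complexification_def)
    show "v \<in> ?N p \<inter> cnj_vec ` ?N p"
      using r i line_perp A_line[OF g r] subspace_diff[OF line_subspace] subspace_neg[OF line_subspace i]
      by (simp add: cnj_vec_image_iff N re_im_vec)
  qed
  have sum: "{x + y |x y. x \<in> ?N p \<and> y \<in> cnj_vec ` ?N p} = complexification (perp M p)" for p
  proof (intro set_eqI iffI)
    fix z assume "z \<in> {x + y |x y. x \<in> ?N p \<and> y \<in> cnj_vec ` ?N p}"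
    then obtain x y where xy: "z = x + cnj_vec y" "x \<in> ?N p" "y \<in> ?N p" by auto
    then show "z \<in> complexification (perp M p)"
      using im(2)[OF xy(2)] im(2)[OF xy(3)] subspace_add[OF perp_subspace] subspace_diff[OF perp_subspace]
      by (simp add: complexification_def re_im_vec N)
  next
    fix z assume "z \<in> complexification (perp M p)"
    then have r: "re_vec z \<in> perp M p" and i: "im_vec z \<in> perp M p" by (auto simp: complexification_def)
    \<comment> \<open>The components of \<open>z\<close> are \<open>(z + \<i>Jz)/2\<close> and \<open>(z - \<i>Jz)/2\<close>, up to elements of \<open>K\<close>.\<close>
    define a where "a = (1/2) *\<^sub>R (re_vec z - A p (im_vec z))"
    define b where "b = (1/2) *\<^sub>R (re_vec z + A p (im_vec z))"
    have ab: "a \<in> perp M p" "b \<in> perp M p" "a + b = re_vec z"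
      unfolding a_def b_def
      by (auto intro!: subspace_scale[OF perp_subspace] subspace_add[OF perp_subspace]
          subspace_diff[OF perp_subspace] A_perp g r i simp: scaleR_add_right[symmetric])
    have d: "im_vec z - A p a + A p b \<in> line M p"
    proof -
      have "A p b - A p a = A p (A p (im_vec z))"
        by (simp add: a_def b_def A_linear scaleR_add_right scaleR_diff_right scaleR_add_left[symmetric])
      then show ?thesis using conformal_square[OF g c i] by (simp add: algebra_simps)
    qed
    let ?x = "cvec a (im_vec z + A p b)" and ?y = "cvec b (A p b)"
    have "?x \<in> ?N p" using ab d by (simp add: N algebra_simps)
    moreover have "?y \<in> ?N p" using ab subspace_0[OF line_subspace] by (simp add: N)
    moreover have "z = ?x + cnj_vec ?y" by (intro cvec_eqI) (simp_all add: re_im_vec ab)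
    ultimately show "z \<in> {x + y |x y. x \<in> ?N p \<and> y \<in> cnj_vec ` ?N p}" by blast
  qed
  have dim: "2 * vec.dim (?N p) = CARD('n)" for p
  proof -
    have cs: "vec.subspace (cnj_vec ` ?N p)"
    proof -
      have "cnj_vec ` ?N p = {v. cnj_vec v \<in> ?N p}" using cnj_vec_image_iff by blast
      then show ?thesis using cnj_vec_subspace[OF sub[of p]] by simp
    qed
    have "vec.dim (complexification (perp M p)) + vec.dim (complexification (line M p)) =
        vec.dim (?N p) + vec.dim (cnj_vec ` ?N p)"
      using vec.dim_sums_Int[OF sub[of p] cs] unfolding sum int .
    then show ?thesis
      using dim_complexification_perp[of p] unfolding dim_cnj_vec dim_complexification_line by linarith
  qed
  show ?thesis
    unfolding almost_robinson_structure_def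
    using sub dim null int robinson_local_frame[OF g c sub] by blast
qed

section \<open>The Robinson 3-form\<close>

lemma wedge3_skew3:
  assumes "transpose \<Omega> = - \<Omega>"
  shows "3 * skew3 (\<lambda>a b c. \<kappa> p $ a * \<Omega> $ b $ c) a b c = wedge3 (\<kappa> p) \<Omega> a b c"
  using skew_form_swap(1)[OF assms, of b a] skew_form_swap(1)[OF assms, of c a]
    skew_form_swap(1)[OF assms, of c b]
  by (simp add: skew3_def wedge3_def field_simps)

text \<open>The 3-form \<open>3 \<kappa>\<^sub>[\<^sub>a \<Omega>\<^sub>b\<^sub>c\<^sub>]\<close> depends only on the restriction of \<open>\<Omega>\<close> to \<open>K\<^sup>\<bottom>\<close>: two extensions differ by a
  wedge product with \<open>\<kappa>\<close>.\<close>

lemma wedge3_perp_cong: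
  assumes 1: "transpose \<Omega> = - \<Omega>" and 2: "transpose \<Omega>' = - \<Omega>'"
    and eq: "\<And>v w. v \<in> perp M p \<Longrightarrow> w \<in> perp M p \<Longrightarrow> eval2 \<Omega> v w = eval2 \<Omega>' v w"
  shows "wedge3 (\<kappa> p) \<Omega> = wedge3 (\<kappa> p) \<Omega>'"
proof -
  obtain l where l: "\<kappa> p \<bullet> l = 1"
    using null_vector.transversal[OF null_vector, of p] unfolding kappa_eq by blast
  define D where "D v w = eval2 \<Omega> v w - eval2 \<Omega>' v w" for v w
  have lin: "D (u + v) w = D u w + D v w" "D w (u + v) = D w u + D w v" "D (s *\<^sub>R u) w = s * D u w"
    "D w (s *\<^sub>R u) = s * D w u" "D (u - v) w = D u w - D v w" "D w (u - v) = D w u - D w v" for u v w s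
    by (simp_all add: D_def eval2_linear algebra_simps)
  have skew: "D v w = - D w v" for v w
    using skew_form_swap(2)[OF 1, of v w] skew_form_swap(2)[OF 2, of v w] by (simp add: D_def)
  have D: "D v w = (\<kappa> p \<bullet> v) * D l w - (\<kappa> p \<bullet> w) * D l v" for v w
  proof -
    have "D (v - (\<kappa> p \<bullet> v) *\<^sub>R l) (w - (\<kappa> p \<bullet> w) *\<^sub>R l) = 0"
      unfolding D_def by (simp add: eq perp_iff inner_diff_right l)
    then show ?thesis using skew[of v l] skew[of l l] unfolding lin by (simp add: algebra_simps)
  qed
  have e: "\<Omega> $ a $ b = \<Omega>' $ a $ b + (\<kappa> p $ a * D l (axis b 1) - \<kappa> p $ b * D l (axis a 1))" for a b
    using D[of "axis a 1" "axis b 1"] unfolding D_def[of "axis a 1"] eval2_axis by (simp add: inner_axis)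
  show ?thesis unfolding wedge3_def fun_eq_iff e by (simp add: algebra_simps)
qed

lemma robinson_3_form_iff:
  assumes g: "\<And>p. geod p"
  shows "robinson_3_form M (twist_endo M k) \<kappa> \<rho> \<longleftrightarrow> \<rho> = tau3 M \<kappa>"
proof -
  have ext: "screen_metric M p (twist_endo M k p (screen_class M p v)) (screen_class M p w) = eval2 (F p) v w"
    if "v \<in> perp M p" "w \<in> perp M p" for p v w
    using that A_perp[OF g] by (simp add: twist_endo_class[OF g] screen_metric_class g_A)
  have e: "extends_hermitian_form M (twist_endo M k) \<Omega> \<longleftrightarrow>
      smooth_tensor2 M \<Omega> \<and> (\<forall>p. transpose (\<Omega> p) = - \<Omega> p) \<and>
      (\<forall>p. \<forall>v\<in>perp M p. \<forall>w\<in>perp M p. eval2 (\<Omega> p) v w = eval2 (F p) v w)" for \<Omega>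
    unfolding extends_hermitian_form_def using ext by (metis (full_types))
  show ?thesis
  proof
    assume "robinson_3_form M (twist_endo M k) \<kappa> \<rho>"
    then obtain \<Omega> where \<Omega>: "extends_hermitian_form M (twist_endo M k) \<Omega>"
      "\<And>p a b c. \<rho> p a b c = 3 * skew3 (\<lambda>a b c. \<kappa> p $ a * \<Omega> p $ b $ c) a b c"
      unfolding robinson_3_form_def by blast
    have sk: "transpose (\<Omega> p) = - \<Omega> p" for p using \<Omega>(1) unfolding e by blast
    have "wedge3 (\<kappa> p) (\<Omega> p) = wedge3 (\<kappa> p) (F p)" for p
      by (rule wedge3_perp_cong[OF sk F_skew]) (use \<Omega>(1) e in blast)
    then show "\<rho> = tau3 M \<kappa>"
      by (simp add: fun_eq_iff \<Omega>(2) wedge3_skew3[OF sk] tau3_eq)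
  next
    assume "\<rho> = tau3 M \<kappa>"
    moreover have "extends_hermitian_form M (twist_endo M k) F"
      unfolding e using smooth_F F_skew by blast
    ultimately show "robinson_3_form M (twist_endo M k) \<kappa> \<rho>"
      unfolding robinson_3_form_def by (intro exI[of _ F]) (simp add: tau3_eq wedge3_skew3[OF F_skew])
  qed
qed

end

section \<open>The equivalence\<close>

lemma optical_geometry_manifold:
  fixes M :: "('a::{t2_space,second_countable_topology}, 'n::finite) optical_data"
  assumes "optical_geometry M"
  shows "optical_manifold M"
proof
  have og: "oriented_atlas (atlas M)" "smooth_tensor2 M (metric M)" "\<And>p. lorentzian (metric M p)"
    "time_orientation M" "null_line_distribution M"
    using assms by (auto simp: optical_geometry_def)
  show "oriented_atlas (atlas M)" "smooth_tensor2 M (metric M)" "\<And>p. lorentzian (metric M p)"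
    "time_orientation M" "null_line_distribution M" by (rule og)+
  show "transpose (metric M q) = metric M q" for q
    using og(3) by (simp add: lorentzian_def)
  show "invertible (metric M q)" for q
  proof -
    have l: "dim (line M q) = 1" "\<And>v. v \<in> line M q \<Longrightarrow> gform M q v v = 0"
      using og(5) by (auto simp: null_line_distribution_def)
    obtain v where v: "v \<in> line M q" "v \<noteq> 0"
    proof -
      have "\<not> line M q \<subseteq> {0}"
      proof
        assume "line M q \<subseteq> {0}"
        from dim_subset[OF this] show False using l(1) by simp
      qed
      with that show ?thesis by blast
    qed
    have "null_vector (metric M q) v"
      using og(3) l(2)[OF v(1)] v(2) by (simp add: null_vector_def)
    then show ?thesis by (rule null_vector.G_invertible)
  qed
qed

context optical_field
begin

text \<open>Dividing \<open>k\<close> by the square root of the conformal factor of its twist endomorphism makes the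
  endomorphism an isometry, hence a complex structure.\<close>

lemma normalised_field:
  assumes n: "CARD('n) \<ge> 4" and g: "\<And>p. geod p" and c: "\<And>p. \<exists>\<mu>>0. conformal p \<mu>"
  shows "\<exists>k'. optical_vector_field M k' \<and> twist_is_complex_structure M k'"
proof -
  obtain \<mu> where \<mu>: "\<And>p. \<mu> p > 0" "\<And>p. conformal p (\<mu> p)" using c by metis
  have s: "smooth_fun_on M UNIV \<mu>" by (rule conformal_factor_smooth[OF n g \<mu>(2)])
  define f where "f p = 1 / sqrt (\<mu> p)" for p
  have f: "smooth_fun_on M UNIV f" "f p > 0" "(f p)\<^sup>2 * \<mu> p = 1" for p
  proof -
    have "sqrt (\<mu> q) \<noteq> 0" for q using \<mu>(1)[of q] by simp
    then show "smooth_fun_on M UNIV f"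
      unfolding f_def
      by (intro smooth_fun_on_divide smooth_fun_on_sqrt smooth_fun_on_const open_UNIV s \<mu>(1))
    show "f p > 0" using \<mu>(1) by (simp add: f_def)
    show "(f p)\<^sup>2 * \<mu> p = 1" using \<mu>(1)[of p] by (simp add: f_def power_divide)
  qed
  define k' where "k' p = f p *\<^sub>R k p" for p
  have o: "optical_vector_field M k'"
    unfolding optical_vector_field_def
  proof (intro conjI allI ballI)
    show "smooth_vec_on M UNIV k'"
      unfolding k'_def by (intro smooth_vec_on_scaleR open_UNIV f k_smooth)
    show "k' p \<in> line M p" for p unfolding k'_def by (rule subspace_scale[OF line_subspace k_line])
    show "k' p \<noteq> 0" for p using f(2)[of p] k_nonzero by (simp add: k'_def)
    show "gform M p (k' p) t < 0" if "t \<in> future M p" for p t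
      using k_future[OF that] f(2)[of p] by (simp add: k'_def eval2_linear mult_pos_neg)
  qed
  interpret optical_pair M k k'
    by unfold_locales (rule o)
  have "other.conformal p 1" for p
    using conformal_rescale[OF g f(1) k'_def \<mu>(2)[of p]] by (simp only: f(3))
  then have "twist_is_complex_structure M k'"
    using other.twist_is_complex_structure_iff[OF other_geod[OF g]] by blast
  with o show ?thesis by blast
qed

text \<open>For spacelike \<open>v\<close>, the twist of \<open>k'\<close> on \<open>v\<close> and its image is the squared norm of that image.\<close>

lemma twisting_if_conformal:
  assumes n: "CARD('n) \<ge> 4" and g: "\<And>p. geod p" and c: "\<And>p. \<exists>\<mu>>0. conformal p \<mu>"
  shows "twisting M"
  unfolding twisting_def
proof (intro allI impI)
  fix k' p assume "optical_vector_field M k'"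
  then interpret optical_pair M k k' by unfold_locales
  obtain f where f: "smooth_fun_on M UNIV f" "\<And>p. k' p = f p *\<^sub>R k p" "\<And>p. f p > 0"
    using positive_ratio by blast
  obtain \<mu> where \<mu>: "\<mu> > 0" "conformal p \<mu>" using c by blast
  have c': "other.conformal p ((f p)\<^sup>2 * \<mu>)" by (rule conformal_rescale[OF g f(1,2) \<mu>(2)])
  have g': "other.geod p" by (rule other_geod[OF g])
  obtain v where v: "v \<in> perp M p" "gform M p v v > 0"
    using null_vector.spacelike_in_perp[OF null_vector n, of p] unfolding kappa_eq perp_iff by metis
  note Av = other.A_perp[OF g' v(1)]
  have "gform M p (other.A p v) (other.A p v) = (f p)\<^sup>2 * \<mu> * gform M p v v"
    using c' v(1) unfolding other.conformal_def by blast
  also have "\<dots> > 0" using f(3)[of p] \<mu>(1) v(2) by simp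
  finally have "twist M k' p (screen_class M p v) (screen_class M p (other.A p v)) \<noteq> 0"
    unfolding other.twist_class[OF g' v(1) Av] other.g_A by simp
  then show "\<exists>V\<in>screen M p. \<exists>W\<in>screen M p. twist M k' p V W \<noteq> 0"
    using screen_class_in[OF v(1)] screen_class_in[OF Av] by blast
qed

end

lemma (in optical_pair) complex_structure_unique:
  assumes n: "CARD('n) \<ge> 4" and g: "\<And>p. geod p"
    and c: "twist_is_complex_structure M k" "twist_is_complex_structure M k'"
  shows "k' = k"
proof
  fix p
  obtain f where f: "smooth_fun_on M UNIV f" "\<And>p. k' p = f p *\<^sub>R k p" "\<And>p. f p > 0"
    using positive_ratio by blast
  have "conformal p 1" "other.conformal p 1"
    using c twist_is_complex_structure_iff[OF g] other.twist_is_complex_structure_iff[OF other_geod[OF g]]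
    by blast+
  with conformal_rescale[OF g f(1,2)] have "(f p)\<^sup>2 * 1 = 1"
    by (intro other.conformal_unique[OF n])
  then have "f p = 1" using f(3)[of p] by (simp add: power2_eq_1_iff)
  then show "k' p = k p" by (simp add: f(2))
qed

theorem proposition4p34:
  fixes M :: "('a::{t2_space,second_countable_topology}, 'n::finite) optical_data"
    and \<kappa> :: "'a \<Rightarrow> real^'n" and m :: nat
  assumes "optical_geometry M"
    and "CARD('n) = 2 * m + 2" and "m \<ge> 1"
    and "optical_form M \<kappa>"
  shows
    "((\<forall>p. (\<forall>a b c d.
           (\<Sum>e\<in>UNIV. raise3 (metric M p) (tau3 M \<kappa> p) a b e * tau3 M \<kappa> p e c d) =
             - (2 / real m) * skew_square (metric M p) (tau3 M \<kappa> p) a b c d) \<and>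
         (\<exists>a b c d. - (2 / real m) * skew_square (metric M p) (tau3 M \<kappa> p) a b c d \<noteq> 0))
      \<longleftrightarrow>
      (geodesic M \<and> twisting M \<and>
       (\<exists>!k. optical_vector_field M k \<and> twist_is_complex_structure M k)))
     \<and>
     (geodesic M \<and> twisting M \<longrightarrow>
       (\<forall>k. optical_vector_field M k \<and> twist_is_complex_structure M k \<longrightarrow>
          almost_robinson_structure M (robinson_distribution M (twist_endo M k)) \<and>
          (\<exists>!\<rho>. robinson_3_form M (twist_endo M k) (flat M k) \<rho>) \<and>
          robinson_3_form M (twist_endo M k) (flat M k) (tau3 M (flat M k))))"
proof -
  interpret optical_manifold M by (rule optical_geometry_manifold[OF assms(1)])
  obtain k0 where k0: "optical_vector_field M k0" and \<kappa>: "\<kappa> = flat M k0"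
    using assms(4) by (auto simp: optical_form_def)
  interpret k0: optical_field M k0 by unfold_locales (rule k0)
  have n: "CARD('n) \<ge> 4" using assms(2,3) by simp
  have field: "optical_field M k" if "optical_vector_field M k" for k
    by unfold_locales (rule that)
  have pair: "optical_pair M k k'" if "optical_vector_field M k" "optical_vector_field M k'" for k k'
    using that by (simp add: optical_pair_def field)
  let ?uniq = "\<exists>!k. optical_vector_field M k \<and> twist_is_complex_structure M k"
  let ?conf = "\<forall>p. k0.geod p \<and> (\<exists>\<mu>>0. k0.conformal p \<mu>)"
  have 2: "?conf \<longleftrightarrow> geodesic M \<and> twisting M \<and> ?uniq"
  proof
    assume conf: ?conf
    then have g: "\<And>p. k0.geod p" and c: "\<And>p. \<exists>\<mu>>0. k0.conformal p \<mu>" by blast+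
    have geod: "geodesic M" using g k0.geodesic_iff by blast
    have "k2 = k1"
      if 1: "optical_vector_field M k1" "twist_is_complex_structure M k1"
        and 2: "optical_vector_field M k2" "twist_is_complex_structure M k2" for k1 k2
    proof -
      interpret optical_pair M k1 k2 by (rule pair[OF 1(1) 2(1)])
      show ?thesis
        by (rule complex_structure_unique[OF n _ 1(2) 2(2)]) (use geod geodesic_iff in blast)
    qed
    then have ?uniq using k0.normalised_field[OF n g c] by blast
    with geod k0.twisting_if_conformal[OF n g c] show "geodesic M \<and> twisting M \<and> ?uniq" by blast
  next
    assume R: "geodesic M \<and> twisting M \<and> ?uniq"
    then obtain k where k: "optical_vector_field M k" "twist_is_complex_structure M k" by blast
    interpret optical_pair M k k0 by (rule pair[OF k(1) k0])
    have g: "\<And>p. geod p" using R geodesic_iff by blast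
    obtain f where f: "smooth_fun_on M UNIV f" "\<And>p. k0 p = f p *\<^sub>R k p" "\<And>p. f p > 0"
      using positive_ratio by blast
    have "k0.conformal p ((f p)\<^sup>2 * 1)" for p
      using conformal_rescale[OF g f(1,2)] k(2) twist_is_complex_structure_iff[OF g] by blast
    moreover have "(f p)\<^sup>2 * 1 > 0" for p using f(3)[of p] by simp
    ultimately show ?conf using other_geod[OF g] by blast
  qed
  have 3: "almost_robinson_structure M (robinson_distribution M (twist_endo M k)) \<and>
      (\<exists>!\<rho>. robinson_3_form M (twist_endo M k) (flat M k) \<rho>) \<and>
      robinson_3_form M (twist_endo M k) (flat M k) (tau3 M (flat M k))"
    if geod: "geodesic M" and k: "optical_vector_field M k" "twist_is_complex_structure M k" for k
  proof -
    interpret k: optical_field M k by (rule field[OF k(1)])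
    have g: "\<And>p. k.geod p" using geod k.geodesic_iff by blast
    have c: "\<And>p. k.conformal p 1" using k(2) k.twist_is_complex_structure_iff[OF g] by blast
    show ?thesis
      using k.robinson_distribution_almost_robinson[OF g c] unfolding k.robinson_3_form_iff[OF g] by simp
  qed
  show ?thesis
    unfolding \<kappa> k0.equation_iff_conformal[OF assms(2,3)] 2 using 3 by blast
qed

end
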